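(* Let $r_{\mathrm{crit}}(n)$ denote the threshold value of $r$ below which the restriction to $\mathrm{Seg}_{n,r}$ of the class $d\theta_1\wedge\cdots\wedge d\theta_n$ is nonzero and above which it is zero. Then $$\lim_{n\to\infty} r_{\mathrm{crit}}(n) < 1.$$
   Context: $D^2$ is the closed unit disk in $\mathbb{R}^2$. For $n\ge 1$, $r>0$, $\mathrm{Seg}_{n,r}$ is the space of configurations of $n$ disjoint, labeled, oriented line segments of length $r$ contained in $D^2$. A configuration is specified by the center of each segment and the unit vector giving its direction, so $\mathrm{Seg}_{n,r}$ is topologized as a subspace of $\mathrm{Seg}_n := \mathrm{Conf}_n(D^2)\times (S^1)^n$, where $\mathrm{Conf}_n(D^2)$ is the space of ordered $n$-tuples of distinct points of $D^2$. Let $\alpha_n:\mathrm{Seg}_n\to (S^1)^n$ be the projection (the angle map) and $i_{n,r}:\mathrm{Seg}_{n,r}\to \mathrm{Seg}_n$ the inclusion. Cohomology is singular cohomology with integer coefficients. Writing $d\theta$ for the generator of $H^1(S^1)$, $d\theta_1\wedge\cdots\wedge d\theta_n\in H^n(\mathrm{Seg}_n)$ denotes the pullback by $\alpha_n$ of the fundamental cohomology class of $(S^1)^n$, and its restriction to $\mathrm{Seg}_{n,r}$ is $i_{n,r}^*(d\theta_1\wedge\cdots\wedge d\theta_n)\in H^n(\mathrm{Seg}_{n,r})$. Thus $r_{\mathrm{crit}}(n)=\sup\{r>0 : i_{n,r}^*(d\theta_1\wedge\cdots\wedge d\theta_n)\ne 0\}$. *)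

theory Defs
  imports "HOL-Homology.Homology"
begin

text \<open>Singular cohomology with integer coefficients. A \<open>p\<close>-cochain is an integer-valued function
  on the singular \<open>p\<close>-simplices, which is the same as a homomorphism from the free abelian group
  \<^const>\<open>chain_group\<close> to the integers. As for products of groups, functions are extensional.\<close>

type_synonym 'a cochain = "((nat \<Rightarrow> real) \<Rightarrow> 'a) \<Rightarrow> int"

definition cochain_group :: "nat \<Rightarrow> 'a topology \<Rightarrow> 'a cochain monoid"
  where "cochain_group p X = product_group (singular_simplex_set p X) (\<lambda>_. integer_group)"

text \<open>This is the transpose of \<^term>\<open>chain_boundary (Suc p)\<close>, evaluated on a single simplex.\<close>

definition cochain_coboundary :: "nat \<Rightarrow> 'a topology \<Rightarrow> 'a cochain \<Rightarrow> 'a cochain"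
  where "cochain_coboundary p X \<phi> =
    (\<lambda>\<sigma>\<in>singular_simplex_set (Suc p) X. \<Sum>k\<le>Suc p. (-1) ^ k * \<phi> (singular_face (Suc p) k \<sigma>))"

definition singular_cocycle_set :: "nat \<Rightarrow> 'a topology \<Rightarrow> 'a cochain set"
  where "singular_cocycle_set p X =
    {\<phi> \<in> carrier (cochain_group p X). cochain_coboundary p X \<phi> = \<one>\<^bsub>cochain_group (Suc p) X\<^esub>}"

definition singular_coboundary_set :: "nat \<Rightarrow> 'a topology \<Rightarrow> 'a cochain set"
  where "singular_coboundary_set p X =
    (case p of 0 \<Rightarrow> {\<one>\<^bsub>cochain_group 0 X\<^esub>}
     | Suc q \<Rightarrow> cochain_coboundary q X ` carrier (cochain_group q X))"

definition cohomology_group :: "nat \<Rightarrow> 'a topology \<Rightarrow> 'a cochain set monoid"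
  where "cohomology_group p X =
    subgroup_generated (cochain_group p X) (singular_cocycle_set p X) Mod singular_coboundary_set p X"

definition cohomology_class :: "nat \<Rightarrow> 'a topology \<Rightarrow> 'a cochain \<Rightarrow> 'a cochain set"
  where "cohomology_class p X \<phi> = singular_coboundary_set p X #>\<^bsub>cochain_group p X\<^esub> \<phi>"

definition cochain_map :: "nat \<Rightarrow> 'a topology \<Rightarrow> ('a \<Rightarrow> 'b) \<Rightarrow> 'b cochain \<Rightarrow> 'a cochain"
  where "cochain_map p X f \<phi> = (\<lambda>\<sigma>\<in>singular_simplex_set p X. \<phi> (simplex_map p f \<sigma>))"

text \<open>Operations on cohomology classes are unions over all representatives; on actual cohomology
  classes all the sets in the union coincide.\<close>

definition cohomology_induced ::
    "nat \<Rightarrow> 'a topology \<Rightarrow> ('a \<Rightarrow> 'b) \<Rightarrow> 'b cochain set \<Rightarrow> 'a cochain set"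
  where "cohomology_induced p X f A = (\<Union>\<phi>\<in>A. cohomology_class p X (cochain_map p X f \<phi>))"

text \<open>The face spanned by the first \<open>p + 1\<close>, respectively the last \<open>q + 1\<close>, vertices of a singular
  \<open>p + q\<close>-simplex.\<close>

definition front_face :: "nat \<Rightarrow> ((nat \<Rightarrow> real) \<Rightarrow> 'a) \<Rightarrow> (nat \<Rightarrow> real) \<Rightarrow> 'a"
  where "front_face p \<sigma> = restrict \<sigma> (standard_simplex p)"

definition back_face :: "nat \<Rightarrow> nat \<Rightarrow> ((nat \<Rightarrow> real) \<Rightarrow> 'a) \<Rightarrow> (nat \<Rightarrow> real) \<Rightarrow> 'a"
  where "back_face p q \<sigma> = (\<lambda>x\<in>standard_simplex q. \<sigma> (\<lambda>i. if i < p then 0 else x (i - p)))"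

definition cochain_cup ::
    "nat \<Rightarrow> nat \<Rightarrow> 'a topology \<Rightarrow> 'a cochain \<Rightarrow> 'a cochain \<Rightarrow> 'a cochain"
  where "cochain_cup p q X \<phi> \<psi> =
    (\<lambda>\<sigma>\<in>singular_simplex_set (p + q) X. \<phi> (front_face p \<sigma>) * \<psi> (back_face p q \<sigma>))"

definition cohomology_cup ::
    "nat \<Rightarrow> nat \<Rightarrow> 'a topology \<Rightarrow> 'a cochain set \<Rightarrow> 'a cochain set \<Rightarrow> 'a cochain set"
  where "cohomology_cup p q X A B =
    (\<Union>\<phi>\<in>A. \<Union>\<psi>\<in>B. cohomology_class (p + q) X (cochain_cup p q X \<phi> \<psi>))"

definition cohomology_unit :: "'a topology \<Rightarrow> 'a cochain set"
  where "cohomology_unit X = cohomology_class 0 X (\<lambda>\<sigma>\<in>singular_simplex_set 0 X. 1)"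

text \<open>The product \<open>a 0 \<union> \<dots> \<union> a (n - 1)\<close> of classes of degree one.\<close>

primrec iterated_cup :: "'a topology \<Rightarrow> (nat \<Rightarrow> 'a cochain set) \<Rightarrow> nat \<Rightarrow> 'a cochain set"
  where
    "iterated_cup X a 0 = cohomology_unit X"
  | "iterated_cup X a (Suc n) = cohomology_cup n 1 X (iterated_cup X a n) (a n)"


text \<open>The plane is \<^typ>\<open>complex\<close>, and the labels are \<open>0, \<dots>, n - 1\<close>. A point of \<open>Seg n\<close> is a pair
  consisting of the family of centers and the family of unit direction vectors.\<close>

definition circle :: "complex topology"
  where "circle = top_of_set (sphere 0 1)"

definition torus :: "nat \<Rightarrow> (nat \<Rightarrow> complex) topology"
  where "torus n = product_topology (\<lambda>_. circle) {..<n}"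

definition Conf_disk :: "nat \<Rightarrow> (nat \<Rightarrow> complex) topology"
  where "Conf_disk n =
    subtopology (product_topology (\<lambda>_. top_of_set (cball 0 1)) {..<n}) {c. inj_on c {..<n}}"

definition Seg :: "nat \<Rightarrow> ((nat \<Rightarrow> complex) \<times> (nat \<Rightarrow> complex)) topology"
  where "Seg n = prod_topology (Conf_disk n) (torus n)"

definition segment :: "real \<Rightarrow> complex \<Rightarrow> complex \<Rightarrow> complex set"
  where "segment r c u = closed_segment (c - (r / 2) *\<^sub>R u) (c + (r / 2) *\<^sub>R u)"

definition Seg_length :: "nat \<Rightarrow> real \<Rightarrow> ((nat \<Rightarrow> complex) \<times> (nat \<Rightarrow> complex)) topology"
  where "Seg_length n r = subtopology (Seg n)
    {(c, u). (\<forall>i<n. segment r (c i) (u i) \<subseteq> cball 0 1) \<and>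
             disjoint_family_on (\<lambda>i. segment r (c i) (u i)) {..<n}}"

definition angle_map :: "(nat \<Rightarrow> complex) \<times> (nat \<Rightarrow> complex) \<Rightarrow> nat \<Rightarrow> complex"
  where "angle_map = snd"

definition Seg_inclusion ::
    "(nat \<Rightarrow> complex) \<times> (nat \<Rightarrow> complex) \<Rightarrow> (nat \<Rightarrow> complex) \<times> (nat \<Rightarrow> complex)"
  where "Seg_inclusion = id"

text \<open>Below, \<open>d\<theta>\<close> is a generator of the first cohomology group of the circle. The fundamental
  cohomology class of the torus is the cup product of its pullbacks along the coordinate
  projections.\<close>

definition torus_class :: "complex cochain set \<Rightarrow> nat \<Rightarrow> (nat \<Rightarrow> complex) cochain set"
  where "torus_class d\<theta> n =
    iterated_cup (torus n) (\<lambda>i. cohomology_induced 1 (torus n) (\<lambda>u. u i) d\<theta>) n"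

definition Seg_class ::
    "complex cochain set \<Rightarrow> nat \<Rightarrow> ((nat \<Rightarrow> complex) \<times> (nat \<Rightarrow> complex)) cochain set"
  where "Seg_class d\<theta> n = cohomology_induced n (Seg n) angle_map (torus_class d\<theta> n)"

definition r_crit :: "complex cochain set \<Rightarrow> nat \<Rightarrow> real"
  where "r_crit d\<theta> n = Sup {r. 0 < r \<and>
    cohomology_induced n (Seg_length n r) Seg_inclusion (Seg_class d\<theta> n)
      \<noteq> \<one>\<^bsub>cohomology_group n (Seg_length n r)\<^esub>}"

end

theory Submission
  imports Defs "HOL-Analysis.Further_Topology" "HOL-Combinatorics.Permutations"
begin

text \<open>
Write \<open>\<phi>\<close> for a cocycle that represents \<open>d\<theta>\<close>. On \<open>Seg_length n r\<close> the restricted class is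
represented by an explicit cocycle, \<open>angle_product \<phi> n r\<close>: its value on a singular simplex is the
product over \<open>i < n\<close> of the values of \<open>\<phi>\<close> on the \<open>i\<close>th angle along the edge from vertex \<open>i\<close> to vertex
\<open>i + 1\<close>. If this cocycle is a coboundary for \<open>n\<close> segments of length \<open>r\<close>, then it is one for \<open>n + 1\<close>
segments, by pulling back along the map that forgets a segment. Hence the critical lengths decrease
with \<open>n\<close>. It is not a coboundary for small \<open>r\<close>: with fixed centers all angles are free, and the
cocycle takes a nonzero value on the fundamental cycle of the torus (\<open>angle_product_nonzero\<close>). So the
critical lengths are positive, and they converge. It remains to find one \<open>n\<close> and one \<open>R < 1\<close> such that
the cocycle is a coboundary for all \<open>r \<ge> R\<close> (\<open>angle_product_vanishes\<close>, with \<open>R = 1 - 1/10^6\<close>).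

The criterion for vanishing is a cup length argument (\<open>edge_product_coboundary_of_open_cover\<close>): the
product is zero if the space is covered by open sets \<open>U i\<close>, one for each label, such that the angle of
segment \<open>i\<close> lifts to a real function on \<open>U i\<close>. Since an angle that avoids a direction lifts, it is
enough that on \<open>U i\<close> the direction of segment \<open>i\<close> avoids a target direction that is allowed to depend on
the configuration in a locally constant way.

Split the labels into six groups of \<open>K\<close> segments, \<open>K\<close> large, and ask each group to point nearly in one
common direction. Suppose that the segments of a group all cross a common strip perpendicular to that
direction. Being disjoint, they are linearly ordered across the strip, and the order is locally
constant. Let the targets be alternately tilted to the left and to the right in this order. Every
second segment that attains its target moves the next one sideways by a fixed amount, so for large \<open>K\<close>
the segments do not fit into the disk if all of them attain their targets; hence the sets \<open>U i\<close> of the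
group cover the configurations in question (\<open>group_cover\<close>).

Two segments of a group fail to cross a common strip only if one of them lies beyond the other, and
for lengths close to 1 this forces both to be almost radial. Four groups point east, north, west and
south. If such a group is not covered, then it contains a segment that is almost a radius in this
direction. Two more groups point east and north, and here a locally constant choice between two strips
is made, one on each side of the center; if such a group is not covered, it contains a segment that
reaches a fixed distance to both sides of the center. A configuration that is covered by none of the
six groups would thus contain radial segments in the four directions of the compass, together with a
horizontal and a vertical segment. The east and west radii confine the vertical segment to the center,
the north and south radii confine the horizontal one, and so these two cross
(\<open>compass_contradiction\<close>).
\<close>

section \<open>Evaluation of cochains on chains\<close>

text \<open>Evaluation goes through the free abelian group on one point, where additivity of \<open>frag_extend\<close> applies.\<close>

definition chain_eval :: "'a cochain \<Rightarrow> 'a chain \<Rightarrow> int"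
  where "chain_eval \<phi> c =
    poly_mapping.lookup (frag_extend (\<lambda>\<sigma>. frag_cmul (\<phi> \<sigma>) (frag_of ())) c) ()"

lemma chain_eval_0 [simp]: "chain_eval \<phi> 0 = 0"
  by (simp add: chain_eval_def)

lemma chain_eval_of [simp]: "chain_eval \<phi> (frag_of \<sigma>) = \<phi> \<sigma>"
  by (simp add: chain_eval_def)

lemma chain_eval_cmul [simp]: "chain_eval \<phi> (frag_cmul k c) = k * chain_eval \<phi> c"
  by (simp add: chain_eval_def frag_extend_cmul)

lemma chain_eval_add: "chain_eval \<phi> (a + b) = chain_eval \<phi> a + chain_eval \<phi> b"
  by (simp add: chain_eval_def frag_extend_add lookup_add)

lemma chain_eval_diff: "chain_eval \<phi> (a - b) = chain_eval \<phi> a - chain_eval \<phi> b"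
  by (simp add: chain_eval_def frag_extend_diff lookup_minus)

lemma chain_eval_sum: "finite I \<Longrightarrow> chain_eval \<phi> (sum f I) = (\<Sum>i\<in>I. chain_eval \<phi> (f i))"
  by (induction I rule: finite_induct) (simp_all add: chain_eval_add)

lemma chain_eval_eq_0:
  assumes "\<And>\<sigma>. \<sigma> \<in> Poly_Mapping.keys c \<Longrightarrow> \<phi> \<sigma> = 0"
  shows "chain_eval \<phi> c = 0"
  using assms by (simp add: chain_eval_def frag_extend_eq_0)

lemma chain_eval_extend:
  "chain_eval (\<lambda>\<sigma>. chain_eval \<phi> (f \<sigma>)) c = chain_eval \<phi> (frag_extend f c)"
  using subset_UNIV
proof (induction c rule: frag_induction)
  case (diff a b)
  then show ?case by (simp add: chain_eval_diff frag_extend_diff)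
qed auto

lemma chain_eval_cong:
  assumes "singular_chain p X c" "\<And>\<sigma>. singular_simplex p X \<sigma> \<Longrightarrow> \<phi> \<sigma> = \<psi> \<sigma>"
  shows "chain_eval \<phi> c = chain_eval \<psi> c"
  using assms(1) unfolding singular_chain_def
  by (induction c rule: frag_induction) (auto simp: assms chain_eval_diff)

lemma chain_eval_boundary_of:
  "chain_eval \<phi> (chain_boundary (Suc p) (frag_of \<sigma>))
    = (\<Sum>k\<le>Suc p. (-1) ^ k * \<phi> (singular_face (Suc p) k \<sigma>))"
  by (simp add: chain_boundary_of chain_eval_sum del: sum.atMost_Suc)

lemma chain_eval_coboundary:
  assumes "singular_chain (Suc p) X c"
  shows "chain_eval (cochain_coboundary p X \<phi>) c = chain_eval \<phi> (chain_boundary (Suc p) c)"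
  using assms unfolding singular_chain_def
proof (induction c rule: frag_induction)
  case (one \<sigma>)
  then show ?case
    by (simp add: chain_eval_boundary_of cochain_coboundary_def del: sum.atMost_Suc)
qed (auto simp: chain_boundary_diff chain_eval_diff)

section \<open>Cochain groups\<close>

abbreviation simplex_space :: "nat \<Rightarrow> (nat \<Rightarrow> real) topology"
  where "simplex_space p \<equiv> subtopology (powertop_real UNIV) (standard_simplex p)"

lemma singular_simplex_face:
  "singular_simplex (Suc p) X \<sigma> \<Longrightarrow> k \<le> Suc p \<Longrightarrow> singular_simplex p X (singular_face (Suc p) k \<sigma>)"
  using singular_simplex_singular_face[of "Suc p" X \<sigma> k] by simp

lemma carrier_cochain_group:
  "carrier (cochain_group p X) = extensional (singular_simplex_set p X)"
  by (simp add: cochain_group_def PiE_def Pi_def)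

lemma one_cochain_group: "\<one>\<^bsub>cochain_group p X\<^esub> = (\<lambda>\<sigma>\<in>singular_simplex_set p X. 0)"
  by (simp add: cochain_group_def)

lemma mult_cochain_group:
  "\<phi> \<otimes>\<^bsub>cochain_group p X\<^esub> \<psi> = (\<lambda>\<sigma>\<in>singular_simplex_set p X. \<phi> \<sigma> + \<psi> \<sigma>)"
  by (simp add: cochain_group_def)

lemma group_cochain_group: "group (cochain_group p X)"
  by (simp add: cochain_group_def)

lemma singular_cocycle_set_iff:
  "\<phi> \<in> singular_cocycle_set p X \<longleftrightarrow> \<phi> \<in> extensional (singular_simplex_set p X) \<and>
    (\<forall>\<sigma>. singular_simplex (Suc p) X \<sigma> \<longrightarrow>
      (\<Sum>k\<le>Suc p. (-1) ^ k * \<phi> (singular_face (Suc p) k \<sigma>)) = 0)"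
  by (auto simp: singular_cocycle_set_def carrier_cochain_group one_cochain_group
      cochain_coboundary_def fun_eq_iff restrict_def simp del: sum.atMost_Suc)

lemma chain_eval_cocycle_boundary:
  assumes "\<phi> \<in> singular_cocycle_set p X" "singular_chain (Suc p) X c"
  shows "chain_eval \<phi> (chain_boundary (Suc p) c) = 0"
proof -
  have "chain_eval (cochain_coboundary p X \<phi>) c = 0"
    using assms by (intro chain_eval_eq_0) (auto simp: singular_cocycle_set_def one_cochain_group
      singular_chain_def)
  then show ?thesis using chain_eval_coboundary[OF assms(2)] by metis
qed

section \<open>Small simplices\<close>

definition small_chain :: "'a set set \<Rightarrow> nat \<Rightarrow> 'a topology \<Rightarrow> 'a chain \<Rightarrow> bool"
  where "small_chain \<C> p X c \<longleftrightarrow>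
    Poly_Mapping.keys c \<subseteq> {\<sigma>. singular_simplex p X \<sigma> \<and> (\<exists>V\<in>\<C>. \<sigma> \<in> standard_simplex p \<rightarrow> V)}"

lemma small_chain_0 [simp]: "small_chain \<C> p X 0"
  by (simp add: small_chain_def)

lemma small_chain_diff: "small_chain \<C> p X a \<Longrightarrow> small_chain \<C> p X b \<Longrightarrow> small_chain \<C> p X (a - b)"
  unfolding small_chain_def using keys_diff [of a b] by blast

lemma small_chain_subtopology:
  "V \<in> \<C> \<Longrightarrow> singular_chain p (subtopology X V) c \<Longrightarrow> small_chain \<C> p X c"
  by (auto simp: small_chain_def singular_chain_def singular_simplex_subtopology subset_iff image_subset_iff Pi_iff)

text \<open>A sufficiently fine iterated subdivision of \<open>z\<close> is small. It differs from \<open>z\<close> by a boundary and by the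
image of \<open>\<partial>z\<close> under the subdivision homotopy, and this homotopy keeps chains inside any subspace that
contains them, in particular inside the members of the cover.\<close>

lemma boundary_mod_small:
  assumes opn: "\<And>V. V \<in> \<C> \<Longrightarrow> openin X V" and cover: "topspace X \<subseteq> \<Union>\<C>"
    and z: "singular_chain (Suc q) X z" and bz: "small_chain \<C> q X (chain_boundary (Suc q) z)"
  shows "\<exists>d. singular_chain (Suc (Suc q)) X d \<and>
             small_chain \<C> (Suc q) X (z - chain_boundary (Suc (Suc q)) d)"
proof -
  obtain n where n: "\<And>m f. \<lbrakk>n \<le> m; f \<in> Poly_Mapping.keys ((singular_subdivision (Suc q) ^^ m) z)\<rbrakk>
                      \<Longrightarrow> \<exists>V \<in> \<C>. f \<in> standard_simplex (Suc q) \<rightarrow> V"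
    using sufficient_iterated_singular_subdivision_exists[OF opn cover z] by blast
  obtain h where h0: "\<And>p. h p 0 = (0 :: 'a chain)"
     and hd: "\<And>p c1 c2. h p (c1-c2) = h p c1 - h p c2"
     and hs: "\<And>p X c. singular_chain p X c \<Longrightarrow> singular_chain (Suc p) X (h p c)"
     and hb: "\<And>p X c. singular_chain p X c
                 \<Longrightarrow> chain_boundary (Suc p) (h p c) + h (p - Suc 0) (chain_boundary p c)
                   = (singular_subdivision p ^^ n) c - c"
    by (rule chain_homotopic_iterated_singular_subdivision[where n=n]) (rule that)
  let ?sd = "(singular_subdivision (Suc q) ^^ n) z"
  have "singular_chain (Suc q) X ((singular_subdivision (Suc q) ^^ m) z)" for m
    by (induction m) (auto simp: z singular_chain_singular_subdivision)
  then have sd: "small_chain \<C> (Suc q) X ?sd"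
    using n[OF order_refl] by (fastforce simp: small_chain_def singular_chain_def)
  have hsmall: "small_chain \<C> (Suc q) X (h q c)" if "small_chain \<C> q X c" for c
    using that unfolding small_chain_def[of _ q]
  proof (induction c rule: frag_induction)
    case (one \<sigma>)
    then obtain V where "V \<in> \<C>" "singular_simplex q X \<sigma>" "\<sigma> \<in> standard_simplex q \<rightarrow> V" by blast
    then show ?case
      by (intro small_chain_subtopology[of V] hs)
         (auto simp: singular_chain_of singular_simplex_subtopology)
  qed (auto simp: h0 hd small_chain_diff)
  have "z - chain_boundary (Suc (Suc q)) (- h (Suc q) z) = ?sd - h q (chain_boundary (Suc q) z)"
    using hb[OF z] by (simp add: chain_boundary_minus algebra_simps)
  then show ?thesis
    by (metis hs singular_chain_minus small_chain_diff sd hsmall bz z)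
qed

text \<open>The singular complex modulo small chains is free and acyclic, hence contractible. The contraction is
built degree by degree: \<open>\<sigma> - D (\<partial>\<sigma>)\<close> has a small boundary, so it is itself a boundary up to a small
chain, and \<open>D \<sigma>\<close> is chosen to have that boundary.\<close>

lemma contraction_mod_small:
  assumes opn: "\<And>V. V \<in> \<C> \<Longrightarrow> openin X V" and cover: "topspace X \<subseteq> \<Union>\<C>"
  obtains D where
    "\<And>q \<sigma>. singular_simplex q X \<sigma> \<Longrightarrow> singular_chain (Suc q) X (D q \<sigma>)"
    "\<And>q \<sigma>. singular_simplex (Suc q) X \<sigma> \<Longrightarrow> small_chain \<C> (Suc q) X
       (frag_of \<sigma> - frag_extend (D q) (chain_boundary (Suc q) (frag_of \<sigma>))
          - chain_boundary (Suc (Suc q)) (D (Suc q) \<sigma>))"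
proof -
  define P where "P q D \<longleftrightarrow> (\<forall>\<sigma>. singular_simplex q X \<sigma> \<longrightarrow> singular_chain (Suc q) X (D \<sigma>)) \<and>
     (\<forall>c. singular_chain q X c \<and> chain_boundary q c = 0 \<longrightarrow>
        small_chain \<C> q X (c - chain_boundary (Suc q) (frag_extend D c)))" for q D
  define Q where "Q q D D' \<longleftrightarrow> (\<forall>\<sigma>. singular_simplex (Suc q) X \<sigma> \<longrightarrow> small_chain \<C> (Suc q) X
       (frag_of \<sigma> - frag_extend D (chain_boundary (Suc q) (frag_of \<sigma>))
          - chain_boundary (Suc (Suc q)) (D' \<sigma>)))"
    for q and D D' :: "((nat \<Rightarrow> real) \<Rightarrow> 'a) \<Rightarrow> 'a chain"
  \<comment> \<open>A simplex of dimension 0 is a point, hence small.\<close>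
  have base: "P 0 (\<lambda>_. 0)"
  proof -
    have "small_chain \<C> 0 X c" if "singular_chain 0 X c" for c
    proof -
      have "\<exists>V\<in>\<C>. \<sigma> \<in> standard_simplex 0 \<rightarrow> V" if "singular_simplex 0 X \<sigma>" for \<sigma>
      proof -
        have "\<sigma> (\<lambda>j. if j = 0 then 1 else 0) \<in> topspace X"
          using that by (auto simp: singular_simplex_def standard_simplex_0 continuous_map_def Pi_iff)
        then show ?thesis using cover by (auto simp: standard_simplex_0)
      qed
      then show ?thesis using that by (auto simp: small_chain_def singular_chain_def)
    qed
    then show ?thesis by (simp add: P_def frag_extend_eq_0)
  qed
  have step: "\<exists>D'. P (Suc q) D' \<and> Q q D D'" if "P q D" for q D
  proof -
    have ex: "\<exists>d. singular_chain (Suc (Suc q)) X d \<and> small_chain \<C> (Suc q) X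
       (frag_of \<sigma> - frag_extend D (chain_boundary (Suc q) (frag_of \<sigma>))
          - chain_boundary (Suc (Suc q)) d)" if \<sigma>: "singular_simplex (Suc q) X \<sigma>" for \<sigma>
    proof -
      let ?b = "chain_boundary (Suc q) (frag_of \<sigma>)"
      have fs: "singular_chain (Suc q) X (frag_of \<sigma>)" using \<sigma> by (simp add: singular_chain_of)
      have b: "singular_chain q X ?b" using singular_chain_boundary_alt[OF fs] .
      have bb: "chain_boundary q ?b = 0" using chain_boundary_boundary[OF fs] by simp
      have Db: "singular_chain (Suc q) X (frag_extend D ?b)"
        using \<open>P q D\<close> b by (intro singular_chain_extend) (auto simp: P_def singular_chain_def)
      show ?thesis
      proof (rule boundary_mod_small[OF opn cover])
        show "singular_chain (Suc q) X (frag_of \<sigma> - frag_extend D ?b)"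
          by (intro singular_chain_diff fs Db)
        show "small_chain \<C> q X (chain_boundary (Suc q) (frag_of \<sigma> - frag_extend D ?b))"
          using \<open>P q D\<close> b bb by (simp add: P_def chain_boundary_diff)
      qed auto
    qed
    then obtain D' where D': "\<And>\<sigma>. singular_simplex (Suc q) X \<sigma> \<Longrightarrow> singular_chain (Suc (Suc q)) X (D' \<sigma>)"
      and sm: "\<And>\<sigma>. singular_simplex (Suc q) X \<sigma> \<Longrightarrow> small_chain \<C> (Suc q) X
       (frag_of \<sigma> - frag_extend D (chain_boundary (Suc q) (frag_of \<sigma>))
          - chain_boundary (Suc (Suc q)) (D' \<sigma>))" by metis
    have "small_chain \<C> (Suc q) X (c - frag_extend D (chain_boundary (Suc q) c)
          - chain_boundary (Suc (Suc q)) (frag_extend D' c))" if "singular_chain (Suc q) X c" for c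
      using that unfolding singular_chain_def
    proof (induction c rule: frag_induction)
      case (one \<sigma>)
      then show ?case using sm by auto
    next
      case (diff a b)
      have "a - b - frag_extend D (chain_boundary (Suc q) (a - b))
          - chain_boundary (Suc (Suc q)) (frag_extend D' (a - b)) =
         (a - frag_extend D (chain_boundary (Suc q) a)
          - chain_boundary (Suc (Suc q)) (frag_extend D' a)) -
         (b - frag_extend D (chain_boundary (Suc q) b)
          - chain_boundary (Suc (Suc q)) (frag_extend D' b))"
        by (simp add: chain_boundary_diff frag_extend_diff algebra_simps)
      then show ?case using diff by (metis small_chain_diff)
    qed auto
    then have "P (Suc q) D'" using D' by (auto simp: P_def) fastforce
    moreover have "Q q D D'" using sm by (simp add: Q_def)
    ultimately show ?thesis by blast
  qed
  obtain f where "\<And>n. P n (f n)" "\<And>n. Q n (f n) (f (Suc n))"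
    using dependent_nat_choice[of P Q] base step by metis
  then show ?thesis by (intro that[of f]) (auto simp: P_def Q_def)
qed

text \<open>The transpose of the contraction, \<open>\<psi> = \<phi> \<circ> D\<close>, is a primitive: in
\<open>\<sigma> = D (\<partial>\<sigma>) + \<partial>(D \<sigma>) + small\<close> the cocycle kills the last two terms.\<close>

lemma small_cocycle_is_coboundary:
  assumes opn: "\<And>V. V \<in> \<C> \<Longrightarrow> openin X V" and cover: "topspace X \<subseteq> \<Union>\<C>"
    and \<phi>: "\<phi> \<in> singular_cocycle_set (Suc p) X"
    and van: "\<And>\<sigma> V. singular_simplex (Suc p) X \<sigma> \<Longrightarrow> V \<in> \<C> \<Longrightarrow> \<sigma> \<in> standard_simplex (Suc p) \<rightarrow> V
                 \<Longrightarrow> \<phi> \<sigma> = 0"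
  shows "\<phi> \<in> singular_coboundary_set (Suc p) X"
proof -
  obtain D where D: "\<And>q \<sigma>. singular_simplex q X \<sigma> \<Longrightarrow> singular_chain (Suc q) X (D q \<sigma>)"
    and sm: "\<And>q \<sigma>. singular_simplex (Suc q) X \<sigma> \<Longrightarrow> small_chain \<C> (Suc q) X
       (frag_of \<sigma> - frag_extend (D q) (chain_boundary (Suc q) (frag_of \<sigma>))
          - chain_boundary (Suc (Suc q)) (D (Suc q) \<sigma>))"
    using contraction_mod_small[OF opn cover] by metis
  define \<psi> where "\<psi> = (\<lambda>\<tau>\<in>singular_simplex_set p X. chain_eval \<phi> (D p \<tau>))"
  have "cochain_coboundary p X \<psi> \<sigma> = \<phi> \<sigma>" for \<sigma>
  proof (cases "singular_simplex (Suc p) X \<sigma>")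
    case True
    let ?b = "chain_boundary (Suc p) (frag_of \<sigma>)"
    have fs: "singular_chain (Suc p) X (frag_of \<sigma>)" using True by (simp add: singular_chain_of)
    have "cochain_coboundary p X \<psi> \<sigma> = chain_eval \<psi> ?b"
      using chain_eval_coboundary[OF fs, of \<psi>] by simp
    also have "\<dots> = chain_eval (\<lambda>\<tau>. chain_eval \<phi> (D p \<tau>)) ?b"
      by (rule chain_eval_cong[OF singular_chain_boundary_alt[OF fs]]) (simp add: \<psi>_def)
    also have "\<dots> = chain_eval \<phi> (frag_extend (D p) ?b)" by (rule chain_eval_extend)
    also have "\<dots> = \<phi> \<sigma>"
    proof -
      let ?r = "frag_of \<sigma> - frag_extend (D p) ?b - chain_boundary (Suc (Suc p)) (D (Suc p) \<sigma>)"
      have "chain_eval \<phi> ?r = 0"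
        using sm[OF True] van by (intro chain_eval_eq_0) (auto simp: small_chain_def)
      moreover have "chain_eval \<phi> (chain_boundary (Suc (Suc p)) (D (Suc p) \<sigma>)) = 0"
        using chain_eval_cocycle_boundary[OF \<phi> D[OF True]] .
      ultimately show ?thesis by (simp add: chain_eval_diff)
    qed
    finally show ?thesis .
  next
    case False
    then show ?thesis using \<phi>
      by (simp add: cochain_coboundary_def singular_cocycle_set_iff extensional_def)
  qed
  then have "\<phi> = cochain_coboundary p X \<psi>" by auto
  moreover have "\<psi> \<in> carrier (cochain_group p X)" by (simp add: \<psi>_def carrier_cochain_group)
  ultimately show ?thesis by (simp add: singular_coboundary_set_def)
qed

section \<open>Cohomology classes\<close>

lemma hom_cochain_coboundary:
  "cochain_coboundary q X \<in> hom (cochain_group q X) (cochain_group (Suc q) X)"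
proof (rule homI)
  fix \<phi> \<psi>
  note singular_simplex_face[of q X]
  then show "cochain_coboundary q X (\<phi> \<otimes>\<^bsub>cochain_group q X\<^esub> \<psi>) =
      cochain_coboundary q X \<phi> \<otimes>\<^bsub>cochain_group (Suc q) X\<^esub> cochain_coboundary q X \<psi>"
    by (auto simp: cochain_coboundary_def mult_cochain_group fun_eq_iff restrict_def
        distrib_left sum.distrib simp del: sum.atMost_Suc intro!: sum.cong)
qed (auto simp: cochain_coboundary_def carrier_cochain_group)

lemma group_hom_cochain_coboundary:
  "group_hom (cochain_group q X) (cochain_group (Suc q) X) (cochain_coboundary q X)"
  using hom_cochain_coboundary by (auto simp: group_hom_def group_hom_axioms_def group_cochain_group)

lemma subgroup_singular_coboundary_set:
  "subgroup (singular_coboundary_set p X) (cochain_group p X)"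
proof (cases p)
  case 0
  then show ?thesis
    by (simp add: singular_coboundary_set_def group.triv_subgroup group_cochain_group)
next
  case (Suc q)
  interpret group_hom "cochain_group q X" "cochain_group (Suc q) X" "cochain_coboundary q X"
    by (rule group_hom_cochain_coboundary)
  show ?thesis using img_is_subgroup by (simp add: singular_coboundary_set_def Suc)
qed

lemma singular_coboundary_set_carrier:
  "singular_coboundary_set p X \<subseteq> extensional (singular_simplex_set p X)"
  using subgroup.subset[OF subgroup_singular_coboundary_set]
  by (simp add: carrier_cochain_group)

lemma cohomology_class_iff:
  "\<psi> \<in> cohomology_class p X \<phi> \<longleftrightarrow>
    (\<exists>\<beta>\<in>singular_coboundary_set p X. \<psi> = (\<lambda>\<sigma>\<in>singular_simplex_set p X. \<beta> \<sigma> + \<phi> \<sigma>))"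
  by (auto simp: cohomology_class_def r_coset_def mult_cochain_group)

lemma cohomology_class_add_coboundary:
  assumes "\<beta> \<in> singular_coboundary_set p X" "\<phi> \<in> extensional (singular_simplex_set p X)"
  shows "cohomology_class p X (\<lambda>\<sigma>\<in>singular_simplex_set p X. \<beta> \<sigma> + \<phi> \<sigma>) = cohomology_class p X \<phi>"
proof -
  interpret group "cochain_group p X" by (rule group_cochain_group)
  have "\<beta> \<otimes>\<^bsub>cochain_group p X\<^esub> \<phi> \<in> singular_coboundary_set p X #>\<^bsub>cochain_group p X\<^esub> \<phi>"
    using assms(1) by (auto simp: r_coset_def)
  then show ?thesis
    using repr_independence[OF _ _ subgroup_singular_coboundary_set] assms(2)
    by (simp add: cohomology_class_def mult_cochain_group carrier_cochain_group)
qed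

lemma cohomology_class_self:
  "\<phi> \<in> extensional (singular_simplex_set p X) \<Longrightarrow> \<phi> \<in> cohomology_class p X \<phi>"
  using group.rcos_self[OF group_cochain_group _ subgroup_singular_coboundary_set, of \<phi> p X]
  by (simp add: cohomology_class_def carrier_cochain_group)

lemma cohomology_class_trivial_iff:
  assumes "\<phi> \<in> extensional (singular_simplex_set p X)"
  shows "cohomology_class p X \<phi> = \<one>\<^bsub>cohomology_group p X\<^esub> \<longleftrightarrow> \<phi> \<in> singular_coboundary_set p X"
proof -
  have "\<one>\<^bsub>cohomology_group p X\<^esub> = singular_coboundary_set p X"
    by (simp add: cohomology_group_def FactGroup_def)
  moreover have "cohomology_class p X \<phi> = singular_coboundary_set p X"
    if "\<phi> \<in> singular_coboundary_set p X"
    using group.coset_join2[OF group_cochain_group _ subgroup_singular_coboundary_set that] assms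
    by (simp add: cohomology_class_def carrier_cochain_group)
  ultimately show ?thesis using cohomology_class_self[OF assms] by metis
qed

lemma carrier_cocycle_group:
  "carrier (subgroup_generated (cochain_group p X) (singular_cocycle_set p X)) = singular_cocycle_set p X"
proof -
  interpret group_hom "cochain_group p X" "cochain_group (Suc p) X" "cochain_coboundary p X"
    by (rule group_hom_cochain_coboundary)
  have "singular_cocycle_set p X = kernel (cochain_group p X) (cochain_group (Suc p) X) (cochain_coboundary p X)"
    by (simp add: kernel_def singular_cocycle_set_def)
  then have "subgroup (singular_cocycle_set p X) (cochain_group p X)"
    using subgroup_kernel by simp
  then show ?thesis by (rule subgroup.carrier_subgroup_generated_subgroup)
qed

lemma cohomology_group_elem:
  assumes "A \<in> carrier (cohomology_group p X)"
  obtains \<phi> where "\<phi> \<in> singular_cocycle_set p X" "A = cohomology_class p X \<phi>"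
  using assms that carrier_cocycle_group[of p X]
  by (auto simp: cohomology_group_def FactGroup_def RCOSETS_def cohomology_class_def r_coset_def)

section \<open>Induced maps\<close>

lemma cochain_coboundary_cochain_map:
  assumes "continuous_map X Y f"
  shows "cochain_coboundary p X (cochain_map p X f \<phi>) = cochain_map (Suc p) X f (cochain_coboundary p Y \<phi>)"
proof
  fix \<sigma>
  show "cochain_coboundary p X (cochain_map p X f \<phi>) \<sigma> = cochain_map (Suc p) X f (cochain_coboundary p Y \<phi>) \<sigma>"
  proof (cases "singular_simplex (Suc p) X \<sigma>")
    case True
    have 1: "singular_simplex p X (singular_face (Suc p) k \<sigma>)" if "k \<le> Suc p" for k
      using singular_simplex_singular_face[OF True _ that] by simp
    have 2: "singular_face (Suc p) k (simplex_map (Suc p) f \<sigma>) = simplex_map p f (singular_face (Suc p) k \<sigma>)"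
      if "k \<le> Suc p" for k
      using that by (fastforce simp add: singular_face_def simplex_map_def simplical_face_in_standard_simplex)
    show ?thesis
      using True singular_simplex_simplex_map[OF True assms]
      by (simp add: cochain_coboundary_def cochain_map_def 1 2 del: sum.atMost_Suc)
  qed (simp add: cochain_coboundary_def cochain_map_def)
qed

lemma cochain_map_coboundary:
  assumes "continuous_map X Y f" "\<beta> \<in> singular_coboundary_set p Y"
  shows "cochain_map p X f \<beta> \<in> singular_coboundary_set p X"
proof (cases p)
  case 0
  then show ?thesis using assms singular_simplex_simplex_map[OF _ assms(1)]
    by (auto simp: singular_coboundary_set_def one_cochain_group cochain_map_def fun_eq_iff restrict_def)
next
  case (Suc q)
  then obtain \<psi> where "\<beta> = cochain_coboundary q Y \<psi>" using assms(2) by (auto simp: singular_coboundary_set_def)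
  then have "cochain_map p X f \<beta> = cochain_coboundary q X (cochain_map q X f \<psi>)"
    using cochain_coboundary_cochain_map[OF assms(1)] Suc by simp
  then show ?thesis
    by (simp add: singular_coboundary_set_def Suc carrier_cochain_group cochain_map_def)
qed

lemma cochain_map_cocycle:
  assumes "continuous_map X Y f" "\<phi> \<in> singular_cocycle_set p Y"
  shows "cochain_map p X f \<phi> \<in> singular_cocycle_set p X"
proof -
  have "cochain_coboundary p X (cochain_map p X f \<phi>) = cochain_map (Suc p) X f \<one>\<^bsub>cochain_group (Suc p) Y\<^esub>"
    using assms(2) cochain_coboundary_cochain_map[OF assms(1)] by (simp add: singular_cocycle_set_def)
  also have "\<dots> = \<one>\<^bsub>cochain_group (Suc p) X\<^esub>"
    using singular_simplex_simplex_map[OF _ assms(1)]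
    by (auto simp: one_cochain_group cochain_map_def)
  finally show ?thesis by (simp add: singular_cocycle_set_def carrier_cochain_group cochain_map_def)
qed

text \<open>The union over all representatives collapses because pulling back preserves coboundaries.\<close>

lemma cohomology_induced_class:
  assumes "continuous_map X Y f" "\<phi> \<in> extensional (singular_simplex_set p Y)"
  shows "cohomology_induced p X f (cohomology_class p Y \<phi>) = cohomology_class p X (cochain_map p X f \<phi>)"
proof -
  have "cohomology_class p X (cochain_map p X f \<psi>) = cohomology_class p X (cochain_map p X f \<phi>)"
    if mem: "\<psi> \<in> cohomology_class p Y \<phi>" for \<psi>
  proof -
    obtain \<beta> where \<beta>: "\<beta> \<in> singular_coboundary_set p Y"
      and \<psi>: "\<psi> = (\<lambda>\<sigma>\<in>singular_simplex_set p Y. \<beta> \<sigma> + \<phi> \<sigma>)"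
      using mem unfolding cohomology_class_iff by blast
    have "cochain_map p X f \<psi> =
      (\<lambda>\<sigma>\<in>singular_simplex_set p X. cochain_map p X f \<beta> \<sigma> + cochain_map p X f \<phi> \<sigma>)"
      using singular_simplex_simplex_map[OF _ assms(1)]
      by (auto simp: cochain_map_def \<psi> fun_eq_iff restrict_def)
    moreover have "cochain_map p X f \<phi> \<in> extensional (singular_simplex_set p X)"
      by (simp add: cochain_map_def)
    ultimately show ?thesis
      using cohomology_class_add_coboundary[OF cochain_map_coboundary[OF assms(1) \<beta>], of "cochain_map p X f \<phi>"]
      by simp
  qed
  then show ?thesis
    using cohomology_class_self[OF assms(2)] unfolding cohomology_induced_def by blast
qed

section \<open>Cup products\<close>

lemma standard_simplex_zero: "x \<in> standard_simplex p \<Longrightarrow> i > p \<Longrightarrow> x i = 0"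
  by (simp add: standard_simplex_def)

lemma shift_standard_simplex:
  assumes "x \<in> standard_simplex q"
  shows "(\<lambda>i. if i < p then 0 else x (i - p)) \<in> standard_simplex (p + q)"
proof -
  have "(\<Sum>i\<le>p+q. if i < p then 0 else x (i - p)) = (\<Sum>i\<in>{p..p+q}. x (i - p))"
    by (rule sum.mono_neutral_cong_right) auto
  also have "\<dots> = (\<Sum>i\<le>q. x i)"
    by (rule sum.reindex_bij_witness[of _ "\<lambda>i. i + p" "\<lambda>i. i - p"]) auto
  finally show ?thesis using assms by (auto simp: standard_simplex_def)
qed

lemma front_face_simplex:
  "singular_simplex (p + q) X \<sigma> \<Longrightarrow> singular_simplex p X (front_face p \<sigma>)"
  using standard_simplex_mono[of p "p + q"]
  by (auto simp: singular_simplex_def front_face_def intro: continuous_map_from_subtopology_mono)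

lemma back_face_simplex:
  assumes "singular_simplex (p + q) X \<sigma>"
  shows "singular_simplex q X (back_face p q \<sigma>)"
proof -
  have "continuous_map (simplex_space q)
           (simplex_space (p + q))
           (\<lambda>x i. if i < p then 0 else x (i - p))"
  proof -
    have "continuous_map (powertop_real UNIV) euclideanreal (\<lambda>x. if i < p then 0 else x (i - p))" for i
      by (cases "i < p") (auto intro: continuous_map_product_projection)
    then show ?thesis
      by (auto simp: continuous_map_in_subtopology continuous_map_componentwise_UNIV
          shift_standard_simplex intro!: continuous_map_from_subtopology continuous_map_product_projection)
  qed
  then show ?thesis
    using assms continuous_map_compose
    by (fastforce simp: singular_simplex_def back_face_def o_def)
qed

lemma front_face_low:
  assumes "k \<le> Suc p"
  shows "front_face p (singular_face (Suc (p + q)) k \<sigma>) = singular_face (Suc p) k (front_face (Suc p) \<sigma>)"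
  using standard_simplex_mono[of p "p + q"] assms simplical_face_in_standard_simplex[of "Suc p" k]
  by (intro ext) (auto simp: front_face_def singular_face_def)

lemma front_face_high:
  assumes "p < k"
  shows "front_face p (singular_face (Suc (p + q)) k \<sigma>) = front_face p \<sigma>"
proof -
  have "simplical_face k x = x" if "x \<in> standard_simplex p" for x :: "nat \<Rightarrow> real"
    using assms that by (auto simp: simplical_face_def fun_eq_iff standard_simplex_zero)
  then show ?thesis using standard_simplex_mono[of p "p + q"]
    by (intro ext) (auto simp: front_face_def singular_face_def)
qed

lemma back_face_low:
  assumes "k \<le> p"
  shows "back_face p q (singular_face (Suc (p + q)) k \<sigma>) = back_face (Suc p) q \<sigma>"
proof -
  have "simplical_face k (\<lambda>i. if i < p then 0 else x (i - p)) = (\<lambda>i. if i < Suc p then 0 else x (i - Suc p))"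
    for x :: "nat \<Rightarrow> real"
    using assms by (auto simp: simplical_face_def fun_eq_iff)
  then show ?thesis
    by (intro ext) (auto simp: back_face_def singular_face_def shift_standard_simplex)
qed

lemma back_face_high:
  assumes "j \<le> Suc q"
  shows "back_face p q (singular_face (Suc (p + q)) (p + j) \<sigma>) = singular_face (Suc q) j (back_face p (Suc q) \<sigma>)"
proof -
  have "simplical_face (p + j) (\<lambda>i. if i < p then 0 else x (i - p)) =
      (\<lambda>i. if i < p then 0 else simplical_face j x (i - p))" for x :: "nat \<Rightarrow> real"
    by (auto simp: simplical_face_def fun_eq_iff)
  then show ?thesis
    using assms simplical_face_in_standard_simplex[of "Suc q" j]
    by (intro ext) (auto simp: back_face_def singular_face_def shift_standard_simplex)
qed

text \<open>The Leibniz rule. Face \<open>k\<close> of a simplex changes the front factor for \<open>k \<le> p\<close> and the back factor for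
\<open>k > p\<close>; the last face of the front part and the first face of the back part appear in both terms on
the right, with opposite signs.\<close>

lemma coboundary_cup:
  assumes \<sigma>: "singular_simplex (Suc (p + q)) X \<sigma>"
  shows "cochain_coboundary (p + q) X (cochain_cup p q X \<phi> \<psi>) \<sigma> =
    cochain_coboundary p X \<phi> (front_face (Suc p) \<sigma>) * \<psi> (back_face (Suc p) q \<sigma>) +
    (-1) ^ p * \<phi> (front_face p \<sigma>) * cochain_coboundary q X \<psi> (back_face p (Suc q) \<sigma>)"
proof -
  have face: "singular_simplex (p + q) X (singular_face (Suc (p + q)) k \<sigma>)" if "k \<le> Suc (p + q)" for k
    using singular_simplex_singular_face[OF \<sigma> _ that] by simp
  have fr: "singular_simplex (Suc p) X (front_face (Suc p) \<sigma>)"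
    using front_face_simplex[of "Suc p" q] \<sigma> by simp
  have ba: "singular_simplex (Suc q) X (back_face p (Suc q) \<sigma>)"
    using back_face_simplex[of p "Suc q"] \<sigma> by simp
  let ?t = "\<lambda>k. (-1) ^ k * (\<phi> (front_face p (singular_face (Suc (p + q)) k \<sigma>)) *
                   \<psi> (back_face p q (singular_face (Suc (p + q)) k \<sigma>)))"
  let ?B = "\<psi> (back_face (Suc p) q \<sigma>)" and ?F = "\<phi> (front_face p \<sigma>)"
  have "cochain_coboundary (p + q) X (cochain_cup p q X \<phi> \<psi>) \<sigma> = (\<Sum>k\<le>Suc (p + q). ?t k)"
    using \<sigma> face by (simp add: cochain_coboundary_def cochain_cup_def del: sum.atMost_Suc)
  also have "\<dots> = (\<Sum>k\<le>p. ?t k) + (\<Sum>k\<in>{Suc p..Suc (p + q)}. ?t k)"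
  proof -
    have "{..Suc (p + q)} = {..p} \<union> {Suc p..Suc (p + q)}" by auto
    then show ?thesis by (simp only:) (rule sum.union_disjoint; auto)
  qed
  also have "(\<Sum>k\<le>p. ?t k) = (\<Sum>k\<le>p. (-1) ^ k * \<phi> (singular_face (Suc p) k (front_face (Suc p) \<sigma>))) * ?B"
    by (simp add: front_face_low back_face_low sum_distrib_right mult.assoc)
  also have "\<dots> = (cochain_coboundary p X \<phi> (front_face (Suc p) \<sigma>)
      - (-1) ^ Suc p * \<phi> (singular_face (Suc p) (Suc p) (front_face (Suc p) \<sigma>))) * ?B"
    using fr by (simp add: cochain_coboundary_def)
  also have "singular_face (Suc p) (Suc p) (front_face (Suc p) \<sigma>) = front_face p \<sigma>"
    using front_face_low[of "Suc p" p q \<sigma>] front_face_high[of p "Suc p" q \<sigma>] by simp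
  also have "(\<Sum>k\<in>{Suc p..Suc (p + q)}. ?t k) = (\<Sum>j\<in>{1..Suc q}. ?t (p + j))"
    by (rule sum.reindex_bij_witness[of _ "\<lambda>j. p + j" "\<lambda>k. k - p"]) auto
  also have "\<dots> = (\<Sum>j\<in>{1..Suc q}. (-1) ^ p * ?F * ((-1) ^ j * \<psi> (singular_face (Suc q) j (back_face p (Suc q) \<sigma>))))"
    by (rule sum.cong) (auto simp: front_face_high back_face_high power_add)
  also have "\<dots> = (-1) ^ p * ?F * (\<Sum>j\<in>{1..Suc q}. (-1) ^ j * \<psi> (singular_face (Suc q) j (back_face p (Suc q) \<sigma>)))"
    by (simp only: sum_distrib_left)
  also have "(\<Sum>j\<in>{1..Suc q}. (-1) ^ j * \<psi> (singular_face (Suc q) j (back_face p (Suc q) \<sigma>))) =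
      cochain_coboundary q X \<psi> (back_face p (Suc q) \<sigma>) - \<psi> (singular_face (Suc q) 0 (back_face p (Suc q) \<sigma>))"
  proof -
    have "{..Suc q} = insert 0 {1..Suc q}" by auto
    then show ?thesis using ba by (simp add: cochain_coboundary_def del: sum.atMost_Suc)
  qed
  also have "singular_face (Suc q) 0 (back_face p (Suc q) \<sigma>) = back_face (Suc p) q \<sigma>"
    using back_face_high[of 0 q p \<sigma>] back_face_low[of p p q \<sigma>] by simp
  finally show ?thesis by (simp add: algebra_simps)
qed

lemma cocycle_coboundary_eq_0:
  "\<phi> \<in> singular_cocycle_set p X \<Longrightarrow> singular_simplex (Suc p) X \<sigma> \<Longrightarrow> cochain_coboundary p X \<phi> \<sigma> = 0"
  by (simp add: singular_cocycle_set_def one_cochain_group)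

lemma cup_cocycle:
  assumes "\<phi> \<in> singular_cocycle_set p X" "\<psi> \<in> singular_cocycle_set q X"
  shows "cochain_cup p q X \<phi> \<psi> \<in> singular_cocycle_set (p + q) X"
proof -
  have "cochain_coboundary (p + q) X (cochain_cup p q X \<phi> \<psi>) \<sigma> = 0"
    if \<sigma>: "singular_simplex (Suc (p + q)) X \<sigma>" for \<sigma>
  proof -
    have "singular_simplex (Suc p) X (front_face (Suc p) \<sigma>)"
      using front_face_simplex[of "Suc p" q] \<sigma> by simp
    moreover have "singular_simplex (Suc q) X (back_face p (Suc q) \<sigma>)"
      using back_face_simplex[of p "Suc q"] \<sigma> by simp
    ultimately show ?thesis
      by (simp add: coboundary_cup[OF \<sigma>] cocycle_coboundary_eq_0[OF assms(1)]
          cocycle_coboundary_eq_0[OF assms(2)])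
  qed
  then have "cochain_coboundary (p + q) X (cochain_cup p q X \<phi> \<psi>) = \<one>\<^bsub>cochain_group (Suc (p + q)) X\<^esub>"
    by (auto simp: one_cochain_group cochain_coboundary_def fun_eq_iff simp del: sum.atMost_Suc)
  then show ?thesis
    by (simp add: singular_cocycle_set_def carrier_cochain_group cochain_cup_def)
qed

lemma zero_in_coboundary_set:
  "(\<lambda>\<sigma>\<in>singular_simplex_set p X. 0) \<in> singular_coboundary_set p X"
  using subgroup.one_closed[OF subgroup_singular_coboundary_set] by (simp add: one_cochain_group)

lemma coboundary_cup_cocycle:
  assumes "\<beta> \<in> singular_coboundary_set p X" "\<psi> \<in> singular_cocycle_set q X"
  shows "cochain_cup p q X \<beta> \<psi> \<in> singular_coboundary_set (p + q) X"
proof (cases p)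
  case 0
  then have "cochain_cup p q X \<beta> \<psi> = (\<lambda>\<sigma>\<in>singular_simplex_set (p + q) X. 0)"
    using assms(1) front_face_simplex[of 0 q]
    by (auto simp: singular_coboundary_set_def one_cochain_group cochain_cup_def fun_eq_iff)
  then show ?thesis using zero_in_coboundary_set by metis
next
  case (Suc r)
  then obtain \<alpha> where \<alpha>: "\<beta> = cochain_coboundary r X \<alpha>" using assms(1)
    by (auto simp: singular_coboundary_set_def)
  have "cochain_cup p q X \<beta> \<psi> = cochain_coboundary (r + q) X (cochain_cup r q X \<alpha> \<psi>)"
  proof
    fix \<sigma>
    show "cochain_cup p q X \<beta> \<psi> \<sigma> = cochain_coboundary (r + q) X (cochain_cup r q X \<alpha> \<psi>) \<sigma>"
    proof (cases "singular_simplex (Suc (r + q)) X \<sigma>")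
      case True
      have "singular_simplex (Suc q) X (back_face r (Suc q) \<sigma>)"
        using back_face_simplex[of r "Suc q"] True by simp
      then show ?thesis using True
        by (simp add: coboundary_cup[OF True] cocycle_coboundary_eq_0[OF assms(2)])
           (simp add: cochain_cup_def Suc \<alpha>)
    qed (simp add: cochain_cup_def cochain_coboundary_def Suc)
  qed
  then show ?thesis
    by (simp add: singular_coboundary_set_def Suc carrier_cochain_group cochain_cup_def)
qed

lemma cocycle_cup_coboundary:
  assumes "\<phi> \<in> singular_cocycle_set p X" "\<beta> \<in> singular_coboundary_set q X"
  shows "cochain_cup p q X \<phi> \<beta> \<in> singular_coboundary_set (p + q) X"
proof (cases q)
  case 0
  then have "cochain_cup p q X \<phi> \<beta> = (\<lambda>\<sigma>\<in>singular_simplex_set (p + q) X. 0)"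
    using assms(2) back_face_simplex[of p 0]
    by (auto simp: singular_coboundary_set_def one_cochain_group cochain_cup_def fun_eq_iff)
  then show ?thesis using zero_in_coboundary_set by metis
next
  case (Suc r)
  then obtain \<alpha> where \<alpha>: "\<beta> = cochain_coboundary r X \<alpha>" using assms(2)
    by (auto simp: singular_coboundary_set_def)
  let ?\<alpha> = "\<lambda>\<tau>. (-1) ^ p * \<alpha> \<tau>"
  have "cochain_cup p q X \<phi> \<beta> = cochain_coboundary (p + r) X (cochain_cup p r X \<phi> ?\<alpha>)"
  proof
    fix \<sigma>
    show "cochain_cup p q X \<phi> \<beta> \<sigma> = cochain_coboundary (p + r) X (cochain_cup p r X \<phi> ?\<alpha>) \<sigma>"
    proof (cases "singular_simplex (Suc (p + r)) X \<sigma>")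
      case True
      have 1: "singular_simplex (Suc p) X (front_face (Suc p) \<sigma>)"
        using front_face_simplex[of "Suc p" r] True by simp
      have 2: "singular_simplex (Suc r) X (back_face p (Suc r) \<sigma>)"
        using back_face_simplex[of p "Suc r"] True by simp
      have "cochain_coboundary r X ?\<alpha> (back_face p (Suc r) \<sigma>) = (-1) ^ p * \<beta> (back_face p (Suc r) \<sigma>)"
        using 2 by (simp add: \<alpha> cochain_coboundary_def sum_distrib_left algebra_simps del: sum.atMost_Suc)
      then show ?thesis using True 1
        by (simp add: coboundary_cup[OF True] cocycle_coboundary_eq_0[OF assms(1)])
           (simp add: cochain_cup_def Suc algebra_simps flip: power_add)
    qed (simp add: cochain_cup_def cochain_coboundary_def Suc)
  qed
  then show ?thesis
    by (simp add: singular_coboundary_set_def Suc carrier_cochain_group cochain_cup_def)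
qed

lemma coboundary_imp_cocycle:
  assumes "\<beta> \<in> singular_coboundary_set p X"
  shows "\<beta> \<in> singular_cocycle_set p X"
proof (cases p)
  case 0
  note singular_simplex_face[of 0 X]
  then show ?thesis using assms 0
    by (auto simp: singular_coboundary_set_def one_cochain_group singular_cocycle_set_iff)
next
  case (Suc q)
  then obtain \<alpha> where \<alpha>: "\<beta> = cochain_coboundary q X \<alpha>" using assms
    by (auto simp: singular_coboundary_set_def)
  have "(\<Sum>k\<le>Suc p. (-1) ^ k * \<beta> (singular_face (Suc p) k \<sigma>)) = 0" if "singular_simplex (Suc p) X \<sigma>" for \<sigma>
  proof -
    have \<sigma>: "singular_chain (Suc (Suc q)) X (frag_of \<sigma>)" using that Suc by (simp add: singular_chain_of)
    have "chain_eval \<beta> (chain_boundary (Suc p) (frag_of \<sigma>)) =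
        chain_eval \<alpha> (chain_boundary (Suc q) (chain_boundary (Suc p) (frag_of \<sigma>)))"
      unfolding \<alpha> Suc by (rule chain_eval_coboundary[OF singular_chain_boundary_alt[OF \<sigma>]])
    also have "\<dots> = 0" using chain_boundary_boundary[OF \<sigma>] Suc by simp
    finally show ?thesis by (simp add: chain_eval_boundary_of del: sum.atMost_Suc)
  qed
  then show ?thesis using assms singular_coboundary_set_carrier by (auto simp: singular_cocycle_set_iff)
qed

lemma cocycle_add_coboundary:
  assumes "\<beta> \<in> singular_coboundary_set p X" "\<phi> \<in> singular_cocycle_set p X"
  shows "(\<lambda>\<sigma>\<in>singular_simplex_set p X. \<beta> \<sigma> + \<phi> \<sigma>) \<in> singular_cocycle_set p X"
proof -
  note singular_simplex_face[of p X]
  then show ?thesis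
    using assms(2) coboundary_imp_cocycle[OF assms(1)]
    by (auto simp: singular_cocycle_set_iff distrib_left sum.distrib simp del: sum.atMost_Suc)
qed

text \<open>Again the union collapses, now by the Leibniz rule.\<close>

lemma cohomology_cup_class:
  assumes "\<phi> \<in> singular_cocycle_set p X" "\<psi> \<in> singular_cocycle_set q X"
  shows "cohomology_cup p q X (cohomology_class p X \<phi>) (cohomology_class q X \<psi>) =
         cohomology_class (p + q) X (cochain_cup p q X \<phi> \<psi>)"
proof -
  have eq: "cohomology_class (p + q) X (cochain_cup p q X \<phi>' \<psi>') = cohomology_class (p + q) X (cochain_cup p q X \<phi> \<psi>)"
    if \<phi>': "\<phi>' \<in> cohomology_class p X \<phi>" and \<psi>': "\<psi>' \<in> cohomology_class q X \<psi>" for \<phi>' \<psi>'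
  proof -
    obtain \<beta> where \<beta>: "\<beta> \<in> singular_coboundary_set p X"
      and \<phi>': "\<phi>' = (\<lambda>\<sigma>\<in>singular_simplex_set p X. \<beta> \<sigma> + \<phi> \<sigma>)"
      using \<phi>' unfolding cohomology_class_iff by blast
    obtain \<gamma> where \<gamma>: "\<gamma> \<in> singular_coboundary_set q X"
      and \<psi>': "\<psi>' = (\<lambda>\<sigma>\<in>singular_simplex_set q X. \<gamma> \<sigma> + \<psi> \<sigma>)"
      using \<psi>' unfolding cohomology_class_iff by blast
    have c: "\<psi>' \<in> singular_cocycle_set q X"
      unfolding \<psi>' using cocycle_add_coboundary[OF \<gamma> assms(2)] .
    let ?S = "singular_simplex_set (p + q) X"
    define \<xi> where "\<xi> = (\<lambda>\<sigma>\<in>?S. cochain_cup p q X \<phi> \<gamma> \<sigma> + cochain_cup p q X \<phi> \<psi> \<sigma>)"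
    have "cochain_cup p q X \<phi>' \<psi>' = (\<lambda>\<sigma>\<in>?S. cochain_cup p q X \<beta> \<psi>' \<sigma> + \<xi> \<sigma>)"
      using front_face_simplex[of p q X] back_face_simplex[of p q X]
      by (intro ext) (simp add: cochain_cup_def \<phi>' \<psi>' \<xi>_def algebra_simps)
    moreover have "\<xi> \<in> extensional ?S" unfolding \<xi>_def by (rule restrict_extensional)
    ultimately have "cohomology_class (p + q) X (cochain_cup p q X \<phi>' \<psi>') = cohomology_class (p + q) X \<xi>"
      using cohomology_class_add_coboundary[OF coboundary_cup_cocycle[OF \<beta> c], of \<xi>] by simp
    also have "\<dots> = cohomology_class (p + q) X (cochain_cup p q X \<phi> \<psi>)"
      unfolding \<xi>_def
      by (rule cohomology_class_add_coboundary[OF cocycle_cup_coboundary[OF assms(1) \<gamma>]])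
         (simp only: cochain_cup_def restrict_extensional)
    finally show ?thesis .
  qed
  have "\<phi> \<in> cohomology_class p X \<phi>" "\<psi> \<in> cohomology_class q X \<psi>"
    using assms by (auto intro!: cohomology_class_self simp: singular_cocycle_set_iff)
  then show ?thesis unfolding cohomology_cup_def using eq by blast
qed

section \<open>Products of cocycles of degree one\<close>

text \<open>The cup product of one-dimensional cochains, evaluated along the consecutive edges of the simplex.\<close>

definition edge_product :: "nat \<Rightarrow> 'a topology \<Rightarrow> (nat \<Rightarrow> 'a cochain) \<Rightarrow> 'a cochain"
  where "edge_product n X a = (\<lambda>\<sigma>\<in>singular_simplex_set n X. \<Prod>i<n. a i (back_face i 1 \<sigma>))"

lemma back_face_front_face:
  assumes "i < n" shows "back_face i 1 (front_face n \<sigma>) = back_face i 1 \<sigma>"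
proof -
  have "(\<lambda>j. if j < i then 0 else x (j - i)) \<in> standard_simplex n" if "x \<in> standard_simplex (Suc 0)" for x
    using shift_standard_simplex[of x 1 i] that standard_simplex_mono[of "i + 1" n] assms by auto
  then show ?thesis by (intro ext) (auto simp: back_face_def front_face_def)
qed

lemma edge_simplex:
  assumes "singular_simplex n X \<sigma>" "i < n"
  shows "singular_simplex 1 X (back_face i 1 \<sigma>)"
proof -
  have "singular_simplex (i + 1) X (front_face (i + 1) \<sigma>)"
    using assms front_face_simplex[of "i + 1" "n - (i + 1)"] by simp
  then have "singular_simplex 1 X (back_face i 1 (front_face (i + 1) \<sigma>))" by (rule back_face_simplex)
  then show ?thesis using back_face_front_face[of i "i + 1" \<sigma>] by simp
qed

lemma edge_product_Suc:
  "edge_product (Suc n) X a = cochain_cup n 1 X (edge_product n X a) (a n)"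
proof -
  have "(\<Prod>i<n. a i (back_face i 1 (front_face n \<sigma>))) = (\<Prod>i<n. a i (back_face i 1 \<sigma>))" for \<sigma>
    by (rule prod.cong) (simp_all only: lessThan_iff back_face_front_face)
  moreover have "singular_simplex n X (front_face n \<sigma>)" if "singular_simplex (Suc n) X \<sigma>" for \<sigma>
    using that front_face_simplex[of n 1 X] by simp
  ultimately show ?thesis
    by (intro ext) (simp add: edge_product_def cochain_cup_def)
qed

lemma edge_product_cocycle:
  assumes "\<And>i. i < n \<Longrightarrow> a i \<in> singular_cocycle_set 1 X"
  shows "edge_product n X a \<in> singular_cocycle_set n X"
  using assms
proof (induction n)
  case 0
  note singular_simplex_face[of 0 X]
  moreover have "edge_product 0 X a = (\<lambda>\<sigma>\<in>singular_simplex_set 0 X. 1)"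
    unfolding edge_product_def by simp
  ultimately show ?case unfolding singular_cocycle_set_iff
    by (intro conjI allI impI) (auto simp: restrict_extensional)
next
  case (Suc n)
  then show ?case using cup_cocycle[of "edge_product n X a" n X "a n" 1]
    by (simp add: edge_product_Suc)
qed

lemma iterated_cup_class:
  assumes "\<And>i. i < n \<Longrightarrow> a i \<in> singular_cocycle_set 1 X"
  shows "iterated_cup X (\<lambda>i. cohomology_class 1 X (a i)) n = cohomology_class n X (edge_product n X a)"
  using assms
proof (induction n)
  case 0
  have "edge_product 0 X a = (\<lambda>\<sigma>\<in>singular_simplex_set 0 X. 1)"
    unfolding edge_product_def by simp
  then show ?case by (simp only: iterated_cup.simps cohomology_unit_def)
next
  case (Suc n)
  then show ?case
    using cohomology_cup_class[OF edge_product_cocycle[of n a X], of "a n" 1]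
    by (simp add: edge_product_Suc)
qed

lemma cochain_map_edge_product:
  assumes "continuous_map X Y f"
  shows "cochain_map n X f (edge_product n Y a) = edge_product n X (\<lambda>i. cochain_map 1 X f (a i))"
proof -
  have 1: "back_face i 1 (simplex_map n f \<sigma>) = simplex_map 1 f (back_face i 1 \<sigma>)" if "i < n" for i \<sigma>
  proof -
    have "(\<lambda>j. if j < i then 0 else x (j - i)) \<in> standard_simplex n" if "x \<in> standard_simplex (Suc 0)" for x
      using shift_standard_simplex[of x 1 i] that standard_simplex_mono[of "i + 1" n] \<open>i < n\<close> by auto
    then show ?thesis by (intro ext) (auto simp: back_face_def simplex_map_def)
  qed
  note 2 = edge_simplex
  show ?thesis
    using singular_simplex_simplex_map[OF _ assms]
    by (auto simp: cochain_map_def edge_product_def fun_eq_iff 1[unfolded One_nat_def] 2[unfolded One_nat_def]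
        intro!: prod.cong)
qed

section \<open>Cocycles of degree one on the line and the circle\<close>

lemma cocycle_1_eval:
  assumes "\<psi> \<in> singular_cocycle_set 1 X" "singular_relboundary 1 X {} c"
  shows "chain_eval \<psi> c = 0"
proof -
  obtain d where "singular_chain (Suc 1) X d" "chain_boundary (Suc 1) d = c"
    using assms(2) by (auto simp: singular_boundary)
  then show ?thesis using chain_eval_cocycle_boundary[OF assms(1)] by blast
qed

abbreviation vertex :: "nat \<Rightarrow> nat \<Rightarrow> real"
  where "vertex i \<equiv> (\<lambda>j. if j = i then 1 else 0)"

lemma cocycle_1_constant:
  assumes "\<psi> \<in> singular_cocycle_set 1 X" "a \<in> topspace X"
  shows "\<psi> (\<lambda>x\<in>standard_simplex 1. a) = 0"
proof -
  let ?s = "\<lambda>x\<in>standard_simplex (Suc 1). a"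
  have "singular_simplex (Suc 1) X ?s" using assms(2) by (auto simp: singular_simplex_def)
  moreover have "singular_face (Suc 1) k ?s = (\<lambda>x\<in>standard_simplex 1. a)" if "k \<le> Suc 1" for k
    using that simplical_face_in_standard_simplex[of "Suc 1" k]
    by (intro ext) (auto simp: singular_face_def)
  ultimately have "(\<Sum>k\<le>Suc 1. (-1) ^ k * \<psi> (\<lambda>x\<in>standard_simplex 1. a)) = 0"
    using assms(1) unfolding singular_cocycle_set_iff by (metis (no_types, lifting) atMost_iff sum.cong)
  then show ?thesis by simp
qed

lemma continuous_map_simplex_coordinate:
  "continuous_map (subtopology (powertop_real UNIV) S) euclideanreal (\<lambda>x. x i)"
  by (intro continuous_map_from_subtopology continuous_map_product_projection) auto

lemma face_1_0: "singular_face (Suc 0) 0 \<tau> = (\<lambda>x\<in>standard_simplex 0. \<tau> (vertex 1))"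
  by (intro ext) (auto simp: singular_face_def standard_simplex_0 simplical_face_def intro!: arg_cong[where f = \<tau>])

lemma face_1_1: "singular_face (Suc 0) (Suc 0) \<tau> = (\<lambda>x\<in>standard_simplex 0. \<tau> (vertex 0))"
  by (intro ext) (auto simp: singular_face_def standard_simplex_0 simplical_face_def intro!: arg_cong[where f = \<tau>])

text \<open>The primitive \<open>h t\<close> is the value of \<open>\<psi>\<close> on the segment from \<open>0\<close> to \<open>t\<close>. A path together with the
segments to its end points is a cycle, and the line is contractible.\<close>

lemma cocycle_on_line:
  assumes \<psi>: "\<psi> \<in> singular_cocycle_set 1 euclideanreal"
  obtains h where "\<And>\<tau>. singular_simplex 1 euclideanreal \<tau> \<Longrightarrow> \<psi> \<tau> = h (\<tau> (vertex 1)) - h (\<tau> (vertex 0))"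
proof
  define lin where "lin t = (\<lambda>x\<in>standard_simplex 1. x 1 * t)" for t :: real
  let ?K = "\<lambda>x\<in>standard_simplex 1. 0 :: real"
  fix \<tau> assume \<tau>: "singular_simplex 1 euclideanreal \<tau>"
  have lin: "singular_simplex 1 euclideanreal (lin t)" for t
    unfolding singular_simplex_def lin_def
    by (auto intro!: continuous_map_real_mult continuous_map_simplex_coordinate)
  \<comment> \<open>The loop that runs from \<open>0\<close> straight to the start of the path, along it, and straight back.\<close>
  define c where "c = frag_of \<tau> - (frag_of (lin (\<tau> (vertex 1))) - frag_of (lin (\<tau> (vertex 0))))"
  have "singular_chain 1 euclideanreal c"
    unfolding c_def using \<tau> lin by (intro singular_chain_diff) (simp_all add: singular_chain_of)
  moreover have "chain_boundary 1 c = 0"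
    by (simp add: c_def chain_boundary_diff chain_boundary_of face_1_0 face_1_1 lin_def)
  ultimately have cyc: "singular_relcycle 1 euclideanreal {} c"
    by (simp add: singular_cycle)
  \<comment> \<open>Contracting the line to \<open>0\<close> turns the cycle into a constant simplex, on which \<open>\<psi>\<close> is zero.\<close>
  have "homotopic_with (\<lambda>h. h \<in> {} \<rightarrow> {}) euclideanreal euclideanreal id (\<lambda>x. 0)"
    using homotopic_with_linear[of UNIV id "\<lambda>x::real. 0::real" UNIV]
    by (simp add: homotopic_with_eq)
  from homotopic_imp_homologous_rel_chain_maps[OF this cyc]
  have "singular_relboundary 1 euclideanreal {} (chain_map 1 id c - chain_map 1 (\<lambda>x. 0) c)"
    by (simp add: homologous_rel_def)
  then have "chain_eval \<psi> (chain_map 1 id c - chain_map 1 (\<lambda>x. 0) c) = 0"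
    using cocycle_1_eval[OF \<psi>] by blast
  moreover have "chain_map 1 id c = c"
    using \<open>singular_chain 1 euclideanreal c\<close> by (rule chain_map_ident)
  moreover have "chain_map 1 (\<lambda>x. 0) c = frag_of ?K"
    by (simp add: c_def chain_map_diff simplex_map_def o_def)
  moreover have "\<psi> ?K = 0" by (rule cocycle_1_constant[OF \<psi>]) simp
  ultimately have "chain_eval \<psi> c = 0" by (simp add: chain_eval_diff)
  then show "\<psi> \<tau> = \<psi> (lin (\<tau> (vertex 1))) - \<psi> (lin (\<tau> (vertex 0)))"
    by (simp add: c_def chain_eval_diff)
qed

lemma continuous_map_cis: "continuous_map euclideanreal circle cis"
  unfolding circle_def by (auto simp: continuous_map_in_subtopology cis_conv_exp intro!: continuous_intros)

text \<open>Along a lifted path a cocycle of the circle has a primitive on the line. It is not periodic in general: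
over a full turn it increases by the value of the cocycle on the loop.\<close>

lemma cocycle_on_circle:
  assumes "\<phi> \<in> singular_cocycle_set 1 circle"
  obtains h where "\<And>\<tau>. singular_simplex 1 euclideanreal \<tau> \<Longrightarrow>
      \<phi> (simplex_map 1 cis \<tau>) = h (\<tau> (vertex 1)) - h (\<tau> (vertex 0))"
proof -
  have "cochain_map 1 euclideanreal cis \<phi> \<in> singular_cocycle_set 1 euclideanreal"
    by (rule cochain_map_cocycle[OF continuous_map_cis assms])
  then obtain h where "\<And>\<tau>. singular_simplex 1 euclideanreal \<tau> \<Longrightarrow>
      cochain_map 1 euclideanreal cis \<phi> \<tau> = h (\<tau> (vertex 1)) - h (\<tau> (vertex 0))"
    using cocycle_on_line by blast
  then show ?thesis by (intro that[of h]) (simp add: cochain_map_def)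
qed

section \<open>A cup length criterion\<close>

lemma iterated_cup_cong: "(\<And>i. i < n \<Longrightarrow> a i = b i) \<Longrightarrow> iterated_cup X a n = iterated_cup X b n"
  by (induction n) auto

text \<open>The cup length argument of Lusternik and Schnirelmann. With the primitive \<open>h\<close> on the line and the lift
\<open>A i\<close> on \<open>U i\<close>, subtracting the coboundary of \<open>h \<circ> A i\<close> from the \<open>i\<close>th cocycle makes it vanish on all
paths in \<open>U i\<close>. Then the product vanishes on every simplex that lies in some \<open>U i\<close>, that is, on small simplices.\<close>

lemma edge_product_coboundary_of_open_cover:
  fixes \<alpha> :: "nat \<Rightarrow> 'a \<Rightarrow> complex" and A :: "nat \<Rightarrow> 'a \<Rightarrow> real"
  assumes \<phi>: "\<phi> \<in> singular_cocycle_set 1 circle" and "n > 0"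
    and \<alpha>: "\<And>i. i < n \<Longrightarrow> continuous_map X circle (\<alpha> i)"
    and opn: "\<And>i. i < n \<Longrightarrow> openin X (U i)"
    and cover: "topspace X \<subseteq> (\<Union>i<n. U i)"
    and A: "\<And>i. i < n \<Longrightarrow> continuous_map (subtopology X (U i)) euclideanreal (A i)"
    and lift: "\<And>i x. i < n \<Longrightarrow> x \<in> U i \<Longrightarrow> cis (A i x) = \<alpha> i x"
  shows "edge_product n X (\<lambda>i. cochain_map 1 X (\<alpha> i) \<phi>) \<in> singular_coboundary_set n X"
proof -
  obtain p where n: "n = Suc p" using \<open>n > 0\<close> by (cases n) auto
  obtain h where h: "\<And>\<tau>. singular_simplex 1 euclideanreal \<tau> \<Longrightarrow>
      \<phi> (simplex_map 1 cis \<tau>) = h (\<tau> (vertex 1)) - h (\<tau> (vertex 0))"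
    using cocycle_on_circle[OF \<phi>] by blast
  define \<gamma> where "\<gamma> i = (\<lambda>s\<in>singular_simplex_set 0 X. - h (A i (s (vertex 0))))" for i
  define \<beta> where "\<beta> i = cochain_coboundary 0 X (\<gamma> i)" for i
  have \<beta>: "\<beta> i \<in> singular_coboundary_set 1 X" for i
    unfolding \<beta>_def \<gamma>_def singular_coboundary_set_def
    by (auto simp: carrier_cochain_group simp del: restrict_apply)
  let ?a = "\<lambda>i. cochain_map 1 X (\<alpha> i) \<phi>"
  define b where "b i = (\<lambda>\<sigma>\<in>singular_simplex_set 1 X. \<beta> i \<sigma> + ?a i \<sigma>)" for i
  have a: "?a i \<in> singular_cocycle_set 1 X" if "i < n" for i
    using cochain_map_cocycle[OF \<alpha>[OF that] \<phi>] .
  have b: "b i \<in> singular_cocycle_set 1 X" if "i < n" for i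
    unfolding b_def using cocycle_add_coboundary[OF \<beta> a[OF that]] .
  have bclass: "cohomology_class 1 X (b i) = cohomology_class 1 X (?a i)" if "i < n" for i
    unfolding b_def using cohomology_class_add_coboundary[OF \<beta>, of "?a i"] a[OF that]
    by (simp add: singular_cocycle_set_iff)
  have b0: "b i \<sigma> = 0" if i: "i < n" and \<sigma>: "singular_simplex 1 X \<sigma>" and U: "\<sigma> \<in> standard_simplex 1 \<rightarrow> U i" for i \<sigma>
  proof -
    have "singular_simplex 1 (subtopology X (U i)) \<sigma>"
      using \<sigma> U by (auto simp: singular_simplex_subtopology)
    from singular_simplex_simplex_map[OF this A[OF i]]
    have s: "singular_simplex 1 euclideanreal (simplex_map 1 (A i) \<sigma>)" .
    have "simplex_map 1 cis (simplex_map 1 (A i) \<sigma>) = simplex_map 1 (\<alpha> i) \<sigma>"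
      using U lift[OF i] by (intro ext) (auto simp: simplex_map_def)
    then have "?a i \<sigma> = h (A i (\<sigma> (vertex 1))) - h (A i (\<sigma> (vertex 0)))"
      using h[OF s] \<sigma> by (simp add: cochain_map_def simplex_map_def)
    moreover have "singular_simplex 0 X (singular_face (Suc 0) k \<sigma>)" if "k \<le> Suc 0" for k
      using singular_simplex_singular_face[OF \<sigma>[unfolded One_nat_def] _ that] by simp
    then have "\<beta> i \<sigma> = h (A i (\<sigma> (vertex 0))) - h (A i (\<sigma> (vertex 1)))"
      using \<sigma> by (simp add: \<beta>_def \<gamma>_def cochain_coboundary_def) (simp add: face_1_0 face_1_1)
    ultimately show ?thesis using \<sigma> by (simp add: b_def)
  qed
  have "edge_product n X b \<in> singular_coboundary_set n X" unfolding n
  proof (rule small_cocycle_is_coboundary[where \<C> = "U ` {..<n}"])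
    show "edge_product (Suc p) X b \<in> singular_cocycle_set (Suc p) X"
      using edge_product_cocycle[of n b X] b n by simp
    fix \<sigma> V assume \<sigma>: "singular_simplex (Suc p) X \<sigma>" and V: "V \<in> U ` {..<n}" "\<sigma> \<in> standard_simplex (Suc p) \<rightarrow> V"
    then obtain i where i: "i < n" "V = U i" by auto
    have 1: "singular_simplex 1 X (back_face i 1 \<sigma>)"
      using edge_simplex[OF \<sigma>, of i] i n by simp
    have "(\<lambda>j. if j < i then 0 else x (j - i)) \<in> standard_simplex (Suc p)" if "x \<in> standard_simplex 1" for x
      using shift_standard_simplex[of x 1 i] that standard_simplex_mono[of "i + 1" n] i n by auto
    then have "back_face i 1 \<sigma> \<in> standard_simplex 1 \<rightarrow> U i"
      using V i by (auto simp: back_face_def)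
    then have "b i (back_face i 1 \<sigma>) = 0" using b0[OF i(1) 1] by simp
    then have "(\<Prod>i<Suc p. b i (back_face i 1 \<sigma>)) = 0" using i n by (intro prod_zero) auto
    then show "edge_product (Suc p) X b \<sigma> = 0"
      using \<sigma> unfolding edge_product_def by (simp only: restrict_apply mem_Collect_eq if_True)
  qed (use opn cover in auto)
  then have "\<one>\<^bsub>cohomology_group n X\<^esub> = cohomology_class n X (edge_product n X b)"
    using cohomology_class_trivial_iff singular_coboundary_set_carrier by blast
  also have "\<dots> = iterated_cup X (\<lambda>i. cohomology_class 1 X (b i)) n"
    by (rule iterated_cup_class[symmetric]) (rule b)
  also have "\<dots> = iterated_cup X (\<lambda>i. cohomology_class 1 X (?a i)) n"
    by (rule iterated_cup_cong) (rule bclass)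
  also have "\<dots> = cohomology_class n X (edge_product n X ?a)"
    by (rule iterated_cup_class) (rule a)
  finally show ?thesis
    using cohomology_class_trivial_iff[of "edge_product n X ?a" n X] edge_product_cocycle[of n ?a X] a
    by (simp add: singular_cocycle_set_iff)
qed

section \<open>The restricted angle class\<close>

type_synonym configuration = "(nat \<Rightarrow> complex) \<times> (nat \<Rightarrow> complex)"

text \<open>The cocycle that represents the restricted class.\<close>

definition angle_product :: "complex cochain \<Rightarrow> nat \<Rightarrow> real \<Rightarrow> configuration cochain"
  where "angle_product \<phi> n r =
    edge_product n (Seg_length n r) (\<lambda>i. cochain_map 1 (Seg_length n r) (\<lambda>x. snd x i) \<phi>)"

lemma continuous_map_torus_angle: "i < n \<Longrightarrow> continuous_map (torus n) circle (\<lambda>u. u i)"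
  unfolding torus_def by (rule continuous_map_product_projection) simp

lemma continuous_map_angle:
  assumes "i < n" shows "continuous_map (Seg_length n r) circle (\<lambda>x. snd x i)"
proof -
  have "continuous_map (Seg_length n r) (torus n) snd"
    unfolding Seg_length_def Seg_def by (rule continuous_map_from_subtopology) (rule continuous_map_snd)
  from continuous_map_compose[OF this continuous_map_torus_angle[OF assms]]
  show ?thesis by (simp add: o_def)
qed

lemma edge_product_cong:
  "(\<And>i. i < n \<Longrightarrow> a i = b i) \<Longrightarrow> edge_product n X a = edge_product n X b"
  unfolding edge_product_def by (intro ext) (auto intro!: prod.cong simp: restrict_def)

lemma cochain_map_compose:
  assumes "continuous_map X Y f"
  shows "cochain_map p X f (cochain_map p Y g \<phi>) = cochain_map p X (g \<circ> f) \<phi>"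
  using singular_simplex_simplex_map[OF _ assms]
  by (intro ext) (auto simp: cochain_map_def simplex_map_compose)

lemma angle_product_cocycle:
  "\<phi> \<in> singular_cocycle_set 1 circle \<Longrightarrow> angle_product \<phi> n r \<in> singular_cocycle_set n (Seg_length n r)"
  unfolding angle_product_def
  using cochain_map_cocycle[OF continuous_map_angle] by (auto intro!: edge_product_cocycle)

lemma restricted_Seg_class:
  assumes \<phi>: "\<phi> \<in> singular_cocycle_set 1 circle"
  shows "cohomology_induced n (Seg_length n r) Seg_inclusion (Seg_class (cohomology_class 1 circle \<phi>) n) =
    cohomology_class n (Seg_length n r) (angle_product \<phi> n r)"
proof -
  let ?t = "\<lambda>i. cochain_map 1 (torus n) (\<lambda>u. u i) \<phi>"
  have \<phi>e: "\<phi> \<in> extensional (singular_simplex_set 1 circle)" using \<phi> by (simp add: singular_cocycle_set_iff)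
  have t: "?t i \<in> singular_cocycle_set 1 (torus n)" if "i < n" for i
    by (rule cochain_map_cocycle[OF continuous_map_torus_angle[OF that] \<phi>])
  have "torus_class (cohomology_class 1 circle \<phi>) n = iterated_cup (torus n) (\<lambda>i. cohomology_class 1 (torus n) (?t i)) n"
    unfolding torus_class_def
    by (intro iterated_cup_cong cohomology_induced_class continuous_map_torus_angle \<phi>e)
  also have "\<dots> = cohomology_class n (torus n) (edge_product n (torus n) ?t)"
    by (rule iterated_cup_class) (rule t)
  finally have tc: "torus_class (cohomology_class 1 circle \<phi>) n = cohomology_class n (torus n) (edge_product n (torus n) ?t)" .
  have am: "continuous_map (Seg n) (torus n) angle_map"
    unfolding angle_map_def Seg_def by (rule continuous_map_snd)
  have inc: "continuous_map (Seg_length n r) (Seg n) Seg_inclusion"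
    unfolding Seg_length_def Seg_inclusion_def by (simp add: continuous_map_from_subtopology)
  have SC: "Seg_class (cohomology_class 1 circle \<phi>) n =
      cohomology_class n (Seg n) (cochain_map n (Seg n) angle_map (edge_product n (torus n) ?t))"
    unfolding Seg_class_def tc
    by (rule cohomology_induced_class[OF am])
       (use edge_product_cocycle[OF t] in \<open>simp add: singular_cocycle_set_iff\<close>)
  have I: "cohomology_induced n (Seg_length n r) Seg_inclusion
        (cohomology_class n (Seg n) (cochain_map n (Seg n) angle_map (edge_product n (torus n) ?t))) =
      cohomology_class n (Seg_length n r) (cochain_map n (Seg_length n r) Seg_inclusion
         (cochain_map n (Seg n) angle_map (edge_product n (torus n) ?t)))"
    by (rule cohomology_induced_class[OF inc]) (simp only: cochain_map_def restrict_extensional)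
  have E: "cochain_map n (Seg_length n r) Seg_inclusion
         (cochain_map n (Seg n) angle_map (edge_product n (torus n) ?t)) = angle_product \<phi> n r"
    unfolding cochain_map_edge_product[OF am] cochain_map_edge_product[OF inc] angle_product_def
      cochain_map_compose[OF am] cochain_map_compose[OF inc]
    by (simp add: o_def angle_map_def Seg_inclusion_def)
  show ?thesis by (simp only: SC I E)
qed

lemma restricted_Seg_class_trivial_iff:
  assumes "\<phi> \<in> singular_cocycle_set 1 circle"
  shows "cohomology_induced n (Seg_length n r) Seg_inclusion (Seg_class (cohomology_class 1 circle \<phi>) n)
      = \<one>\<^bsub>cohomology_group n (Seg_length n r)\<^esub> \<longleftrightarrow>
    angle_product \<phi> n r \<in> singular_coboundary_set n (Seg_length n r)"
  unfolding restricted_Seg_class[OF assms]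
  by (rule cohomology_class_trivial_iff)
     (use angle_product_cocycle[OF assms] in \<open>simp add: singular_cocycle_set_iff\<close>)

lemma topspace_Seg_length:
  "x \<in> topspace (Seg_length n r) \<longleftrightarrow>
     fst x \<in> extensional {..<n} \<and> snd x \<in> extensional {..<n} \<and>
     (\<forall>i<n. norm (fst x i) \<le> 1 \<and> norm (snd x i) = 1) \<and> inj_on (fst x) {..<n} \<and>
     (\<forall>i<n. segment r (fst x i) (snd x i) \<subseteq> cball 0 1) \<and>
     disjoint_family_on (\<lambda>i. segment r (fst x i) (snd x i)) {..<n}"
  by (cases x) (auto simp: Seg_length_def Seg_def Conf_disk_def torus_def circle_def PiE_iff)

lemma continuous_map_center:
  assumes "i < n" shows "continuous_map (Seg_length n r) euclidean (\<lambda>x. fst x i)"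
proof -
  have "continuous_map (Seg_length n r) (Conf_disk n) fst"
    unfolding Seg_length_def Seg_def by (rule continuous_map_from_subtopology) (rule continuous_map_fst)
  then have "continuous_map (Seg_length n r) (product_topology (\<lambda>_. top_of_set (cball 0 1)) {..<n}) fst"
    unfolding Conf_disk_def by (rule continuous_map_into_fulltopology)
  then have "continuous_map (Seg_length n r) (top_of_set (cball 0 1)) (\<lambda>x. fst x i)"
    using assms by (simp add: continuous_map_componentwise)
  then show ?thesis by (rule continuous_map_into_fulltopology)
qed

lemma continuous_map_forget:
  "continuous_map (Seg_length (Suc n) r) (Seg_length n r)
     (\<lambda>x. (restrict (fst x) {..<n}, restrict (snd x) {..<n}))"
proof -
  have a: "continuous_map (Seg_length (Suc n) r) circle (\<lambda>x. snd x i)" if "i < n" for i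
    using continuous_map_angle[of i "Suc n" r] that by simp
  have "continuous_map (Seg_length (Suc n) r) (Seg n) (\<lambda>x. (restrict (fst x) {..<n}, restrict (snd x) {..<n}))"
    unfolding Seg_def Conf_disk_def torus_def continuous_map_pairedI
    by (intro continuous_map_pairedI)
       (auto simp: continuous_map_in_subtopology continuous_map_componentwise a topspace_Seg_length
         inj_on_def intro!: continuous_map_center)
  then show ?thesis
    unfolding Seg_length_def[of n]
    by (auto simp: continuous_map_in_subtopology topspace_Seg_length disjoint_family_on_def)
qed

text \<open>The first \<open>n\<close> factors of the product are pulled back along the map that forgets the last segment.\<close>

lemma angle_product_Suc_coboundary:
  assumes \<phi>: "\<phi> \<in> singular_cocycle_set 1 circle"
    and "angle_product \<phi> n r \<in> singular_coboundary_set n (Seg_length n r)"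
  shows "angle_product \<phi> (Suc n) r \<in> singular_coboundary_set (Suc n) (Seg_length (Suc n) r)"
proof -
  let ?f = "\<lambda>x :: configuration. (restrict (fst x) {..<n}, restrict (snd x) {..<n})"
  let ?X = "Seg_length (Suc n) r"
  let ?a = "\<lambda>i. cochain_map 1 ?X (\<lambda>x. snd x i) \<phi>"
  have "cochain_map n ?X ?f (angle_product \<phi> n r) \<in> singular_coboundary_set n ?X"
    by (rule cochain_map_coboundary[OF continuous_map_forget assms(2)])
  also have "cochain_map n ?X ?f (angle_product \<phi> n r) = edge_product n ?X ?a"
    unfolding angle_product_def cochain_map_edge_product[OF continuous_map_forget]
      cochain_map_compose[OF continuous_map_forget]
    by (rule edge_product_cong) (simp add: o_def cong: if_cong)
  finally show ?thesis
    unfolding angle_product_def edge_product_Suc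
    using coboundary_cup_cocycle[of "edge_product n ?X ?a" n ?X "?a n" 1]
      cochain_map_cocycle[OF continuous_map_angle[of n "Suc n" r] \<phi>]
    by (simp add: angle_product_def)
qed

section \<open>Segments as graphs\<close>

text \<open>A segment whose direction is close to \<open>1\<close> is seen as a graph over the real axis: it starts over \<open>tail\<close>,
ends over \<open>head\<close>, and \<open>height\<close> is its line, extended to all abscissas.\<close>

definition tail :: "real \<Rightarrow> complex \<Rightarrow> complex \<Rightarrow> real"
  where "tail r c u = Re c - r / 2 * Re u"

definition head :: "real \<Rightarrow> complex \<Rightarrow> complex \<Rightarrow> real"
  where "head r c u = Re c + r / 2 * Re u"

definition height :: "complex \<Rightarrow> complex \<Rightarrow> real \<Rightarrow> real"
  where "height c u y = Im c + (y - Re c) * (Im u / Re u)"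

lemma segment_graph:
  assumes "r > 0" "Re u > 0" "tail r c u \<le> y" "y \<le> head r c u"
  shows "Complex y (height c u y) \<in> segment r c u"
proof -
  define s where "s = (y - Re c) / Re u"
  have s: "\<bar>s\<bar> \<le> r / 2"
    unfolding abs_le_iff using assms by (auto simp: s_def tail_def head_def field_simps)
  have "Complex y (height c u y) = (1 - (1/2 + s / r)) *\<^sub>R (c - (r / 2) *\<^sub>R u) + (1/2 + s / r) *\<^sub>R (c + (r / 2) *\<^sub>R u)"
    using assms by (auto simp: complex_eq_iff height_def s_def field_simps)
  moreover have "0 \<le> 1/2 + s / r" "1/2 + s / r \<le> 1"
    using s \<open>r > 0\<close> by (auto simp: abs_le_iff field_simps)
  ultimately show ?thesis unfolding segment_def closed_segment_def by blast
qed

lemma segment_rotate: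
  assumes "norm d = 1" "z \<in> segment r (cnj d * c) (cnj d * u)"
  shows "d * z \<in> segment r c u"
proof -
  obtain t where t: "0 \<le> t" "t \<le> 1"
    and z: "z = (1 - t) *\<^sub>R (cnj d * c - (r / 2) *\<^sub>R (cnj d * u)) + t *\<^sub>R (cnj d * c + (r / 2) *\<^sub>R (cnj d * u))"
    using assms(2) unfolding segment_def closed_segment_def by blast
  have d: "d * cnj d = 1" using assms(1) by (simp add: complex_norm_square[symmetric])
  have "d * z = (d * cnj d) * ((1 - t) *\<^sub>R (c - (r / 2) *\<^sub>R u) + t *\<^sub>R (c + (r / 2) *\<^sub>R u))"
    unfolding z by (simp add: scaleR_conv_of_real algebra_simps)
  then show ?thesis using t unfolding d segment_def closed_segment_def by auto
qed

text \<open>The constants here and below are generous. A direction \<open>u\<close> counts as close to \<open>1\<close> if \<open>Re u > 1 - 1/10^6\<close>;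
this contains the targets \<open>cis (\<plusminus>1/1000)\<close> in its interior.\<close>

lemma nearly_aligned_slope:
  assumes "norm u = 1" "Re u > 1 - 1/10^6"
  shows "\<bar>Im u / Re u\<bar> \<le> 1/400"
proof -
  have "(Re u)^2 + (Im u)^2 = 1" using assms(1) by (metis cmod_power2 one_power2)
  moreover have "(Re u)^2 \<ge> (1 - 1/10^6)^2" using assms(2) by (intro power_mono) auto
  ultimately have "(Im u)^2 \<le> (1/500)^2" by (simp add: power2_eq_square)
  then have "\<bar>Im u\<bar> \<le> 1/500" by (metis abs_le_square_iff abs_of_nonneg zero_le_divide_1_iff zero_le_numeral)
  then show ?thesis using assms(2) by (simp add: abs_le_iff field_simps)
qed

lemma nearly_aligned_length:
  assumes "Re u > 1 - 1/10^6" "r \<ge> 1 - 1/10^6"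
  shows "head r c u - tail r c u \<ge> 1 - 1/10^5"
proof -
  have "r * Re u \<ge> (1 - 1/10^6) * (1 - 1/10^6)" using assms by (intro mult_mono) auto
  then show ?thesis by (simp add: head_def tail_def)
qed

lemma height_affine: "height c u y = height c u y' + (Im u / Re u) * (y - y')"
proof -
  have "(y - Re c) * s = (y' - Re c) * s + s * (y - y')" for s by (simp add: algebra_simps)
  from this[of "Im u / Re u"] show ?thesis unfolding height_def by linarith
qed

lemma aligned_in_disk:
  assumes u: "norm u = 1" "Re u > 1 - 1/10^6" and r: "r \<ge> 1 - 1/10^6"
    and disk: "segment r c u \<subseteq> cball 0 1"
  shows "\<And>y. tail r c u \<le> y \<Longrightarrow> y \<le> head r c u \<Longrightarrow> y^2 + (height c u y)^2 \<le> 1"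
    "-1 \<le> tail r c u" "tail r c u \<le> 1/10^5" "-1/10^5 \<le> head r c u" "head r c u \<le> 1"
proof -
  have r0: "r > 0" and u0: "Re u > 0" using u r by auto
  show *: "y^2 + (height c u y)^2 \<le> 1" if "tail r c u \<le> y" "y \<le> head r c u" for y
  proof -
    have "norm (Complex y (height c u y)) \<le> 1"
      using segment_graph[OF r0 u0 that] disk by auto
    then show ?thesis by (simp add: cmod_def)
  qed
  have le: "tail r c u \<le> head r c u" and len: "head r c u - tail r c u \<ge> 1 - 1/10^5"
    using nearly_aligned_length[OF u(2) r, of c] by auto
  have "(tail r c u)^2 \<le> 1" "(head r c u)^2 \<le> 1"
    using *[OF order_refl le] *[OF le order_refl] by (smt (verit) zero_le_power2)+
  then have "\<bar>tail r c u\<bar> \<le> 1" "\<bar>head r c u\<bar> \<le> 1" by (simp_all add: abs_square_le_1)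
  then show "-1 \<le> tail r c u" "tail r c u \<le> 1/10^5" "-1/10^5 \<le> head r c u" "head r c u \<le> 1"
    using len by auto
qed

text \<open>If a segment of length almost 1 starts close to the center or in front of it, then it ends close to the
unit circle. There the disk is narrow, so the end is close to the axis, and then so is the whole segment.\<close>

lemma radial_segment:
  assumes u: "norm u = 1" "Re u > 1 - 1/10^6" and r: "r \<ge> 1 - 1/10^6"
    and disk: "segment r c u \<subseteq> cball 0 1" and t: "tail r c u \<ge> -1/1000"
    and y: "1/1000 \<le> y" "y \<le> 99/100"
  shows "tail r c u \<le> y" "y \<le> head r c u" "\<bar>height c u y\<bar> \<le> 1/20"
proof -
  note al = nearly_aligned_slope[OF u] nearly_aligned_length[OF u(2) r, of c] and D = aligned_in_disk[OF u r disk]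
  have hd: "head r c u \<ge> 99898/100000" using al(2) t by simp
  show 1: "tail r c u \<le> y" "y \<le> head r c u" using D(3) y hd by auto
  have "(head r c u)^2 \<ge> (99898/100000)^2" using hd by (intro power_mono) auto
  moreover have "(head r c u)^2 + (height c u (head r c u))^2 \<le> 1"
    using D(1)[of "head r c u"] al(2) by simp
  ultimately have "(height c u (head r c u))^2 \<le> (46/1000)^2" by (simp add: power2_eq_square)
  then have h: "\<bar>height c u (head r c u)\<bar> \<le> 46/1000"
    by (metis abs_le_square_iff abs_of_nonneg zero_le_divide_iff zero_le_numeral)
  have "\<bar>(Im u / Re u) * (y - head r c u)\<bar> \<le> 1/400 * 1"
    unfolding abs_mult using al(1) 1 D(5) y by (intro mult_mono) auto
  then show "\<bar>height c u y\<bar> \<le> 1/20"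
    using h height_affine[of c u y "head r c u"] by linarith
qed

section \<open>Crossing segments in perpendicular directions\<close>

lemma lines_cross:
  fixes \<alpha> \<beta> \<sigma> \<tau> :: real
  assumes "\<bar>\<sigma>\<bar> \<le> 1/400" "\<bar>\<tau>\<bar> \<le> 1/400"
  obtains x y where "x = \<alpha> + \<sigma> * y" "y = \<beta> + \<tau> * x" "\<bar>y\<bar> \<le> 2 * \<bar>\<beta> + \<tau> * \<alpha>\<bar>"
proof
  have "\<bar>\<sigma> * \<tau>\<bar> \<le> 1/400 * (1/400)" unfolding abs_mult using assms by (intro mult_mono) auto
  then have d: "1 - \<sigma> * \<tau> \<ge> 10/11" by (simp add: abs_le_iff)
  let ?y = "(\<beta> + \<tau> * \<alpha>) / (1 - \<sigma> * \<tau>)"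
  show "\<alpha> + \<sigma> * ?y = \<alpha> + \<sigma> * ?y" ..
  show "?y = \<beta> + \<tau> * (\<alpha> + \<sigma> * ?y)" using d by (simp add: field_simps)
  have "\<bar>\<beta> + \<tau> * \<alpha>\<bar> * 1 \<le> \<bar>\<beta> + \<tau> * \<alpha>\<bar> * (2 * (1 - \<sigma> * \<tau>))"
    using d by (intro mult_left_mono) auto
  then show "\<bar>?y\<bar> \<le> 2 * \<bar>\<beta> + \<tau> * \<alpha>\<bar>" using d by (simp add: abs_divide field_simps)
qed

text \<open>A steep line \<open>x = \<alpha> + \<sigma> y\<close> reaches \<open>1/10\<close> to both sides of the horizontal axis. It cannot meet the two flat
lines that run from the center almost to the boundary, so it crosses the axis near the center or near
the boundary. The latter is impossible, as its length would take it out of the disk.\<close>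

lemma crossing_near_center:
  fixes \<alpha> \<sigma> v0 v1 \<beta> \<tau> \<beta>' \<tau>' :: real
  assumes slopes: "\<bar>\<sigma>\<bar> \<le> 1/400" "\<bar>\<tau>\<bar> \<le> 1/400" "\<bar>\<tau>'\<bar> \<le> 1/400"
    and v: "v0 \<le> -1/10" "1/10 \<le> v1" "v1 - v0 \<ge> 99/100"
    and disk: "\<And>y. v0 \<le> y \<Longrightarrow> y \<le> v1 \<Longrightarrow> (\<alpha> + \<sigma> * y)^2 + y^2 \<le> 1"
    and east: "\<And>x. 1/1000 \<le> x \<Longrightarrow> x \<le> 99/100 \<Longrightarrow> \<bar>\<beta> + \<tau> * x\<bar> \<le> 1/20"
    and west: "\<And>x. -99/100 \<le> x \<Longrightarrow> x \<le> -1/1000 \<Longrightarrow> \<bar>\<beta>' + \<tau>' * x\<bar> \<le> 1/20"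
    and off_east: "\<And>x y. v0 \<le> y \<Longrightarrow> y \<le> v1 \<Longrightarrow> x = \<alpha> + \<sigma> * y \<Longrightarrow>
       1/1000 \<le> x \<Longrightarrow> x \<le> 99/100 \<Longrightarrow> y = \<beta> + \<tau> * x \<Longrightarrow> False"
    and off_west: "\<And>x y. v0 \<le> y \<Longrightarrow> y \<le> v1 \<Longrightarrow> x = \<alpha> + \<sigma> * y \<Longrightarrow>
       -99/100 \<le> x \<Longrightarrow> x \<le> -1/1000 \<Longrightarrow> y = \<beta>' + \<tau>' * x \<Longrightarrow> False"
  shows "\<bar>\<alpha>\<bar> \<le> 1/500"
proof -
  have small: "\<bar>\<sigma> * y\<bar> \<le> 1/400 * \<bar>y\<bar>" for y
    unfolding abs_mult using slopes by (intro mult_right_mono) auto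
  have far: "\<bar>\<alpha>\<bar> \<le> 98/100"
  proof (rule ccontr)
    assume nfar: "\<not> \<bar>\<alpha>\<bar> \<le> 98/100"
    obtain y where y: "v0 \<le> y" "y \<le> v1" "49/100 \<le> \<bar>y\<bar>"
    proof (cases "v1 \<ge> 49/100")
      case True then show ?thesis using v by (intro that[of v1]) auto
    next
      case False then show ?thesis using v by (intro that[of v0]) auto
    qed
    have y2: "y^2 \<ge> (49/100)^2" using y(3) by (metis abs_le_square_iff abs_of_nonneg zero_le_divide_iff zero_le_numeral)
    have "y^2 \<le> 1" using disk[OF y(1,2)] by (smt (verit) zero_le_power2)
    then have "\<bar>y\<bar> \<le> 1" by (simp add: abs_square_le_1)
    then have "\<bar>\<alpha> + \<sigma> * y\<bar> \<ge> 97/100" using small[of y] nfar by linarith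
    then have "(\<alpha> + \<sigma> * y)^2 \<ge> (97/100)^2"
      by (metis abs_le_square_iff abs_of_nonneg zero_le_divide_iff zero_le_numeral)
    then show False using y2 disk[OF y(1,2)] by (simp add: power2_eq_square)
  qed
  show ?thesis
  proof (rule ccontr)
    assume n: "\<not> ?thesis"
    show False
    proof (cases "\<alpha> > 0")
      case True
      then have e: "\<bar>\<beta> + \<tau> * \<alpha>\<bar> \<le> 1/20" using n far by (intro east) auto
      obtain x y where xy: "x = \<alpha> + \<sigma> * y" "y = \<beta> + \<tau> * x" "\<bar>y\<bar> \<le> 2 * \<bar>\<beta> + \<tau> * \<alpha>\<bar>"
        using lines_cross[OF slopes(1,2)] by blast
      have y: "\<bar>y\<bar> \<le> 1/10" by (rule order_trans[OF xy(3)]) (use e in simp)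
      then have "\<bar>x - \<alpha>\<bar> \<le> 1/4000" using small[of y] xy(1) by simp
      then show False using off_east[OF _ _ xy(1) _ _ xy(2)] y v n far True by linarith
    next
      case False
      then have e: "\<bar>\<beta>' + \<tau>' * \<alpha>\<bar> \<le> 1/20" using n far by (intro west) auto
      obtain x y where xy: "x = \<alpha> + \<sigma> * y" "y = \<beta>' + \<tau>' * x" "\<bar>y\<bar> \<le> 2 * \<bar>\<beta>' + \<tau>' * \<alpha>\<bar>"
        using lines_cross[OF slopes(1,3)] by blast
      have y: "\<bar>y\<bar> \<le> 1/10" by (rule order_trans[OF xy(3)]) (use e in simp)
      then have "\<bar>x - \<alpha>\<bar> \<le> 1/4000" using small[of y] xy(1) by simp
      then show False using off_west[OF _ _ xy(1) _ _ xy(2)] y v n far False by linarith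
    qed
  qed
qed

lemma central_segments_cross:
  fixes \<alpha> \<beta> \<sigma> \<tau> :: real
  assumes "\<bar>\<sigma>\<bar> \<le> 1/400" "\<bar>\<tau>\<bar> \<le> 1/400" "\<bar>\<alpha>\<bar> \<le> 1/500" "\<bar>\<beta>\<bar> \<le> 1/500"
  obtains x y where "x = \<alpha> + \<sigma> * y" "y = \<beta> + \<tau> * x" "\<bar>x\<bar> \<le> 1/10" "\<bar>y\<bar> \<le> 1/10"
proof -
  obtain x y where xy: "x = \<alpha> + \<sigma> * y" "y = \<beta> + \<tau> * x" "\<bar>y\<bar> \<le> 2 * \<bar>\<beta> + \<tau> * \<alpha>\<bar>"
    using lines_cross[OF assms(1,2)] by blast
  have "\<bar>\<tau> * \<alpha>\<bar> \<le> 1/400 * (1/500)" unfolding abs_mult using assms by (intro mult_mono) auto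
  then have e: "\<bar>\<beta> + \<tau> * \<alpha>\<bar> \<le> 1/20"
    using assms(4) by (intro order_trans[OF abs_triangle_ineq]) linarith
  have y: "\<bar>y\<bar> \<le> 1/10" by (rule order_trans[OF xy(3)]) (use e in simp)
  have "\<bar>\<sigma> * y\<bar> \<le> 1/400 * (1/10)" unfolding abs_mult using assms y by (intro mult_mono) auto
  then have "\<bar>x\<bar> \<le> 1/10" using xy(1) assms(3) by linarith
  then show ?thesis using that xy y by blast
qed

section \<open>Segments with alternating slopes\<close>

text \<open>Here \<open>p\<close> and \<open>q\<close> are the positions of the segments on the two sides of a strip, and their order on both
sides is the same. A segment of even rank moves by \<open>\<omega>\<close> to the right and its successor by \<open>\<omega>\<close> to the left,
so the two are at least \<open>2\<omega>\<close> apart before.\<close>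

lemma alternating_rank_bound:
  fixes p q :: "'i \<Rightarrow> real"
  assumes S: "finite S" "S \<noteq> {}" and "inj_on p S"
    and mono: "\<And>i j. i \<in> S \<Longrightarrow> j \<in> S \<Longrightarrow> p i < p j \<Longrightarrow> q i < q j"
    and even: "\<And>i. i \<in> S \<Longrightarrow> even (card {j\<in>S. p j < p i}) \<Longrightarrow> q i = p i + \<omega>"
    and odd: "\<And>i. i \<in> S \<Longrightarrow> odd (card {j\<in>S. p j < p i}) \<Longrightarrow> q i = p i - \<omega>"
    and lo: "\<And>i. i \<in> S \<Longrightarrow> -1 \<le> p i" and hi: "\<And>i. i \<in> S \<Longrightarrow> p i \<le> 1" and "\<omega> \<ge> 0"
  shows "\<omega> * (real (card S) - 1) \<le> 2"
proof -
  define rk where "rk i = card {j\<in>S. p j < p i}" for i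
  \<comment> \<open>After an odd number of steps the next segment is only known to lie further right, hence the extra term.\<close>
  have *: "p i \<ge> -1 + \<omega> * real k + (if odd k then \<omega> else 0)" if "i \<in> S" "rk i = k" for i k
    using that
  proof (induction k arbitrary: i)
    case 0
    then show ?case using lo by simp
  next
    case (Suc k)
    let ?L = "{j\<in>S. p j < p i}"
    have "finite ?L" using S(1) by simp
    moreover have "?L \<noteq> {}" using Suc.prems(2) unfolding rk_def by (metis card.empty nat.distinct(1))
    ultimately have L: "finite ?L" "?L \<noteq> {}" by auto
    obtain j where j: "j \<in> ?L" "\<And>l. l \<in> ?L \<Longrightarrow> p l \<le> p j"
      using obtains_MAX[OF L, of p] L(1) by (metis (no_types, lifting) Max_ge finite_imageI image_eqI)
    have "{l\<in>S. p l < p j} = ?L - {j}"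
      using j \<open>inj_on p S\<close> by (fastforce simp: inj_on_def order.strict_iff_order)
    then have "rk j = k" using Suc.prems L j by (simp add: rk_def)
    then have IH: "p j \<ge> -1 + \<omega> * real k + (if odd k then \<omega> else 0)" using Suc.IH j by auto
    have "q j < q i" using mono[of j i] j Suc.prems by auto
    then show ?case
      using IH j even[of j] odd[of j] even[of i] odd[of i] \<open>rk j = k\<close> Suc.prems \<open>\<omega> \<ge> 0\<close>
      by (cases "even k") (auto simp: rk_def algebra_simps)
  qed
  obtain i where i: "i \<in> S" "\<And>l. l \<in> S \<Longrightarrow> p l \<le> p i"
    using obtains_MAX[OF S, of p] S(1) by (metis Max_ge finite_imageI image_eqI)
  have "{j\<in>S. p j < p i} = S - {i}"
    using i \<open>inj_on p S\<close> by (fastforce simp: inj_on_def order.strict_iff_order)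
  then have "rk i = card S - 1" using S i by (simp add: rk_def)
  moreover have "card S \<ge> 1" using S by (simp add: Suc_leI card_gt_0_iff)
  ultimately have "p i \<ge> -1 + \<omega> * (real (card S) - 1)"
    using *[OF i(1), of "card S - 1"] \<open>\<omega> \<ge> 0\<close> by (simp add: of_nat_diff split: if_splits)
  then show ?thesis using hi[OF i(1)] by simp
qed

section \<open>Branches of the argument\<close>

text \<open>The argument with values in \<open>[\<theta>, \<theta> + 2\<pi>)\<close>, continuous away from direction \<open>\<theta>\<close>.\<close>

definition branch :: "real \<Rightarrow> complex \<Rightarrow> real"
  where "branch \<theta> z = Arg2pi (z * cis (- \<theta>)) + \<theta>"

lemma cis_Arg2pi: "norm z = 1 \<Longrightarrow> cis (Arg2pi z) = z"
  using complex_norm_eq_1_exp[of z] by (simp add: cis_conv_exp)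

lemma cis_branch: "norm z = 1 \<Longrightarrow> cis (branch \<theta> z) = z"
  using cis_Arg2pi[of "z * cis (- \<theta>)"]
  by (simp add: branch_def norm_mult mult.assoc cis_mult flip: cis_mult[of "Arg2pi _"])

lemma continuous_on_branch: "continuous_on (sphere 0 1 - {cis \<theta>}) (branch \<theta>)"
proof -
  have "z * cis (- \<theta>) \<notin> \<real>\<^sub>\<ge>\<^sub>0" if z: "z \<in> sphere 0 1 - {cis \<theta>}" for z
  proof
    assume "z * cis (- \<theta>) \<in> \<real>\<^sub>\<ge>\<^sub>0"
    moreover have "norm (z * cis (- \<theta>)) = 1" using z by (simp add: norm_mult)
    ultimately have "z * cis (- \<theta>) = 1"
      by (auto simp: nonneg_Reals_def)
    then have "z * cis (- \<theta>) * cis \<theta> = cis \<theta>" by simp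
    then show False using z by (simp add: mult.assoc cis_mult)
  qed
  then have "continuous_on ((\<lambda>z. z * cis (- \<theta>)) ` (sphere 0 1 - {cis \<theta>})) Arg2pi"
    by (intro continuous_at_imp_continuous_on ballI continuous_at_Arg2pi) auto
  moreover have "continuous_on (sphere 0 1 - {cis \<theta>}) (\<lambda>z. z * cis (- \<theta>))"
    by (intro continuous_intros)
  ultimately have "continuous_on (sphere 0 1 - {cis \<theta>}) (\<lambda>z. Arg2pi (z * cis (- \<theta>)))"
    using continuous_on_compose[of _ "\<lambda>z. z * cis (- \<theta>)" Arg2pi] by (simp add: o_def)
  then show ?thesis unfolding branch_def by (intro continuous_intros)
qed

text \<open>The two cuts at \<open>\<plusminus>\<eta>\<close> differ only on the arc between them.\<close>

lemma branch_agree: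
  assumes z: "norm z = 1" "Re z < cos \<eta>" and \<eta>: "0 < \<eta>" "\<eta> < pi / 2"
  shows "branch \<eta> z = branch (- \<eta>) z"
proof -
  define t where "t = Arg2pi (z * cis \<eta>)"
  have t: "0 \<le> t" "t < 2 * pi" using Arg2pi[of "z * cis \<eta>"] by (auto simp: t_def)
  have "cis t = z * cis \<eta>" unfolding t_def using z by (intro cis_Arg2pi) (simp add: norm_mult)
  then have zt: "z = cis (t - \<eta>)" by (simp add: cis_divide[symmetric] mult.assoc cis_mult field_simps)
  have "t > 2 * \<eta>"
  proof (rule ccontr)
    assume "\<not> t > 2 * \<eta>"
    then have "cos \<eta> \<le> cos \<bar>t - \<eta>\<bar>" using t \<eta> by (intro cos_monotone_0_pi_le) auto
    then show False using z(2) by (simp add: zt)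
  qed
  moreover have "z * cis (- \<eta>) = cis (t - 2 * \<eta>)" by (simp add: zt cis_mult)
  then have e: "of_real 1 * exp (\<i> * of_real (t - 2 * \<eta>)) = z * cis (- \<eta>)"
    by (simp only: cis_conv_exp of_real_1 mult_1)
  ultimately have "Arg2pi (z * cis (- \<eta>)) = t - 2 * \<eta>"
    using t \<eta> by (intro Arg2pi_unique[OF e]) auto
  then show ?thesis by (simp add: branch_def t_def)
qed

section \<open>Lifts from a locally constant parity\<close>

lemma openin_less_than:
  assumes "continuous_map X euclideanreal f" "continuous_map X euclideanreal g"
  shows "openin X {x \<in> topspace X. f x < g x}"
proof -
  have "openin X {x \<in> topspace X. g x - f x \<in> {0<..}}"
    by (intro openin_continuous_map_preimage[where Y = euclideanreal] continuous_map_diff assms) auto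
  then show ?thesis by (simp add: Collect_conj_eq)
qed

text \<open>On \<open>good\<close> the number of \<open>j\<close> with \<open>L j x\<close> is locally constant, and its parity selects a target \<open>cis \<eta>\<close> or
\<open>cis (-\<eta>)\<close>. The set \<open>U\<close> consists of the points whose angle is outside the arc between the targets and of
the good points whose angle avoids the selected target. On it the argument with the cut at the selected
target is continuous, because outside the arc both cuts give the same value.\<close>

lemma parity_lift:
  fixes \<alpha> :: "'a \<Rightarrow> complex" and L :: "'i \<Rightarrow> 'a \<Rightarrow> bool"
  assumes \<alpha>: "continuous_map X circle \<alpha>" and "finite G" and gd: "openin X good"
    and L: "\<And>j. j \<in> G \<Longrightarrow> openin X {x\<in>good. L j x}" "\<And>j. j \<in> G \<Longrightarrow> openin X {x\<in>good. \<not> L j x}"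
    and \<eta>: "0 < \<eta>" "\<eta> < pi / 2"
  obtains U A where "openin X U" "continuous_map (subtopology X U) euclideanreal A"
    "\<And>x. x \<in> U \<Longrightarrow> cis (A x) = \<alpha> x"
    "\<And>x. x \<in> topspace X \<Longrightarrow> x \<notin> U \<Longrightarrow> Re (\<alpha> x) \<ge> cos \<eta> \<and>
       (x \<in> good \<longrightarrow> \<alpha> x = cis (if even (card {j\<in>G. L j x}) then \<eta> else - \<eta>))"
proof -
  define N where "N x = card {j\<in>G. L j x}" for x
  have sph: "norm (\<alpha> x) = 1" if "x \<in> topspace X" for x
    using \<alpha> that by (auto simp: circle_def continuous_map_in_subtopology Pi_iff)
  have cr: "continuous_map X euclidean \<alpha>"
    using \<alpha> unfolding circle_def by (rule continuous_map_into_fulltopology)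
  have Npar: "openin X {x\<in>good. P (N x)}" for P
  proof (subst openin_subopen, intro ballI)
    fix x assume x: "x \<in> {x\<in>good. P (N x)}"
    define W where "W = good \<inter> (\<Inter>j\<in>G. {y\<in>good. L j y = L j x})"
    have "openin X {y\<in>good. L j y = L j x}" if "j \<in> G" for j
      using L[OF that] by (cases "L j x") auto
    then have "openin X W"
    proof (cases "G = {}")
      case False
      then show ?thesis
        using \<open>finite G\<close> gd \<open>\<And>j. j \<in> G \<Longrightarrow> openin X {y\<in>good. L j y = L j x}\<close>
        unfolding W_def by (intro openin_Int openin_Inter) auto
    qed (simp add: W_def gd)
    moreover have NW: "N y = N x" if "y \<in> W" for y
    proof -
      have "{j\<in>G. L j y} = {j\<in>G. L j x}" using that unfolding W_def by (intro Collect_cong) auto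
      then show ?thesis by (simp add: N_def)
    qed
    have "y \<in> {x\<in>good. P (N x)}" if "y \<in> W" for y
    proof -
      have "y \<in> good" using that by (simp add: W_def)
      moreover have "P (N y)" using x unfolding NW[OF that] by blast
      ultimately show ?thesis by blast
    qed
    then have "W \<subseteq> {x\<in>good. P (N x)}" by (rule subsetI)
    moreover have "x \<in> W" using x by (simp add: W_def)
    ultimately show "\<exists>T. openin X T \<and> x \<in> T \<and> T \<subseteq> {x\<in>good. P (N x)}" by blast
  qed
  have ne: "openin X {x \<in> topspace X. \<alpha> x \<noteq> a}" for a
  proof -
    have "openin X {x \<in> topspace X. \<alpha> x \<in> - {a}}"
      by (rule openin_continuous_map_preimage[OF cr]) auto
    then show ?thesis by simp
  qed
  define Out where "Out = {x \<in> topspace X. Re (\<alpha> x) < cos \<eta>}"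
  define s where "s b = (if b then \<eta> else - \<eta>)" for b
  define T where "T b = Out \<union> ({x\<in>good. even (N x) = b} \<inter> {x \<in> topspace X. \<alpha> x \<noteq> cis (s b)})" for b
  have "openin X Out"
  proof -
    have "continuous_map X euclideanreal (Re \<circ> \<alpha>)"
      by (rule continuous_map_compose[OF cr]) (auto simp: intro!: continuous_intros)
    from openin_less_than[OF this, of "\<lambda>_. cos \<eta>"] show ?thesis by (simp add: Out_def)
  qed
  then have openT: "openin X (T b)" for b
    unfolding T_def by (intro openin_Un openin_Int Npar ne)
  have Tsub: "T b \<subseteq> topspace X" for b using openT by (rule openin_subset)
  have avoid: "\<alpha> x \<noteq> cis (s b)" if "x \<in> T b" for x b
    using that by (auto simp: T_def Out_def s_def)
  define U where "U = T True \<union> T False"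
  define A where "A x = (if x \<in> T True then branch \<eta> (\<alpha> x) else branch (- \<eta>) (\<alpha> x))" for x
  have "continuous_map (subtopology X U) euclideanreal A"
  proof (rule pasting_lemma[where I = UNIV and T = T and f = "\<lambda>b x. branch (s b) (\<alpha> x)"])
    fix b
    show "openin (subtopology X U) (T b)"
      unfolding openin_subtopology using openT[of b] by (intro exI[of _ "T b"]) (cases b; auto simp: U_def)
    have "continuous_map (subtopology X (T b)) (top_of_set (sphere 0 1 - {cis (s b)})) \<alpha>"
      using avoid Tsub sph cr
      by (auto simp: continuous_map_in_subtopology intro: continuous_map_from_subtopology)
    moreover have "continuous_map (top_of_set (sphere 0 1 - {cis (s b)})) euclideanreal (branch (s b))"
      using continuous_on_branch[of "s b"] by simp
    ultimately have "continuous_map (subtopology X (T b)) euclideanreal (branch (s b) \<circ> \<alpha>)"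
      by (rule continuous_map_compose)
    moreover have "subtopology (subtopology X U) (T b) = subtopology X (T b)"
      by (simp add: subtopology_subtopology, rule arg_cong[where f = "subtopology X"], cases b) (auto simp: U_def)
    ultimately show "continuous_map (subtopology (subtopology X U) (T b)) euclideanreal (\<lambda>x. branch (s b) (\<alpha> x))"
      by (simp add: o_def)
  next
    have ag: "branch \<eta> (\<alpha> x) = branch (- \<eta>) (\<alpha> x)" if "x \<in> T True" "x \<in> T False" for x
    proof -
      have "x \<in> Out" using that by (auto simp: T_def)
      then show ?thesis by (intro branch_agree \<eta>) (auto simp: Out_def sph)
    qed
    show "branch (s i) (\<alpha> x) = branch (s j) (\<alpha> x)"
      if "x \<in> topspace (subtopology X U) \<inter> T i \<inter> T j" for i j x
      using that ag[of x] by (cases i; cases j) (auto simp: s_def)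
    show "\<exists>j. j \<in> UNIV \<and> x \<in> T j \<and> A x = branch (s j) (\<alpha> x)" if "x \<in> topspace (subtopology X U)" for x
      using that by (cases "x \<in> T True") (auto simp: U_def A_def s_def)
  qed
  moreover have "cis (A x) = \<alpha> x" if "x \<in> U" for x
  proof -
    have "x \<in> topspace X" using that Tsub[of True] Tsub[of False] by (auto simp: U_def)
    from sph[OF this] show ?thesis by (simp add: A_def cis_branch)
  qed
  moreover have "Re (\<alpha> x) \<ge> cos \<eta> \<and>
       (x \<in> good \<longrightarrow> \<alpha> x = cis (if even (card {j\<in>G. L j x}) then \<eta> else - \<eta>))"
    if "x \<in> topspace X" "x \<notin> U" for x
    using that by (auto simp: U_def T_def Out_def s_def N_def)
  moreover have "openin X U" using openT by (auto simp: U_def)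
  ultimately show ?thesis using that by blast
qed

section \<open>Groups of nearly parallel segments\<close>

text \<open>Configurations are viewed in the frame of a unit complex number \<open>d\<close>, that is, rotated by \<open>cnj d\<close>, so that
direction \<open>d\<close> becomes \<open>1\<close>.\<close>

abbreviation cen :: "complex \<Rightarrow> configuration \<Rightarrow> nat \<Rightarrow> complex"
  where "cen d x i \<equiv> cnj d * fst x i"

abbreviation dir :: "complex \<Rightarrow> configuration \<Rightarrow> nat \<Rightarrow> complex"
  where "dir d x i \<equiv> cnj d * snd x i"

abbreviation seg :: "real \<Rightarrow> complex \<Rightarrow> configuration \<Rightarrow> nat \<Rightarrow> complex set"
  where "seg r d x i \<equiv> segment r (cen d x i) (dir d x i)"

abbreviation seg_tail :: "real \<Rightarrow> complex \<Rightarrow> configuration \<Rightarrow> nat \<Rightarrow> real"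
  where "seg_tail r d x i \<equiv> tail r (cen d x i) (dir d x i)"

abbreviation seg_head :: "real \<Rightarrow> complex \<Rightarrow> configuration \<Rightarrow> nat \<Rightarrow> real"
  where "seg_head r d x i \<equiv> head r (cen d x i) (dir d x i)"

abbreviation seg_height :: "complex \<Rightarrow> configuration \<Rightarrow> nat \<Rightarrow> real \<Rightarrow> real"
  where "seg_height d x i \<equiv> height (cen d x i) (dir d x i)"

lemma continuous_map_cmult:
  fixes f :: "'a \<Rightarrow> complex"
  assumes "continuous_map X euclidean f" shows "continuous_map X euclidean (\<lambda>x. c * f x)"
proof -
  have "continuous_map euclidean euclidean (\<lambda>z. c * z)" by (simp add: continuous_intros)
  from continuous_map_compose[OF assms this] show ?thesis by (simp add: o_def)
qed

lemma continuous_map_cen: "i < n \<Longrightarrow> continuous_map (Seg_length n r) euclidean (\<lambda>x. cen d x i)"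
  by (intro continuous_map_cmult continuous_map_center)

lemma continuous_map_dir: "i < n \<Longrightarrow> continuous_map (Seg_length n r) euclidean (\<lambda>x. dir d x i)"
  by (intro continuous_map_cmult continuous_map_into_fulltopology[OF continuous_map_angle[unfolded circle_def]])

lemma continuous_map_Re_Im:
  assumes "continuous_map X euclidean f"
  shows "continuous_map X euclideanreal (\<lambda>x. Re (f x))" "continuous_map X euclideanreal (\<lambda>x. Im (f x))"
  using continuous_map_compose[OF assms, of euclideanreal Re] continuous_map_compose[OF assms, of euclideanreal Im]
  by (auto simp: o_def continuous_intros)

lemma continuous_map_tail:
  assumes "i < n" shows "continuous_map (Seg_length n r) euclideanreal (\<lambda>x. seg_tail r d x i)"
  unfolding tail_def
  by (intro continuous_map_diff continuous_map_real_mult continuous_map_Re_Im continuous_map_cen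
      continuous_map_dir assms) auto

lemma continuous_map_head:
  assumes "i < n" shows "continuous_map (Seg_length n r) euclideanreal (\<lambda>x. seg_head r d x i)"
  unfolding head_def
  by (intro continuous_map_add continuous_map_real_mult continuous_map_Re_Im continuous_map_cen
      continuous_map_dir assms) auto

lemma Seg_length_rotated:
  assumes x: "x \<in> topspace (Seg_length n r)" and d: "norm d = 1" and "i < n"
  shows "norm (dir d x i) = 1" "seg r d x i \<subseteq> cball 0 1"
proof -
  show "norm (dir d x i) = 1" using assms by (auto simp: topspace_Seg_length norm_mult)
  show "seg r d x i \<subseteq> cball 0 1"
  proof
    fix z assume "z \<in> seg r d x i"
    then have "d * z \<in> segment r (fst x i) (snd x i)" by (rule segment_rotate[OF d])
    then have "norm (d * z) \<le> 1" using x \<open>i < n\<close> by (fastforce simp: topspace_Seg_length)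
    then show "z \<in> cball 0 1" using d by (simp add: norm_mult)
  qed
qed

lemma Seg_length_disjoint:
  assumes x: "x \<in> topspace (Seg_length n r)" and "norm d = 1" "norm e = 1" and "i < n" "j < n" "i \<noteq> j"
    and "z \<in> seg r d x i" "w \<in> seg r e x j"
  shows "d * z \<noteq> e * w"
proof
  assume eq: "d * z = e * w"
  have "d * z \<in> segment r (fst x i) (snd x i)" using assms by (intro segment_rotate)
  moreover have "d * z \<in> segment r (fst x j) (snd x j)" unfolding eq using assms by (intro segment_rotate)
  moreover have "disjoint_family_on (\<lambda>i. segment r (fst x i) (snd x i)) {..<n}"
    using x by (simp add: topspace_Seg_length)
  then have "segment r (fst x i) (snd x i) \<inter> segment r (fst x j) (snd x j) = {}"
    by (rule disjoint_family_onD) (use assms in auto)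
  ultimately show False by blast
qed

lemma heights_differ:
  assumes x: "x \<in> topspace (Seg_length n r)" and d: "norm d = 1" and "r > 0" and ij: "i < n" "j < n" "i \<noteq> j"
    and "Re (dir d x i) > 0" "Re (dir d x j) > 0"
    and "seg_tail r d x i \<le> y" "y \<le> seg_head r d x i"
    and "seg_tail r d x j \<le> y" "y \<le> seg_head r d x j"
  shows "seg_height d x i y \<noteq> seg_height d x j y"
  using Seg_length_disjoint[OF x d d ij segment_graph segment_graph] assms by metis

lemma continuous_on_height: "continuous_on S (height c u)"
proof -
  have "continuous_on S (\<lambda>y. Im c + (y - Re c) * k)" for k by (intro continuous_intros)
  then show ?thesis unfolding height_def[abs_def] .
qed

text \<open>Two disjoint segments cannot change their order over an interval of abscissas that both of them cover.\<close>

lemma heights_order: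
  assumes x: "x \<in> topspace (Seg_length n r)" and d: "norm d = 1" and "r > 0" and ij: "i < n" "j < n" "i \<noteq> j"
    and "Re (dir d x i) > 0" "Re (dir d x j) > 0" and ab: "a \<le> b"
    and "seg_tail r d x i \<le> a" "b \<le> seg_head r d x i"
    and "seg_tail r d x j \<le> a" "b \<le> seg_head r d x j"
    and less: "seg_height d x i a < seg_height d x j a"
  shows "seg_height d x i b < seg_height d x j b"
proof (rule ccontr)
  let ?f = "\<lambda>y. seg_height d x j y - seg_height d x i y"
  assume "\<not> ?thesis"
  then have "\<exists>y. a \<le> y \<and> y \<le> b \<and> ?f y = 0"
    using less ab by (intro IVT2' continuous_on_diff continuous_on_height) auto
  then obtain y where "a \<le> y" "y \<le> b" "?f y = 0" by blast
  then show False using heights_differ[OF x d \<open>r > 0\<close> ij, of y] assms by auto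
qed

text \<open>A group \<open>G\<close> of segments that point nearly in direction \<open>d\<close>. The predicate \<open>Q t i\<close> says that segment \<open>i\<close> is of
type \<open>t\<close>; then it covers the interval from \<open>lo t\<close> to \<open>hi t\<close>, and segments of the same type are linearly
ordered over it. Each segment aims at \<open>cis \<eta>\<close> or \<open>cis (-\<eta>)\<close>, according to the parity of its rank among the
segments of its type. If all segments have a type and hit their targets, then at least half of them
share a type and have alternating slopes, which does not fit into the disk if the group is large. So the
sets \<open>U i\<close> miss a configuration only if the group is nearly aligned and some segment has no type.\<close>

lemma group_cover:
  fixes Q :: "bool \<Rightarrow> nat \<Rightarrow> configuration \<Rightarrow> bool" and lo hi :: "bool \<Rightarrow> real"
  defines "\<eta> \<equiv> 1/1000"
  assumes r: "r \<ge> 1 - 1/10^6" and d: "norm d = 1" and G: "G \<subseteq> {..<n}"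
    and big: "tan \<eta> / 2000 * (real (card G) / 2 - 1) > 2"
    and Qopen: "\<And>t i. i \<in> G \<Longrightarrow> openin (Seg_length n r) {x \<in> topspace (Seg_length n r). Q t i x}"
    and Qin: "\<And>t i x. x \<in> topspace (Seg_length n r) \<Longrightarrow> i \<in> G \<Longrightarrow> Re (dir d x i) > 1 - 1/10^6 \<Longrightarrow> Q t i x \<Longrightarrow>
        seg_tail r d x i \<le> lo t \<and> hi t \<le> seg_head r d x i"
    and Qex: "\<And>i x. x \<in> topspace (Seg_length n r) \<Longrightarrow> i \<in> G \<Longrightarrow> Re (dir d x i) > 1 - 1/10^6 \<Longrightarrow>
        Q True i x \<Longrightarrow> Q False i x \<Longrightarrow> False"
    and lohi: "\<And>t. hi t - lo t \<ge> 1/2000"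
  obtains U A where "\<And>i. i \<in> G \<Longrightarrow> openin (Seg_length n r) (U i)"
    "\<And>i. i \<in> G \<Longrightarrow> continuous_map (subtopology (Seg_length n r) (U i)) euclideanreal (A i)"
    "\<And>i x. i \<in> G \<Longrightarrow> x \<in> U i \<Longrightarrow> cis (A i x) = snd x i"
    "\<And>x. x \<in> topspace (Seg_length n r) \<Longrightarrow> (\<And>i. i \<in> G \<Longrightarrow> x \<notin> U i) \<Longrightarrow>
       (\<forall>i\<in>G. Re (dir d x i) > 1 - 1/10^6) \<and> (\<exists>i\<in>G. \<forall>t. \<not> Q t i x)"
proof -
  let ?X = "Seg_length n r"
  let ?h = "\<lambda>x i. seg_height d x i"
  have r0: "r > 0" using r by simp
  have fG: "finite G" using G finite_subset by blast
  have "G \<noteq> {}" using big tan_gt_zero[of \<eta>] pi_gt3 by (auto simp: \<eta>_def)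
  define box where "box = {x \<in> topspace ?X. \<forall>i\<in>G. Re (dir d x i) > 1 - 1/10^6}"
  define good where "good = {x \<in> box. \<forall>i\<in>G. \<exists>t. Q t i x}"
  have inG: "i < n" if "i \<in> G" for i using that G by auto
  have openbox: "openin ?X box"
  proof -
    have "openin ?X {x \<in> topspace ?X. 1 - 1/10^6 < Re (dir d x i)}" if "i \<in> G" for i
      by (intro openin_less_than continuous_map_Re_Im continuous_map_dir inG that) auto
    then have "openin ?X (\<Inter>i\<in>G. {x \<in> topspace ?X. 1 - 1/10^6 < Re (dir d x i)})"
      using fG \<open>G \<noteq> {}\<close> by (intro openin_Inter) auto
    also have "\<dots> = box" using \<open>G \<noteq> {}\<close> by (auto simp: box_def)
    finally show ?thesis .
  qed
  have opengood: "openin ?X good"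
  proof -
    have "openin ?X (box \<inter> ({x \<in> topspace ?X. Q True i x} \<union> {x \<in> topspace ?X. Q False i x}))" if "i \<in> G" for i
      by (intro openin_Int openin_Un openbox Qopen that)
    then have "openin ?X (\<Inter>i\<in>G. box \<inter> ({x \<in> topspace ?X. Q True i x} \<union> {x \<in> topspace ?X. Q False i x}))"
      using fG \<open>G \<noteq> {}\<close> by (intro openin_Inter) auto
    also have "\<dots> = good" using \<open>G \<noteq> {}\<close> by (auto simp: good_def box_def ex_bool_eq)
    finally show ?thesis .
  qed
  have gx: "x \<in> topspace ?X" "Re (dir d x i) > 1 - 1/10^6" "Re (dir d x i) > 0" if "x \<in> good" "i \<in> G" for x i
    using that by (force simp: good_def box_def)+
  have openlt: "openin ?X {x \<in> good. ?h x i y < ?h x j y}" if "i \<in> G" "j \<in> G" for i j y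
  proof -
    have c: "continuous_map (subtopology ?X good) euclideanreal (\<lambda>x. ?h x i y)" if "i \<in> G" for i
    proof -
      have C: "continuous_map (subtopology ?X good) euclidean (\<lambda>x. cen d x i)"
        "continuous_map (subtopology ?X good) euclidean (\<lambda>x. dir d x i)"
        by (intro continuous_map_from_subtopology continuous_map_cen continuous_map_dir inG that)+
      have "continuous_map (subtopology ?X good) euclideanreal (\<lambda>x. Im (dir d x i) / Re (dir d x i))"
      proof (rule continuous_map_real_divide)
        fix x assume "x \<in> topspace (subtopology ?X good)"
        then show "Re (dir d x i) \<noteq> 0" using gx(3)[of x i] that by simp
      qed (intro continuous_map_Re_Im C)+
      then show ?thesis unfolding height_def
        by (intro continuous_map_add continuous_map_real_mult continuous_map_diff continuous_map_Re_Im C) auto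
    qed
    have "openin (subtopology ?X good) {x \<in> topspace (subtopology ?X good). ?h x i y < ?h x j y}"
      by (intro openin_less_than c that)
    then have "openin ?X {x \<in> topspace (subtopology ?X good). ?h x i y < ?h x j y}"
      using opengood by (rule openin_trans_full)
    also have "{x \<in> topspace (subtopology ?X good). ?h x i y < ?h x j y} = {x \<in> good. ?h x i y < ?h x j y}"
      using openin_subset[OF opengood] by auto
    finally show ?thesis .
  qed
  have contains: "seg_tail r d x i \<le> lo t" "hi t \<le> seg_head r d x i"
    "seg_tail r d x i \<le> hi t" "lo t \<le> seg_head r d x i"
    if "x \<in> good" "i \<in> G" "Q t i x" for x i t
    using Qin[OF gx(1)[OF that(1,2)] that(2) gx(2)[OF that(1,2)] that(3)] lohi[of t] by linarith+
  have uniq: "s = t" if x: "x \<in> good" and i: "i \<in> G" and "Q s i x" "Q t i x" for x i s t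
    using Qex[OF gx(1)[OF x i] i gx(2)[OF x i]] that by (cases s; cases t) auto
  \<comment> \<open>Segment \<open>j\<close> has the type of segment \<open>i\<close> and precedes it.\<close>
  define L where "L i j x \<longleftrightarrow> (\<exists>t. Q t i x \<and> Q t j x \<and> ?h x j (lo t) < ?h x i (lo t))" for i j x
  have openQlt: "openin ?X {x \<in> good. Q t i x \<and> Q t' j x \<and> ?h x k y < ?h x l y}"
    if "i \<in> G" "j \<in> G" "k \<in> G" "l \<in> G" for i j k l t t' y
  proof -
    have "openin ?X ({x \<in> topspace ?X. Q t i x} \<inter> {x \<in> topspace ?X. Q t' j x} \<inter> {x \<in> good. ?h x k y < ?h x l y})"
      by (intro openin_Int Qopen openlt that)
    then show ?thesis
      by (rule back_subst[where P = "openin ?X"]) (use openin_subset[OF opengood] in auto)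
  qed
  have openQQ: "openin ?X {x \<in> good. Q t i x \<and> Q t' j x}" if "i \<in> G" "j \<in> G" for i j t t'
  proof -
    have "openin ?X (good \<inter> {x \<in> topspace ?X. Q t i x} \<inter> {x \<in> topspace ?X. Q t' j x})"
      by (intro openin_Int Qopen opengood that)
    then show ?thesis
      by (rule back_subst[where P = "openin ?X"]) (use openin_subset[OF opengood] in auto)
  qed
  have openL: "openin ?X {x \<in> good. L i j x}" if "i \<in> G" "j \<in> G" for i j
  proof -
    have "openin ?X (\<Union>t. {x \<in> good. Q t i x \<and> Q t j x \<and> ?h x j (lo t) < ?h x i (lo t)})"
      by (rule openin_Union) (auto intro!: openQlt that)
    then show ?thesis by (rule back_subst[where P = "openin ?X"]) (auto simp: L_def)
  qed
  have openNL: "openin ?X {x \<in> good. \<not> L i j x}" if ij: "i \<in> G" "j \<in> G" for i j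
  proof (cases "i = j")
    case True
    then have "{x \<in> good. \<not> L i j x} = good" by (auto simp: L_def)
    then show ?thesis using opengood by simp
  next
    case False
    let ?W = "(\<Union>t. {x \<in> good. Q t i x \<and> Q t j x \<and> ?h x i (lo t) < ?h x j (lo t)}) \<union>
             (\<Union>t. {x \<in> good. Q t i x \<and> Q (\<not> t) j x})"
    have W: "openin ?X ?W"
      by (rule openin_Un; rule openin_Union) (auto intro!: openQlt openQQ that)
    \<comment> \<open>For distinct segments the negation is an open condition too, since their heights differ.\<close>
    have char: "(\<not> L i j x) \<longleftrightarrow> (\<exists>t. Q t i x \<and> Q t j x \<and> ?h x i (lo t) < ?h x j (lo t)) \<or> (\<exists>t. Q t i x \<and> Q (\<not> t) j x)"
      if x: "x \<in> good" for x
    proof -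
      obtain t where t: "Q t i x" using x ij by (auto simp: good_def)
      obtain t' where t': "Q t' j x" using x ij by (auto simp: good_def)
      have ui: "s = t" if "Q s i x" for s
        using uniq[OF x ij(1) that t] .
      have uj: "s = t'" if "Q s j x" for s
        using uniq[OF x ij(2) that t'] .
      show ?thesis
      proof (cases "t = t'")
        case True
        then have tj: "Q t j x" using t' by simp
        have ne: "?h x i (lo t) \<noteq> ?h x j (lo t)"
          by (rule heights_differ[OF gx(1)[OF x ij(1)] d r0 inG[OF ij(1)] inG[OF ij(2)] \<open>i \<noteq> j\<close>
              gx(3)[OF x ij(1)] gx(3)[OF x ij(2)] contains(1,4)[OF x ij(1) t] contains(1,4)[OF x ij(2) tj]])
        have "L i j x \<longleftrightarrow> ?h x j (lo t) < ?h x i (lo t)"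
          unfolding L_def using t tj ui by blast
        moreover have "(\<exists>s. Q s i x \<and> Q s j x \<and> ?h x i (lo s) < ?h x j (lo s)) \<longleftrightarrow> ?h x i (lo t) < ?h x j (lo t)"
          using t tj ui by blast
        moreover have "\<not> (\<exists>s. Q s i x \<and> Q (\<not> s) j x)" using ui uj True by blast
        moreover have "\<not> ?h x j (lo t) < ?h x i (lo t) \<longleftrightarrow> ?h x i (lo t) < ?h x j (lo t)"
          using ne by linarith
        ultimately show ?thesis by blast
      next
        case False
        then have "\<not> L i j x" unfolding L_def using ui uj by blast
        moreover have "t' = (\<not> t)" using False by blast
        then have "Q t i x \<and> Q (\<not> t) j x" using t t' by simp
        ultimately show ?thesis by blast
      qed
    qed
    have "?W = {x \<in> good. \<not> L i j x}"
    proof (rule Set.set_eqI)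
      fix x
      show "x \<in> ?W \<longleftrightarrow> x \<in> {x \<in> good. \<not> L i j x}"
      proof (cases "x \<in> good")
        case True
        show ?thesis unfolding mem_Collect_eq char[OF True] using True by blast
      qed blast
    qed
    then show ?thesis using W by simp
  qed
  have \<eta>: "0 < \<eta>" "\<eta> < pi / 2" using pi_gt3 by (auto simp: \<eta>_def)
  have cosn: "cos \<eta> > 1 - 1/10^6"
  proof -
    have "\<bar>sin (\<eta>/2)\<bar> \<le> 1/2000" using abs_sin_x_le_abs_x[of "\<eta>/2"] by (simp add: \<eta>_def)
    from power_mono[OF this abs_ge_zero, of 2] have "(sin (\<eta>/2))^2 \<le> (1/2000)^2"
      by (simp only: power2_abs)
    then show ?thesis using cos_double_sin[of "\<eta>/2"] by (simp add: power2_eq_square)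
  qed
  define P where "P i U A \<longleftrightarrow> openin ?X U \<and> continuous_map (subtopology ?X U) euclideanreal A \<and>
     (\<forall>x\<in>U. cis (A x) = snd x i) \<and>
     (\<forall>x\<in>topspace ?X. x \<notin> U \<longrightarrow> Re (dir d x i) \<ge> cos \<eta> \<and>
       (x \<in> good \<longrightarrow> dir d x i = cis (if even (card {j\<in>G. L i j x}) then \<eta> else - \<eta>)))" for i U A
  have lifts: "\<exists>U A. P i U A" if i: "i \<in> G" for i
  proof -
    have CM: "continuous_map ?X circle (\<lambda>x. dir d x i)"
      using continuous_map_dir[OF inG[OF i], of r d] Seg_length_rotated(1)[OF _ d inG[OF i]]
      by (auto simp: circle_def continuous_map_in_subtopology)
    obtain U A where UA: "openin ?X U" "continuous_map (subtopology ?X U) euclideanreal A"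
      "\<And>x. x \<in> U \<Longrightarrow> cis (A x) = dir d x i"
      "\<And>x. x \<in> topspace ?X \<Longrightarrow> x \<notin> U \<Longrightarrow> Re (dir d x i) \<ge> cos \<eta> \<and>
         (x \<in> good \<longrightarrow> dir d x i = cis (if even (card {j\<in>G. L i j x}) then \<eta> else - \<eta>))"
      by (rule parity_lift[where L = "L i", OF CM fG opengood openL[OF i] openNL[OF i] \<eta>]) (assumption | rule that)+
    \<comment> \<open>Rotate the lift back from the frame of \<open>d\<close>.\<close>
    have "cis (A x + Arg2pi d) = snd x i" if "x \<in> U" for x
    proof -
      have "cis (A x + Arg2pi d) = cis (A x) * cis (Arg2pi d)" by (simp add: cis_mult)
      also have "\<dots> = (d * cnj d) * snd x i" using UA(3)[OF that] cis_Arg2pi[OF d] by simp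
      also have "d * cnj d = 1" using d by (simp add: complex_norm_square[symmetric])
      finally show ?thesis by simp
    qed
    moreover have "continuous_map (subtopology ?X U) euclideanreal (\<lambda>x. A x + Arg2pi d)"
      by (intro continuous_map_add UA) auto
    ultimately show ?thesis unfolding P_def using UA(1,4) by (intro exI[of _ U] exI[of _ "\<lambda>x. A x + Arg2pi d"]) blast
  qed
  then obtain U A where "\<And>i. i \<in> G \<Longrightarrow> P i (U i) (A i)" by metis
  note UA = this[unfolded P_def]
  have final: "(\<forall>i\<in>G. Re (dir d x i) > 1 - 1/10^6) \<and> (\<exists>i\<in>G. \<forall>t. \<not> Q t i x)"
    if x: "x \<in> topspace ?X" and nU: "\<And>i. i \<in> G \<Longrightarrow> x \<notin> U i" for x
  proof
    show *: "\<forall>i\<in>G. Re (dir d x i) > 1 - 1/10^6"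
    proof
      fix i assume i: "i \<in> G"
      have "Re (dir d x i) \<ge> cos \<eta>" using UA[OF i] nU[OF i] x by blast
      then show "Re (dir d x i) > 1 - 1/10^6" using cosn by linarith
    qed
    show "\<exists>i\<in>G. \<forall>t. \<not> Q t i x"
    proof (rule ccontr)
      assume "\<not> ?thesis"
      then have g: "x \<in> good" using x * by (auto simp: good_def box_def)
      have dirx: "dir d x i = cis (if even (card {j\<in>G. L i j x}) then \<eta> else - \<eta>)" if "i \<in> G" for i
        using UA[OF that] nU[OF that] x g by blast
      define S where "S t = {i\<in>G. Q t i x}" for t
      have "G = S True \<union> S False" using g by (auto simp: S_def good_def ex_bool_eq)
      then have "card G \<le> card (S True) + card (S False)" by (metis card_Un_le)
      then obtain t where t: "real (card (S t)) \<ge> real (card G) / 2"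
        by (cases "card (S True) \<ge> card (S False)") (auto intro: that[of True] that[of False])
      have SG: "S t \<subseteq> G" by (auto simp: S_def)
      have rank: "{j\<in>G. L i j x} = {j\<in>S t. ?h x j (lo t) < ?h x i (lo t)}" if "i \<in> S t" for i
      proof -
        have "s = t" if "Q s i x" for s
          using uniq[OF g _ that] \<open>i \<in> S t\<close> by (simp add: S_def)
        then show ?thesis using \<open>i \<in> S t\<close> by (auto simp: L_def S_def)
      qed
      have slope: "?h x i (hi t) = ?h x i (lo t) + Im (dir d x i) / Re (dir d x i) * (hi t - lo t)" for i
        by (rule height_affine)
      have "tan \<eta> * (hi t - lo t) * (real (card (S t)) - 1) \<le> 2"
      proof (rule alternating_rank_bound[where p = "\<lambda>i. ?h x i (lo t)" and q = "\<lambda>i. ?h x i (hi t)"])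
        show "finite (S t)" using SG fG finite_subset by blast
        have "card G > 0" using fG \<open>G \<noteq> {}\<close> by (simp add: card_gt_0_iff)
        then show "S t \<noteq> {}" using t by auto
        have St: "i \<in> G" "Q t i x" if "i \<in> S t" for i using that by (auto simp: S_def)
        show "inj_on (\<lambda>i. ?h x i (lo t)) (S t)"
        proof (rule inj_onI, rule ccontr)
          fix i j assume "i \<in> S t" "j \<in> S t" "?h x i (lo t) = ?h x j (lo t)" "i \<noteq> j"
          note i = St[OF \<open>i \<in> S t\<close>] and j = St[OF \<open>j \<in> S t\<close>]
          show False
            using heights_differ[OF x d r0 inG[OF i(1)] inG[OF j(1)] \<open>i \<noteq> j\<close> gx(3)[OF g i(1)] gx(3)[OF g j(1)]
                contains(1,4)[OF g i] contains(1,4)[OF g j]] \<open>?h x i (lo t) = ?h x j (lo t)\<close> by blast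
        qed
        show "?h x i (hi t) < ?h x j (hi t)" if "i \<in> S t" "j \<in> S t" "?h x i (lo t) < ?h x j (lo t)" for i j
        proof -
          note i = St[OF that(1)] and j = St[OF that(2)]
          have "i \<noteq> j" using that by auto
          moreover have "lo t \<le> hi t" using lohi[of t] by linarith
          ultimately show ?thesis
            by (rule heights_order[OF x d r0 inG[OF i(1)] inG[OF j(1)] _ gx(3)[OF g i(1)] gx(3)[OF g j(1)]
                _ contains(1,2)[OF g i] contains(1,2)[OF g j] that(3)])
        qed
        show "?h x i (hi t) = ?h x i (lo t) + tan \<eta> * (hi t - lo t)"
          if "i \<in> S t" "even (card {j\<in>S t. ?h x j (lo t) < ?h x i (lo t)})" for i
          using dirx[OF St(1)[OF that(1)]] rank[OF that(1)] that(2) slope[of i] by (simp add: tan_def)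
        show "?h x i (hi t) = ?h x i (lo t) - tan \<eta> * (hi t - lo t)"
          if "i \<in> S t" "odd (card {j\<in>S t. ?h x j (lo t) < ?h x i (lo t)})" for i
          using dirx[OF St(1)[OF that(1)]] rank[OF that(1)] that(2) slope[of i] by (simp add: tan_def)
        have h1: "\<bar>?h x i (lo t)\<bar> \<le> 1" if "i \<in> S t" for i
        proof -
          note i = St[OF that]
          have "(lo t)^2 + (?h x i (lo t))^2 \<le> 1"
            by (rule aligned_in_disk(1)[OF Seg_length_rotated(1)[OF x d inG[OF i(1)]] gx(2)[OF g i(1)] r
                Seg_length_rotated(2)[OF x d inG[OF i(1)]] contains(1,4)[OF g i]])
          then have "(?h x i (lo t))^2 \<le> 1" by (smt (verit) zero_le_power2)
          then show ?thesis by (simp add: abs_square_le_1)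
        qed
        show "-1 \<le> ?h x i (lo t)" "?h x i (lo t) \<le> 1" if "i \<in> S t" for i
          using h1[OF that] by linarith+
        show "0 \<le> tan \<eta> * (hi t - lo t)" using lohi[of t] tan_gt_zero[OF \<eta>] by simp
      qed
      moreover have "tan \<eta> / 2000 * (real (card G) / 2 - 1) \<le> tan \<eta> * (hi t - lo t) * (real (card (S t)) - 1)"
      proof (rule mult_mono)
        show "tan \<eta> / 2000 \<le> tan \<eta> * (hi t - lo t)"
          using mult_left_mono[OF lohi[of t], of "tan \<eta>"] tan_gt_zero[OF \<eta>] by simp
        show "0 \<le> real (card G) / 2 - 1"
          using big tan_gt_zero[OF \<eta>] by (smt (verit) divide_pos_pos mult_pos_neg zero_less_numeral)
        show "0 \<le> tan \<eta> * (hi t - lo t)" using lohi[of t] tan_gt_zero[OF \<eta>] by simp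
      qed (use t in auto)
      ultimately show False using big by linarith
    qed
  qed
  show ?thesis
  proof (rule that[of U A])
    fix i assume i: "i \<in> G"
    show "openin ?X (U i)" using UA[OF i] by blast
    show "continuous_map (subtopology ?X (U i)) euclideanreal (A i)" using UA[OF i] by blast
    show "cis (A i x) = snd x i" if "x \<in> U i" for x using UA[OF i] that by blast
  next
    fix x assume "x \<in> topspace ?X" "\<And>i. i \<in> G \<Longrightarrow> x \<notin> U i"
    then show "(\<forall>i\<in>G. Re (dir d x i) > 1 - 1/10^6) \<and> (\<exists>i\<in>G. \<forall>t. \<not> Q t i x)" by (rule final)
  qed
qed

section \<open>Six groups of segments\<close>

definition lifts_on :: "nat \<Rightarrow> real \<Rightarrow> nat set \<Rightarrow> (nat \<Rightarrow> configuration set)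
    \<Rightarrow> (nat \<Rightarrow> configuration \<Rightarrow> real) \<Rightarrow> bool"
  where "lifts_on n r G U A \<longleftrightarrow> (\<forall>i\<in>G. openin (Seg_length n r) (U i) \<and>
     continuous_map (subtopology (Seg_length n r) (U i)) euclideanreal (A i) \<and>
     (\<forall>x\<in>U i. cis (A i x) = snd x i))"

text \<open>One type suffices, namely the segments that start before \<open>-1/1000\<close>. Being long, they all cross the strip
over \<open>[-1/1000, -1/2000]\<close>. A segment without this type is almost radial.\<close>

lemma radial_group:
  assumes r: "r \<ge> 1 - 1/10^6" and d: "norm d = 1" and G: "G \<subseteq> {..<n}"
    and big: "tan (1/1000) / 2000 * (real (card G) / 2 - 1) > 2"
  shows "\<exists>U A. lifts_on n r G U A \<and> (\<forall>x\<in>topspace (Seg_length n r). (\<forall>i\<in>G. x \<notin> U i) \<longrightarrow>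
     (\<exists>i\<in>G. Re (dir d x i) > 1 - 1/10^6 \<and> seg_tail r d x i \<ge> -1/1000))"
proof -
  let ?X = "Seg_length n r"
  define Q where "Q t i x \<longleftrightarrow> \<not> t \<and> seg_tail r d x i < -1/1000" for t i x
  have inG: "i < n" if "i \<in> G" for i using that G by auto
  obtain U A where UA: "\<And>i. i \<in> G \<Longrightarrow> openin ?X (U i)"
    "\<And>i. i \<in> G \<Longrightarrow> continuous_map (subtopology ?X (U i)) euclideanreal (A i)"
    "\<And>i x. i \<in> G \<Longrightarrow> x \<in> U i \<Longrightarrow> cis (A i x) = snd x i"
    and fin: "\<And>x. x \<in> topspace ?X \<Longrightarrow> (\<And>i. i \<in> G \<Longrightarrow> x \<notin> U i) \<Longrightarrow>
       (\<forall>i\<in>G. Re (dir d x i) > 1 - 1/10^6) \<and> (\<exists>i\<in>G. \<forall>t. \<not> Q t i x)"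
  proof (rule group_cover[OF r d G big, of Q "\<lambda>_. -1/1000" "\<lambda>_. -1/2000"])
    fix t i assume i: "i \<in> G"
    have "openin ?X {x \<in> topspace ?X. seg_tail r d x i < -1/1000}"
      by (intro openin_less_than continuous_map_tail inG i) auto
    then show "openin ?X {x \<in> topspace ?X. Q t i x}" by (cases t) (auto simp: Q_def)
  next
    fix t i x assume x: "x \<in> topspace ?X" and i: "i \<in> G" and u: "Re (dir d x i) > 1 - 1/10^6" and "Q t i x"
    then show "seg_tail r d x i \<le> -1/1000 \<and> -1/2000 \<le> seg_head r d x i"
      using aligned_in_disk(4)[OF Seg_length_rotated(1)[OF x d inG[OF i]] u r Seg_length_rotated(2)[OF x d inG[OF i]]]
      by (simp add: Q_def)
  qed (auto simp: Q_def)
  have "\<exists>i\<in>G. Re (dir d x i) > 1 - 1/10^6 \<and> seg_tail r d x i \<ge> -1/1000"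
    if x: "x \<in> topspace ?X" and xU: "\<forall>i\<in>G. x \<notin> U i" for x
  proof -
    obtain i where "i \<in> G" "\<forall>t. \<not> Q t i x" "Re (dir d x i) > 1 - 1/10^6" using fin[OF x] xU by blast
    then show ?thesis by (intro bexI[of _ i]) (auto simp: Q_def not_less)
  qed
  then show ?thesis using UA unfolding lifts_on_def by blast
qed

text \<open>The types are the segments that do not reach \<open>1/10\<close> beyond the center on one side or on the other. Those of
the first type cover \<open>[1/4, 1/2]\<close>, those of the second \<open>[-1/2, -1/4]\<close>.\<close>

lemma central_group:
  assumes r: "r \<ge> 1 - 1/10^6" and d: "norm d = 1" and G: "G \<subseteq> {..<n}"
    and big: "tan (1/1000) / 2000 * (real (card G) / 2 - 1) > 2"
  shows "\<exists>U A. lifts_on n r G U A \<and> (\<forall>x\<in>topspace (Seg_length n r). (\<forall>i\<in>G. x \<notin> U i) \<longrightarrow>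
     (\<exists>i\<in>G. Re (dir d x i) > 1 - 1/10^6 \<and> seg_tail r d x i \<le> -1/10 \<and>
        seg_head r d x i \<ge> 1/10))"
proof -
  let ?X = "Seg_length n r"
  define Q where "Q t i x \<longleftrightarrow> (if t then seg_tail r d x i > -1/10
      else seg_head r d x i < 1/10)" for t i x
  have inG: "i < n" if "i \<in> G" for i using that G by auto
  obtain U A where UA: "\<And>i. i \<in> G \<Longrightarrow> openin ?X (U i)"
    "\<And>i. i \<in> G \<Longrightarrow> continuous_map (subtopology ?X (U i)) euclideanreal (A i)"
    "\<And>i x. i \<in> G \<Longrightarrow> x \<in> U i \<Longrightarrow> cis (A i x) = snd x i"
    and fin: "\<And>x. x \<in> topspace ?X \<Longrightarrow> (\<And>i. i \<in> G \<Longrightarrow> x \<notin> U i) \<Longrightarrow>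
       (\<forall>i\<in>G. Re (dir d x i) > 1 - 1/10^6) \<and> (\<exists>i\<in>G. \<forall>t. \<not> Q t i x)"
  proof (rule group_cover[OF r d G big, of Q "\<lambda>t. if t then 1/4 else -1/2" "\<lambda>t. if t then 1/2 else -1/4"])
    fix t i assume i: "i \<in> G"
    have "openin ?X {x \<in> topspace ?X. -1/10 < seg_tail r d x i}"
      by (intro openin_less_than continuous_map_tail inG i) auto
    moreover have "openin ?X {x \<in> topspace ?X. seg_head r d x i < 1/10}"
      by (intro openin_less_than continuous_map_head inG i) auto
    ultimately show "openin ?X {x \<in> topspace ?X. Q t i x}" by (cases t) (auto simp: Q_def)
  next
    fix t i x assume x: "x \<in> topspace ?X" and i: "i \<in> G" and u: "Re (dir d x i) > 1 - 1/10^6"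
    note D = aligned_in_disk[OF Seg_length_rotated(1)[OF x d inG[OF i]] u r Seg_length_rotated(2)[OF x d inG[OF i]]]
      and l = nearly_aligned_length[OF u r, of "cen d x i"]
    show "seg_tail r d x i \<le> (if t then 1/4 else -1/2) \<and>
        (if t then 1/2 else -1/4) \<le> seg_head r d x i" if "Q t i x"
      using D(2-5) l that by (cases t) (simp_all add: Q_def)
    show False if "Q True i x" "Q False i x" using that l by (simp add: Q_def)
  qed auto
  have "\<exists>i\<in>G. Re (dir d x i) > 1 - 1/10^6 \<and> seg_tail r d x i \<le> -1/10 \<and>
        seg_head r d x i \<ge> 1/10"
    if x: "x \<in> topspace ?X" and xU: "\<forall>i\<in>G. x \<notin> U i" for x
  proof -
    obtain i where i: "i \<in> G" "\<And>t. \<not> Q t i x" "Re (dir d x i) > 1 - 1/10^6" using fin[OF x] xU by blast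
    have "seg_tail r d x i \<le> -1/10" using i(2)[of True] unfolding Q_def by simp
    moreover have "seg_head r d x i \<ge> 1/10" using i(2)[of False] unfolding Q_def by simp
    ultimately show ?thesis using i(1,3) by blast
  qed
  then show ?thesis using UA unfolding lifts_on_def by blast
qed

text \<open>Segments \<open>e\<close>, \<open>m\<close>, \<open>w\<close>, \<open>s\<close> are almost radii to the east, north, west and south; \<open>h\<close> and \<open>v\<close> point east and
north and reach \<open>1/10\<close> to both sides of the center. In each frame a point of a segment is
\<open>d * Complex y (ht d i + sl d i * y)\<close>, and the equations of the lines come from multiplying this out.\<close>

lemma compass_contradiction:
  assumes x: "x \<in> topspace (Seg_length n r)" and r: "r \<ge> 1 - 1/10^6"
    and lt: "e < n" "m < n" "w < n" "s < n" "h < n" "v < n"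
    and ne: "v \<noteq> e" "v \<noteq> w" "h \<noteq> m" "h \<noteq> s" "v \<noteq> h"
    and e: "Re (dir 1 x e) > 1 - 1/10^6" "seg_tail r 1 x e \<ge> -1/1000"
    and m: "Re (dir \<i> x m) > 1 - 1/10^6" "seg_tail r \<i> x m \<ge> -1/1000"
    and w: "Re (dir (-1) x w) > 1 - 1/10^6" "seg_tail r (-1) x w \<ge> -1/1000"
    and s: "Re (dir (-\<i>) x s) > 1 - 1/10^6" "seg_tail r (-\<i>) x s \<ge> -1/1000"
    and h: "Re (dir 1 x h) > 1 - 1/10^6" "seg_tail r 1 x h \<le> -1/10"
        "seg_head r 1 x h \<ge> 1/10"
    and v: "Re (dir \<i> x v) > 1 - 1/10^6" "seg_tail r \<i> x v \<le> -1/10"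
        "seg_head r \<i> x v \<ge> 1/10"
  shows False
proof -
  have r0: "r > 0" using r by simp
  define sl where "sl d i = Im (dir d x i) / Re (dir d x i)" for d i
  define ht where "ht d i = seg_height d x i 0" for d i
  have hy: "seg_height d x i y = ht d i + sl d i * y" for d i y
    using height_affine[of "cen d x i" "dir d x i" y 0] by (simp add: ht_def sl_def)
  have sl: "\<bar>sl d i\<bar> \<le> 1/400" if "norm d = 1" "i < n" "Re (dir d x i) > 1 - 1/10^6" for d i
    unfolding sl_def by (rule nearly_aligned_slope[OF Seg_length_rotated(1)[OF x that(1,2)] that(3)])
  have pt: "Complex y (ht d i + sl d i * y) \<in> seg r d x i"
    if "Re (dir d x i) > 1 - 1/10^6" "seg_tail r d x i \<le> y" "y \<le> seg_head r d x i" for d i y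
    using segment_graph[OF r0 _ that(2,3)] that(1) hy[of d i y] by simp
  have rad: "Complex y (ht d i + sl d i * y) \<in> seg r d x i \<and> \<bar>ht d i + sl d i * y\<bar> \<le> 1/20"
    if "norm d = 1" "i < n" and u: "Re (dir d x i) > 1 - 1/10^6" "seg_tail r d x i \<ge> -1/1000"
      and y: "1/1000 \<le> y" "y \<le> 99/100" for d i y
  proof -
    note R = radial_segment[OF Seg_length_rotated(1)[OF x that(1,2)] u(1) r Seg_length_rotated(2)[OF x that(1,2)] u(2) y]
    show ?thesis using pt[OF u(1) R(1,2)] R(3) hy[of d i y] by simp
  qed
  have disk: "y^2 + (ht d i + sl d i * y)^2 \<le> 1"
    if "norm d = 1" "i < n" "Re (dir d x i) > 1 - 1/10^6" "seg_tail r d x i \<le> y" "y \<le> seg_head r d x i" for d i y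
    using aligned_in_disk(1)[OF Seg_length_rotated(1)[OF x that(1,2)] that(3) r Seg_length_rotated(2)[OF x that(1,2)] that(4,5)] hy[of d i y]
    by simp
  have len: "seg_head r d x i - seg_tail r d x i \<ge> 99/100"
    if "Re (dir d x i) > 1 - 1/10^6" for d i
    using nearly_aligned_length[OF that r, of "cen d x i"] by (rule order_trans[rotated]) simp
  have n1: "norm (1::complex) = 1" "norm \<i> = 1" "norm (-1::complex) = 1" "norm (-\<i>) = 1" by auto
  have E: "Complex a (ht 1 e + sl 1 e * a) \<in> seg r 1 x e" "\<bar>ht 1 e + sl 1 e * a\<bar> \<le> 1/20"
    if "1/1000 \<le> a" "a \<le> 99/100" for a using rad[OF n1(1) lt(1) e that] by auto
  have M: "Complex a (ht \<i> m + sl \<i> m * a) \<in> seg r \<i> x m" "\<bar>ht \<i> m + sl \<i> m * a\<bar> \<le> 1/20"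
    if "1/1000 \<le> a" "a \<le> 99/100" for a using rad[OF n1(2) lt(2) m that] by auto
  have W: "Complex a (ht (-1) w + sl (-1) w * a) \<in> seg r (-1) x w" "\<bar>ht (-1) w + sl (-1) w * a\<bar> \<le> 1/20"
    if "1/1000 \<le> a" "a \<le> 99/100" for a using rad[OF n1(3) lt(3) w that] by auto
  have S: "Complex a (ht (-\<i>) s + sl (-\<i>) s * a) \<in> seg r (-\<i>) x s" "\<bar>ht (-\<i>) s + sl (-\<i>) s * a\<bar> \<le> 1/20"
    if "1/1000 \<le> a" "a \<le> 99/100" for a using rad[OF n1(4) lt(4) s that] by auto
  have vc: "\<bar>- ht \<i> v\<bar> \<le> 1/500"
  proof (rule crossing_near_center[where \<sigma> = "- sl \<i> v" and \<beta> = "ht 1 e" and \<tau> = "sl 1 e"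
        and \<beta>' = "- ht (-1) w" and \<tau>' = "sl (-1) w"
        and ?v0.0 = "seg_tail r \<i> x v" and ?v1.0 = "seg_head r \<i> x v"])
    show "\<bar>- sl \<i> v\<bar> \<le> 1/400" "\<bar>sl 1 e\<bar> \<le> 1/400" "\<bar>sl (-1) w\<bar> \<le> 1/400"
      using sl[OF n1(2) lt(6) v(1)] sl[OF n1(1) lt(1) e(1)] sl[OF n1(3) lt(3) w(1)] by auto
    show "(- ht \<i> v + - sl \<i> v * y)^2 + y^2 \<le> 1"
      if "seg_tail r \<i> x v \<le> y" "y \<le> seg_head r \<i> x v" for y
    proof -
      have "(- ht \<i> v + - sl \<i> v * y)^2 = (ht \<i> v + sl \<i> v * y)^2" by (simp add: power2_eq_square algebra_simps)
      then show ?thesis using disk[OF n1(2) lt(6) v(1) that] by linarith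
    qed
    show "\<bar>- ht (-1) w + sl (-1) w * a\<bar> \<le> 1/20" if "-99/100 \<le> a" "a \<le> -1/1000" for a
    proof -
      have "- ht (-1) w + sl (-1) w * a = - (ht (-1) w + sl (-1) w * (-a))" by simp
      moreover have "1/1000 \<le> -a" "-a \<le> 99/100" using that by auto
      ultimately show ?thesis using W(2)[of "-a"] by (simp only: abs_minus_cancel)
    qed
    show False if y: "seg_tail r \<i> x v \<le> y" "y \<le> seg_head r \<i> x v"
      and a: "a = - ht \<i> v + - sl \<i> v * y" "1/1000 \<le> a" "a \<le> 99/100" "y = ht 1 e + sl 1 e * a" for a y
    proof -
      have "\<i> * Complex y (ht \<i> v + sl \<i> v * y) = 1 * Complex a (ht 1 e + sl 1 e * a)"
        using a by (simp add: complex_eq_iff)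
      then show False
        using Seg_length_disjoint[OF x n1(2,1) lt(6,1) ne(1) pt[OF v(1) y] E(1)[OF a(2,3)]] by blast
    qed
    show False if y: "seg_tail r \<i> x v \<le> y" "y \<le> seg_head r \<i> x v"
      and a: "a = - ht \<i> v + - sl \<i> v * y" "-99/100 \<le> a" "a \<le> -1/1000" "y = - ht (-1) w + sl (-1) w * a" for a y
    proof -
      have "\<i> * Complex y (ht \<i> v + sl \<i> v * y) = -1 * Complex (-a) (ht (-1) w + sl (-1) w * (-a))"
        using a by (simp add: complex_eq_iff)
      moreover have "1/1000 \<le> -a" "-a \<le> 99/100" using a by auto
      ultimately show False
        using Seg_length_disjoint[OF x n1(2,3) lt(6,3) ne(2) pt[OF v(1) y] W(1)[of "-a"]] by blast
    qed
  qed (use v E len[OF v(1)] in auto)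
  have hc: "\<bar>ht 1 h\<bar> \<le> 1/500"
  proof (rule crossing_near_center[where \<sigma> = "sl 1 h" and \<beta> = "- ht \<i> m" and \<tau> = "- sl \<i> m"
        and \<beta>' = "ht (-\<i>) s" and \<tau>' = "- sl (-\<i>) s"
        and ?v0.0 = "seg_tail r 1 x h" and ?v1.0 = "seg_head r 1 x h"])
    show "\<bar>sl 1 h\<bar> \<le> 1/400" "\<bar>- sl \<i> m\<bar> \<le> 1/400" "\<bar>- sl (-\<i>) s\<bar> \<le> 1/400"
      using sl[OF n1(1) lt(5) h(1)] sl[OF n1(2) lt(2) m(1)] sl[OF n1(4) lt(4) s(1)] by auto
    show "(ht 1 h + sl 1 h * y)^2 + y^2 \<le> 1"
      if "seg_tail r 1 x h \<le> y" "y \<le> seg_head r 1 x h" for y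
      using disk[OF n1(1) lt(5) h(1) that] by linarith
    show "\<bar>- ht \<i> m + - sl \<i> m * a\<bar> \<le> 1/20" if "1/1000 \<le> a" "a \<le> 99/100" for a
    proof -
      have "- ht \<i> m + - sl \<i> m * a = - (ht \<i> m + sl \<i> m * a)" by simp
      then show ?thesis using M(2)[OF that] by (simp only: abs_minus_cancel)
    qed
    show "\<bar>ht (-\<i>) s + - sl (-\<i>) s * a\<bar> \<le> 1/20" if "-99/100 \<le> a" "a \<le> -1/1000" for a
    proof -
      have "ht (-\<i>) s + - sl (-\<i>) s * a = ht (-\<i>) s + sl (-\<i>) s * (-a)" by simp
      moreover have "1/1000 \<le> -a" "-a \<le> 99/100" using that by auto
      ultimately show ?thesis using S(2)[of "-a"] by (simp only:)
    qed
    show False if y: "seg_tail r 1 x h \<le> y" "y \<le> seg_head r 1 x h"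
      and a: "a = ht 1 h + sl 1 h * y" "1/1000 \<le> a" "a \<le> 99/100" "y = - ht \<i> m + - sl \<i> m * a" for a y
    proof -
      have "1 * Complex y (ht 1 h + sl 1 h * y) = \<i> * Complex a (ht \<i> m + sl \<i> m * a)"
        using a by (simp add: complex_eq_iff)
      then show False
        using Seg_length_disjoint[OF x n1(1,2) lt(5,2) ne(3) pt[OF h(1) y] M(1)[OF a(2,3)]] by blast
    qed
    show False if y: "seg_tail r 1 x h \<le> y" "y \<le> seg_head r 1 x h"
      and a: "a = ht 1 h + sl 1 h * y" "-99/100 \<le> a" "a \<le> -1/1000" "y = ht (-\<i>) s + - sl (-\<i>) s * a" for a y
    proof -
      have "1 * Complex y (ht 1 h + sl 1 h * y) = -\<i> * Complex (-a) (ht (-\<i>) s + sl (-\<i>) s * (-a))"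
        using a by (simp add: complex_eq_iff)
      moreover have "1/1000 \<le> -a" "-a \<le> 99/100" using a by auto
      ultimately show False
        using Seg_length_disjoint[OF x n1(1,4) lt(5,4) ne(4) pt[OF h(1) y] S(1)[of "-a"]] by blast
    qed
  qed (use h len[OF h(1)] in auto)
  obtain a y where ay: "a = - ht \<i> v + - sl \<i> v * y" "y = ht 1 h + sl 1 h * a" "\<bar>a\<bar> \<le> 1/10" "\<bar>y\<bar> \<le> 1/10"
    using central_segments_cross[of "- sl \<i> v" "sl 1 h" "- ht \<i> v" "ht 1 h"]
      sl[OF n1(2) lt(6) v(1)] sl[OF n1(1) lt(5) h(1)] vc hc by auto
  have "\<i> * Complex y (ht \<i> v + sl \<i> v * y) = 1 * Complex a (ht 1 h + sl 1 h * a)"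
    using ay(1,2) by (simp add: complex_eq_iff)
  moreover have "Complex y (ht \<i> v + sl \<i> v * y) \<in> seg r \<i> x v"
    by (rule pt[OF v(1)]) (use ay v in linarith)+
  moreover have "Complex a (ht 1 h + sl 1 h * a) \<in> seg r 1 x h"
    by (rule pt[OF h(1)]) (use ay h in linarith)+
  ultimately show False using Seg_length_disjoint[OF x n1(2,1) lt(6,5) ne(5)] by blast
qed

text \<open>Group \<open>g\<close> consists of the labels \<open>i\<close> with \<open>i div K = g\<close>. Groups 0 to 3 supply the radii of the compass,
groups 4 and 5 the horizontal and the vertical segment.\<close>

lemma angle_product_vanishes:
  obtains n where "\<And>r \<phi>. r \<ge> 1 - 1/10^6 \<Longrightarrow> \<phi> \<in> singular_cocycle_set 1 circle \<Longrightarrow>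
      angle_product \<phi> n r \<in> singular_coboundary_set n (Seg_length n r)"
proof -
  have t0: "tan (1/1000) > (0::real)" using pi_gt3 by (intro tan_gt_zero) auto
  obtain K0 :: nat where K0: "2 / (tan (1/1000) / 2000) < real K0" using reals_Archimedean2 by blast
  \<comment> \<open>Two types of segments share a group, so \<open>K0 + 1\<close> of them have the same type.\<close>
  define K where "K = 2 * (K0 + 1)"
  have "2 < tan (1/1000) / 2000 * real K0" using K0 t0 by (simp add: field_simps)
  moreover have "real K / 2 - 1 = real K0" by (simp add: K_def field_simps)
  ultimately have big: "tan (1/1000) / 2000 * (real K / 2 - 1) > 2" by simp
  have "K > 0" by (simp add: K_def)
  let ?n = "6 * K"
  define G where "G g = {g * K..<g * K + K}" for g
  define fr where "fr g = [1, \<i>, -1, -\<i>, 1, \<i>] ! g" for g :: nat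
  have fr: "fr 0 = 1" "fr 1 = \<i>" "fr 2 = -1" "fr 3 = -\<i>" "fr 4 = 1" "fr 5 = \<i>"
    by (simp_all add: fr_def)
  have nfr: "norm (fr g) = 1" if "g < 6" for g
  proof -
    have "g = 0 \<or> g = 1 \<or> g = 2 \<or> g = 3 \<or> g = 4 \<or> g = 5" using that by auto
    then show ?thesis using fr by auto
  qed
  have Gn: "G g \<subseteq> {..<?n}" if "g < 6" for g
  proof
    fix i assume "i \<in> G g"
    then have "i < (g + 1) * K" by (simp add: G_def)
    also have "\<dots> \<le> 6 * K" using that by (intro mult_right_mono) auto
    finally show "i \<in> {..<?n}" by simp
  qed
  have Gd: "i = g" if "k \<in> G i" "k \<in> G g" for i g k
  proof -
    have "k div K = i" using that(1) \<open>K > 0\<close> by (intro div_nat_eqI) (auto simp: G_def algebra_simps)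
    moreover have "k div K = g" using that(2) \<open>K > 0\<close> by (intro div_nat_eqI) (auto simp: G_def algebra_simps)
    ultimately show ?thesis by simp
  qed
  have cG: "card (G g) = K" for g by (simp add: G_def)
  have "angle_product \<phi> ?n r \<in> singular_coboundary_set ?n (Seg_length ?n r)"
    if r: "r \<ge> 1 - 1/10^6" and \<phi>: "\<phi> \<in> singular_cocycle_set 1 circle" for r \<phi>
  proof -
    let ?X = "Seg_length ?n r"
    define bad where "bad g x i \<longleftrightarrow> Re (dir (fr g) x i) > 1 - 1/10^6 \<and>
       (if g < 4 then seg_tail r (fr g) x i \<ge> -1/1000
        else seg_tail r (fr g) x i \<le> -1/10 \<and> seg_head r (fr g) x i \<ge> 1/10)" for g x i
    have "\<exists>U A. lifts_on ?n r (G g) U A \<and> (\<forall>x\<in>topspace ?X. (\<forall>i\<in>G g. x \<notin> U i) \<longrightarrow> (\<exists>i\<in>G g. bad g x i))"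
      if "g < 6" for g
      using radial_group[OF r nfr[OF that] Gn[OF that]] central_group[OF r nfr[OF that] Gn[OF that]] big
      unfolding bad_def cG by (cases "g < 4") simp_all
    then obtain U A where UA: "\<And>g. g < 6 \<Longrightarrow> lifts_on ?n r (G g) (U g) (A g)"
      and UAb: "\<And>g x. g < 6 \<Longrightarrow> x \<in> topspace ?X \<Longrightarrow> (\<forall>i\<in>G g. x \<notin> U g i) \<Longrightarrow> (\<exists>i\<in>G g. bad g x i)"
      by metis
    have iG: "i div K < 6" "i \<in> G (i div K)" if "i < ?n" for i
    proof -
      show "i div K < 6" using that by (simp add: less_mult_imp_div_less)
      have "i = i div K * K + i mod K" by simp
      moreover have "i mod K < K" using \<open>K > 0\<close> by simp
      ultimately show "i \<in> G (i div K)" unfolding G_def atLeastLessThan_iff by linarith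
    qed
    have cover: "topspace ?X \<subseteq> (\<Union>i<?n. U (i div K) i)"
    proof (rule subsetI, rule ccontr)
      fix x assume x: "x \<in> topspace ?X" and n: "x \<notin> (\<Union>i<?n. U (i div K) i)"
      have "\<exists>i. i < ?n \<and> i \<in> G g \<and> bad g x i" if g: "g < 6" for g
      proof -
        have "x \<notin> U g i" if "i \<in> G g" for i
        proof -
          have "i < ?n" using Gn[OF g] that by auto
          moreover have "i div K = g" using Gd[OF iG(2)[OF \<open>i < ?n\<close>] that] .
          ultimately show ?thesis using n by auto
        qed
        then obtain i where "i \<in> G g" "bad g x i" using UAb[OF g x] by blast
        then show ?thesis using Gn[OF g] by auto
      qed
      then obtain p where p: "\<And>g. g < 6 \<Longrightarrow> p g < ?n" "\<And>g. g < 6 \<Longrightarrow> p g \<in> G g" "\<And>g. g < 6 \<Longrightarrow> bad g x (p g)"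
        by metis
      have pd: "p g \<noteq> p g'" if "g < 6" "g' < 6" "g \<noteq> g'" for g g'
        using Gd p(2)[OF that(1)] p(2)[OF that(2)] that(3) by metis
      show False
        by (rule compass_contradiction[OF x r, of "p 0" "p 1" "p 2" "p 3" "p 4" "p 5"])
           (use p(1) pd p(3)[of 0] p(3)[of 1] p(3)[of 2] p(3)[of 3] p(3)[of 4] p(3)[of 5] in
             \<open>simp_all only: bad_def fr, simp_all\<close>)
    qed
    show ?thesis unfolding angle_product_def
    proof (rule edge_product_coboundary_of_open_cover[OF \<phi>, where U = "\<lambda>i. U (i div K) i" and A = "\<lambda>i. A (i div K) i"])
      show "?n > 0" using \<open>K > 0\<close> by simp
      show "topspace ?X \<subseteq> (\<Union>i<?n. U (i div K) i)" by (rule cover)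
      fix i assume "i < ?n"
      from iG[OF this] UA[of "i div K"]
      show "openin ?X (U (i div K) i)" "continuous_map (subtopology ?X (U (i div K) i)) euclideanreal (A (i div K) i)"
        "\<And>x. x \<in> U (i div K) i \<Longrightarrow> cis (A (i div K) i x) = snd x i"
        by (auto simp: lifts_on_def)
    qed (rule continuous_map_angle)
  qed
  then show ?thesis using that by blast
qed

section \<open>The winding cocycle\<close>

text \<open>A standard simplex of dimension 1 or 2 is parametrized by a convex set \<open>T\<close> in the plane, and there a
nonvanishing function has a continuous logarithm.\<close>

lemma lift_simplex:
  assumes \<sigma>: "singular_simplex p circle \<sigma>" and p: "p = 1 \<or> p = 2"
  obtains \<tau> where "singular_simplex p euclideanreal \<tau>" "simplex_map p cis \<tau> = \<sigma>"
proof -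
  define e :: "real \<times> real \<Rightarrow> nat \<Rightarrow> real"
    where "e y = (\<lambda>j. if j = 0 then 1 - fst y - snd y else if j = 1 then fst y else if j = 2 then snd y else 0)" for y
  define T where "T = {y. e y \<in> standard_simplex p}"
  have T: "y \<in> T \<longleftrightarrow> 0 \<le> fst y \<and> 0 \<le> snd y \<and> fst y + snd y \<le> 1 \<and> (p = 1 \<longrightarrow> snd y = 0)" for y
    using p by (auto simp: T_def standard_simplex_def e_def numeral_2_eq_2)
  have "convex T"
    unfolding convex_def
  proof (intro ballI allI impI)
    fix x y and u v :: real
    assume xy: "x \<in> T" "y \<in> T" and uv: "0 \<le> u" "0 \<le> v" "u + v = 1"
    have "u * (fst x + snd x) + v * (fst y + snd y) \<le> u * 1 + v * 1"
      using xy uv by (intro add_mono mult_left_mono) (auto simp: T)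
    then have "fst (u *\<^sub>R x + v *\<^sub>R y) + snd (u *\<^sub>R x + v *\<^sub>R y) \<le> 1"
      using uv by (simp add: algebra_simps)
    then show "u *\<^sub>R x + v *\<^sub>R y \<in> T" using xy uv by (simp add: T)
  qed
  have e_x: "e (x 1, x 2) = x" "(x 1, x 2) \<in> T" if "x \<in> standard_simplex p" for x
  proof -
    show ex: "e (x 1, x 2) = x"
    proof
      fix j
      have "x 0 + x 1 + x 2 = 1" "j > 2 \<Longrightarrow> x j = 0"
        using p that by (auto simp: standard_simplex_def numeral_2_eq_2)
      then show "e (x 1, x 2) j = x j" by (auto simp: e_def)
    qed
    then show "(x 1, x 2) \<in> T" using that by (simp add: T_def)
  qed
  have ec: "continuous_map (top_of_set T) (simplex_space p) e"
  proof -
    have "continuous_map (top_of_set T) euclideanreal (\<lambda>y. e y j)" for j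
      by (cases "j = 0"; cases "j = 1"; cases "j = 2") (auto simp: e_def intro!: continuous_intros)
    then show ?thesis
      by (auto simp: continuous_map_in_subtopology continuous_map_componentwise_UNIV T_def)
  qed
  have "continuous_map (top_of_set T) (top_of_set (sphere 0 1)) (\<sigma> \<circ> e)"
    by (rule continuous_map_compose[OF ec]) (use \<sigma> in \<open>simp add: singular_simplex_def circle_def\<close>)
  then have f: "continuous_on T (\<sigma> \<circ> e)" "(\<sigma> \<circ> e) \<in> T \<rightarrow> sphere 0 1"
    by (auto simp: continuous_map_in_subtopology)
  have "contractible T" using \<open>convex T\<close> by (rule convex_imp_contractible)
  moreover have "(\<sigma> \<circ> e) y \<noteq> 0" if "y \<in> T" for y using f(2) that by force
  ultimately obtain g where g: "continuous_on T g" "\<And>y. y \<in> T \<Longrightarrow> (\<sigma> \<circ> e) y = exp (g y)"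
    using continuous_logarithm_on_contractible[OF f(1)] by metis
  have cisg: "cis (Im (g y)) = \<sigma> (e y)" if "y \<in> T" for y
  proof -
    have "norm (exp (g y)) = 1" using f(2) g(2)[OF that] that by (metis Pi_iff mem_sphere_0)
    then have "Re (g y) = 0" by simp
    then show ?thesis using g(2)[OF that] by (simp add: exp_eq_polar)
  qed
  define \<tau> where "\<tau> = (\<lambda>x\<in>standard_simplex p. Im (g (x 1, x 2)))"
  have "continuous_map (simplex_space p) (top_of_set T) (\<lambda>x. (x 1, x 2))"
  proof -
    have "continuous_map (simplex_space p)
        (prod_topology euclideanreal euclideanreal) (\<lambda>x. (x 1, x 2))"
      by (intro continuous_map_pairedI continuous_map_simplex_coordinate)
    then have "continuous_map (simplex_space p) euclidean
        (\<lambda>x. (x 1, x 2) :: real \<times> real)" by simp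
    then show ?thesis using e_x(2) by (auto simp: continuous_map_in_subtopology)
  qed
  moreover have "continuous_map (top_of_set T) euclideanreal (\<lambda>y. Im (g y))"
    using g(1) by (auto intro!: continuous_intros)
  ultimately have "continuous_map (simplex_space p) euclideanreal
      ((\<lambda>y. Im (g y)) \<circ> (\<lambda>x. (x 1, x 2)))"
    by (rule continuous_map_compose)
  then have "singular_simplex p euclideanreal \<tau>"
    by (auto simp: \<tau>_def singular_simplex_def o_def)
  moreover have "simplex_map p cis \<tau> = \<sigma>"
  proof
    fix x
    show "simplex_map p cis \<tau> x = \<sigma> x"
      using \<sigma> e_x[of x] cisg[of "(x 1, x 2)"]
      by (cases "x \<in> standard_simplex p") (auto simp: simplex_map_def \<tau>_def singular_simplex_def extensional_def)
  qed
  ultimately show ?thesis using that by blast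
qed

text \<open>Two lifts of a path differ by a continuous function with values in \<open>2\<pi>\<int>\<close>.\<close>

lemma lift_increment_unique:
  assumes \<tau>: "singular_simplex 1 euclideanreal \<tau>" "singular_simplex 1 euclideanreal \<tau>'"
    and eq: "simplex_map 1 cis \<tau> = simplex_map 1 cis \<tau>'"
  shows "\<tau> (vertex 1) - \<tau> (vertex 0) = \<tau>' (vertex 1) - \<tau>' (vertex 0)"
proof -
  define e :: "real \<Rightarrow> nat \<Rightarrow> real" where "e y = (\<lambda>j. if j = 0 then 1 - y else if j = 1 then y else 0)" for y
  have eT: "e y \<in> standard_simplex 1" if "y \<in> {0..1}" for y
    using that by (auto simp: e_def standard_simplex_def)
  have ec: "continuous_map (top_of_set {0..1}) (simplex_space 1) e"
  proof -
    have "continuous_map (top_of_set {0..1}) euclideanreal (\<lambda>y. e y j)" for j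
      by (cases "j = 0"; cases "j = 1"; cases "j = 2") (auto simp: e_def intro!: continuous_intros)
    then show ?thesis using eT
      by (auto simp: continuous_map_in_subtopology continuous_map_componentwise_UNIV)
  qed
  have "continuous_map (top_of_set {0..1}) euclideanreal (\<tau> \<circ> e)"
    "continuous_map (top_of_set {0..1}) euclideanreal (\<tau>' \<circ> e)"
    by (rule continuous_map_compose[OF ec]; use \<tau> in \<open>simp add: singular_simplex_def\<close>)+
  then have c: "continuous_on {0..1} (\<lambda>y. (\<tau> (e y) - \<tau>' (e y)) / (2 * pi))"
    by (auto intro!: continuous_intros simp: o_def)
  have int: "(\<tau> (e y) - \<tau>' (e y)) / (2 * pi) \<in> \<int>" if "y \<in> {0..1}" for y
  proof -
    have "cis (\<tau> (e y)) = cis (\<tau>' (e y))"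
      using fun_cong[OF eq, of "e y"] eT[OF that] by (simp add: simplex_map_def)
    then have "cis (\<tau> (e y) - \<tau>' (e y)) = 1" by (metis cis_divide cis_neq_zero divide_self)
    then have "cos (\<tau> (e y) - \<tau>' (e y)) = 1" by (simp add: complex_eq_iff)
    then obtain k :: int where "\<tau> (e y) - \<tau>' (e y) = real_of_int k * 2 * pi" by (auto simp: cos_one_2pi_int)
    then show ?thesis by simp
  qed
  have "(\<lambda>y. (\<tau> (e y) - \<tau>' (e y)) / (2 * pi)) constant_on {0..1}"
  proof (rule continuous_discrete_range_constant[OF _ c])
    fix y :: real assume y: "y \<in> {0..1}"
    show "\<exists>d>0. \<forall>z. z \<in> {0..1} \<and> (\<tau> (e z) - \<tau>' (e z)) / (2 * pi) \<noteq> (\<tau> (e y) - \<tau>' (e y)) / (2 * pi) \<longrightarrow>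
         d \<le> norm ((\<tau> (e z) - \<tau>' (e z)) / (2 * pi) - (\<tau> (e y) - \<tau>' (e y)) / (2 * pi))"
    proof (intro exI[of _ 1] conjI allI impI)
      fix z assume z: "z \<in> {0..1} \<and> (\<tau> (e z) - \<tau>' (e z)) / (2 * pi) \<noteq> (\<tau> (e y) - \<tau>' (e y)) / (2 * pi)"
      show "1 \<le> norm ((\<tau> (e z) - \<tau>' (e z)) / (2 * pi) - (\<tau> (e y) - \<tau>' (e y)) / (2 * pi))"
        using Ints_nonzero_abs_ge1[OF Ints_diff[OF int int]] y z unfolding real_norm_def
        by (metis right_minus_eq)
    qed auto
  qed auto
  then have "(\<tau> (e 0) - \<tau>' (e 0)) / (2 * pi) = (\<tau> (e 1) - \<tau>' (e 1)) / (2 * pi)"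
    unfolding constant_on_def by (metis atLeastAtMost_iff order_refl zero_le_one)
  moreover have "e 0 = vertex 0" "e 1 = vertex 1" by (auto simp: e_def)
  ultimately show ?thesis by simp
qed

definition standard_loop :: "(nat \<Rightarrow> real) \<Rightarrow> complex"
  where "standard_loop = (\<lambda>x\<in>standard_simplex 1. cis (2 * pi * x 1))"

lemma singular_face_vertex:
  assumes "k \<le> 2" "i \<le> 1"
  shows "singular_face 2 k \<sigma> (vertex i) = \<sigma> (vertex (if i < k then i else Suc i))"
proof -
  have "simplical_face k (vertex i) = vertex (if i < k then i else Suc i)"
    by (auto simp: simplical_face_def fun_eq_iff)
  then show ?thesis using assms by (simp add: singular_face_def)
qed

text \<open>The value of the cocycle on a path is its winding number, made integral by subtracting the difference of a
discontinuous choice of the argument at the end points. It is a cocycle since the sides of a triangle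
lift together.\<close>

lemma winding_cocycle_exists:
  obtains w where "w \<in> singular_cocycle_set 1 circle" "w standard_loop = 1"
proof -
  define W where "W \<sigma> k \<longleftrightarrow> (\<exists>\<tau>. singular_simplex 1 euclideanreal \<tau> \<and> simplex_map 1 cis \<tau> = \<sigma> \<and>
     \<tau> (vertex 1) - Arg2pi (\<sigma> (vertex 1)) - (\<tau> (vertex 0) - Arg2pi (\<sigma> (vertex 0))) = 2 * pi * real_of_int k)"
    for \<sigma> k
  define w where "w = (\<lambda>\<sigma>\<in>singular_simplex_set 1 circle. SOME k. W \<sigma> k)"
  have W_ex: "\<exists>k. W \<sigma> k" if \<sigma>: "singular_simplex 1 circle \<sigma>" for \<sigma>
  proof -
    obtain \<tau> where \<tau>: "singular_simplex 1 euclideanreal \<tau>" "simplex_map 1 cis \<tau> = \<sigma>"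
      using lift_simplex[OF \<sigma>] by auto
    have "\<exists>k. \<tau> v - Arg2pi (\<sigma> v) = 2 * pi * real_of_int k" if v: "v \<in> standard_simplex 1" for v
    proof -
      have "\<sigma> v = cis (\<tau> v)" using \<tau>(2) v by (auto simp: simplex_map_def)
      moreover have "cis (Arg2pi (\<sigma> v)) = \<sigma> v" by (rule cis_Arg2pi) (simp add: \<open>\<sigma> v = cis (\<tau> v)\<close>)
      ultimately have "cis (\<tau> v - Arg2pi (\<sigma> v)) = 1" by (metis cis_divide cis_neq_zero divide_self)
      then have "cos (\<tau> v - Arg2pi (\<sigma> v)) = 1" by (simp add: complex_eq_iff)
      then show ?thesis by (auto simp: cos_one_2pi_int mult_ac)
    qed
    then obtain k l where "\<tau> (vertex 1) - Arg2pi (\<sigma> (vertex 1)) = 2 * pi * real_of_int k"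
      "\<tau> (vertex 0) - Arg2pi (\<sigma> (vertex 0)) = 2 * pi * real_of_int l"
      by (metis basis_in_standard_simplex le_refl zero_le_one)
    then have "W \<sigma> (k - l)" unfolding W_def using \<tau> by (intro exI[of _ \<tau>]) (simp add: algebra_simps)
    then show ?thesis ..
  qed
  have W_eq: "2 * pi * real_of_int (w \<sigma>) = \<tau> (vertex 1) - Arg2pi (\<sigma> (vertex 1)) - (\<tau> (vertex 0) - Arg2pi (\<sigma> (vertex 0)))"
    if \<tau>: "singular_simplex 1 euclideanreal \<tau>" "simplex_map 1 cis \<tau> = \<sigma>" for \<sigma> \<tau>
  proof -
    have \<sigma>: "singular_simplex 1 circle \<sigma>"
      using singular_simplex_simplex_map[OF \<tau>(1) continuous_map_cis] \<tau>(2) by simp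
    then have "W \<sigma> (w \<sigma>)" using someI_ex[OF W_ex[OF \<sigma>]] by (simp add: w_def)
    then obtain \<tau>' where "singular_simplex 1 euclideanreal \<tau>'" "simplex_map 1 cis \<tau>' = \<sigma>"
      "\<tau>' (vertex 1) - Arg2pi (\<sigma> (vertex 1)) - (\<tau>' (vertex 0) - Arg2pi (\<sigma> (vertex 0))) = 2 * pi * real_of_int (w \<sigma>)"
      by (auto simp: W_def)
    then show ?thesis using lift_increment_unique[of \<tau> \<tau>'] \<tau> by simp
  qed
  have "w \<in> singular_cocycle_set 1 circle"
    unfolding singular_cocycle_set_iff
  proof (intro conjI allI impI)
    show "w \<in> extensional (singular_simplex_set 1 circle)" by (simp add: w_def)
    fix \<sigma> assume \<sigma>: "singular_simplex (Suc 1) circle \<sigma>"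
    then have \<sigma>2: "singular_simplex 2 circle \<sigma>" by (simp add: numeral_2_eq_2)
    obtain \<tau> where \<tau>: "singular_simplex 2 euclideanreal \<tau>" "simplex_map 2 cis \<tau> = \<sigma>"
      using lift_simplex[OF \<sigma>2] by auto
    have f: "singular_simplex 1 euclideanreal (singular_face 2 k \<tau>)"
      "simplex_map 1 cis (singular_face 2 k \<tau>) = singular_face 2 k \<sigma>" if "k \<le> 2" for k
    proof -
      show "singular_simplex 1 euclideanreal (singular_face 2 k \<tau>)"
        using singular_simplex_singular_face[OF \<tau>(1) _ that] by simp
      show "simplex_map 1 cis (singular_face 2 k \<tau>) = singular_face 2 k \<sigma>"
        unfolding \<tau>(2)[symmetric] using that simplical_face_in_standard_simplex[of 2 k]
        by (intro ext) (auto simp: simplex_map_def singular_face_def)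
    qed
    define B where "B i = \<tau> (vertex i) - Arg2pi (\<sigma> (vertex i))" for i
    have E: "2 * pi * real_of_int (w (singular_face 2 k \<sigma>)) = B (if 1 < k then 1 else Suc 1) - B (if 0 < k then 0 else Suc 0)"
      if k: "k \<le> 2" for k
      unfolding W_eq[OF f[OF k]] singular_face_vertex[OF k order_refl] singular_face_vertex[OF k zero_le_one]
        B_def by (rule refl)
    have "2 * pi * real_of_int (w (singular_face 2 0 \<sigma>) - w (singular_face 2 1 \<sigma>) + w (singular_face 2 2 \<sigma>)) = 0"
      using E[of 0] E[of 1] E[of 2] by (simp add: algebra_simps)
    then have "w (singular_face 2 0 \<sigma>) - w (singular_face 2 1 \<sigma>) + w (singular_face 2 2 \<sigma>) = 0"
      by (simp add: of_int_eq_0_iff[symmetric] del: of_int_eq_0_iff)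
    then show "(\<Sum>k\<le>Suc 1. (-1) ^ k * w (singular_face (Suc 1) k \<sigma>)) = 0"
      by (simp add: numeral_2_eq_2)
  qed
  moreover have "w standard_loop = 1"
  proof -
    let ?\<tau> = "\<lambda>x\<in>standard_simplex 1. 2 * pi * x 1"
    have "singular_simplex 1 euclideanreal ?\<tau>"
      unfolding singular_simplex_def
      by (auto intro!: continuous_map_real_mult continuous_map_simplex_coordinate)
    moreover have "simplex_map 1 cis ?\<tau> = standard_loop"
      by (auto simp: simplex_map_def standard_loop_def)
    ultimately have "2 * pi * real_of_int (w standard_loop) = 2 * pi"
      by (subst W_eq[of ?\<tau>]) (auto simp: standard_loop_def)
    then show ?thesis by simp
  qed
  ultimately show ?thesis using that by blast
qed

text \<open>Evaluation on the loop is a homomorphism that kills coboundaries. It takes the value 1 on the winding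
cocycle, whose class is a multiple of the generator.\<close>

lemma generator_loop_nonzero:
  assumes \<phi>: "\<phi> \<in> singular_cocycle_set 1 circle"
    and gen: "subgroup_generated (cohomology_group 1 circle) {cohomology_class 1 circle \<phi>} = cohomology_group 1 circle"
  shows "\<phi> standard_loop \<noteq> 0"
proof -
  let ?C = "cochain_group 1 circle" and ?Z = "singular_cocycle_set 1 circle" and ?B = "singular_coboundary_set 1 circle"
  let ?G = "subgroup_generated ?C ?Z" and ?H = "cohomology_group 1 circle"
  interpret C: group ?C by (rule group_cochain_group)
  have "comm_group ?C"
    by (rule C.group_comm_groupI) (auto simp: mult_cochain_group add.commute)
  then interpret G: comm_group ?G by (rule C.abelian_subgroup_generated)
  have Zcar: "carrier ?G = ?Z" by (rule carrier_cocycle_group)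
  have "subgroup ?B ?G"
    by (rule C.subgroup_of_subgroup_generated)
       (use subgroup_singular_coboundary_set coboundary_imp_cocycle in \<open>auto\<close>)
  then interpret B: normal ?B ?G by (rule G.subgroup_imp_normal)
  interpret H: group ?H unfolding cohomology_group_def by (rule B.factorgroup_is_group)
  have cl: "cohomology_class 1 circle \<psi> = ?B #>\<^bsub>?G\<^esub> \<psi>" for \<psi>
    by (simp add: cohomology_class_def r_coset_def)
  have loop: "singular_simplex 1 circle standard_loop"
  proof -
    have "continuous_map (simplex_space 1) euclideanreal (\<lambda>x. 2 * pi * x 1)"
      by (intro continuous_map_real_mult continuous_map_simplex_coordinate) auto
    from continuous_map_compose[OF this continuous_map_cis]
    show ?thesis by (auto simp: singular_simplex_def standard_loop_def o_def)
  qed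
  have e: "group_hom ?G integer_group (\<lambda>\<psi>. \<psi> standard_loop)"
    unfolding group_hom_def group_hom_axioms_def
    using loop by (intro conjI G.is_group homI) (simp_all add: mult_cochain_group)
  have cH: "group_hom ?G ?H (\<lambda>\<psi>. ?B #>\<^bsub>?G\<^esub> \<psi>)"
    unfolding group_hom_def group_hom_axioms_def
    using B.r_coset_hom_Mod by (intro conjI G.is_group H.is_group) (simp add: cohomology_group_def)
  obtain w where w: "w \<in> ?Z" "w standard_loop = 1" using winding_cocycle_exists by blast
  have ZH: "cohomology_class 1 circle \<psi> \<in> carrier ?H" if "\<psi> \<in> ?Z" for \<psi>
    using group_hom.hom_closed[OF cH] that Zcar cl by simp
  have "cohomology_class 1 circle w \<in> carrier (subgroup_generated ?H {cohomology_class 1 circle \<phi>})"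
    unfolding gen using ZH[OF w(1)] .
  then obtain k :: int where "cohomology_class 1 circle w = cohomology_class 1 circle \<phi> [^]\<^bsub>?H\<^esub> k"
    using H.carrier_subgroup_generated_by_singleton[OF ZH[OF \<phi>]] by auto
  also have "\<dots> = ?B #>\<^bsub>?G\<^esub> (\<phi> [^]\<^bsub>?G\<^esub> k)"
    using group_hom.hom_int_pow[OF cH, of \<phi> k] \<phi> Zcar cl by simp
  finally have "w \<in> cohomology_class 1 circle (\<phi> [^]\<^bsub>?G\<^esub> k)"
    using cohomology_class_self[of w 1 circle] w(1) cl by (simp add: singular_cocycle_set_iff)
  then obtain \<beta> where "\<beta> \<in> ?B" "w standard_loop = \<beta> standard_loop + (\<phi> [^]\<^bsub>?G\<^esub> k) standard_loop"
    using loop unfolding cohomology_class_iff by auto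
  moreover have "\<beta> standard_loop = 0"
  proof -
    obtain \<alpha> where "\<beta> = cochain_coboundary 0 circle \<alpha>"
      using \<open>\<beta> \<in> ?B\<close> by (auto simp: singular_coboundary_set_def)
    moreover have "singular_face (Suc 0) 0 standard_loop = singular_face (Suc 0) (Suc 0) standard_loop"
      unfolding face_1_0 face_1_1 by (simp add: standard_loop_def)
    ultimately show ?thesis using loop by (simp add: cochain_coboundary_def)
  qed
  moreover have "(\<phi> [^]\<^bsub>?G\<^esub> k) standard_loop = k * \<phi> standard_loop"
    using group_hom.hom_int_pow[OF e, of \<phi> k] \<phi> Zcar by simp
  ultimately show ?thesis using w(2) by auto
qed

section \<open>The fundamental cycle of the torus\<close>

text \<open>The unit cube is cut into simplices indexed by permutations: \<open>\<rho>\<close> gives the order in which the coordinates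
are raised from 0 to 1 along the vertices, so that coordinate \<open>i\<close> of a point with barycentric
coordinates \<open>x\<close> is \<open>sum_above n (\<rho> i) x\<close>. The torus arises by identifying opposite sides of the cube.\<close>

definition sum_above :: "nat \<Rightarrow> nat \<Rightarrow> (nat \<Rightarrow> real) \<Rightarrow> real"
  where "sum_above n l x = (\<Sum>j\<in>{l<..n}. x j)"

definition torus_simplex :: "(nat \<Rightarrow> complex) \<Rightarrow> nat \<Rightarrow> (nat \<Rightarrow> nat) \<Rightarrow> (nat \<Rightarrow> real) \<Rightarrow> configuration"
  where "torus_simplex c n \<rho> = (\<lambda>x\<in>standard_simplex n. (c, \<lambda>i\<in>{..<n}. cis (2 * pi * sum_above n (\<rho> i) x)))"

lemma sum_above_face_inner:
  assumes "k < n" shows "sum_above n k (simplical_face (Suc k) x) = sum_above n (Suc k) (simplical_face (Suc k) x)"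
proof -
  have "{k<..n} = insert (Suc k) {Suc k<..n}" using assms by auto
  then show ?thesis by (simp add: sum_above_def simplical_face_def)
qed

lemma sum_above_face_0:
  "sum_above (Suc p) (Suc l) (simplical_face 0 x) = sum_above (Suc p) l (simplical_face (Suc p) x)"
proof -
  have "(\<Sum>j\<in>{Suc l<..Suc p}. x (j - 1)) = (\<Sum>j\<in>{l<..p}. x j)"
    by (rule sum.reindex_bij_witness[of _ Suc "\<lambda>j. j - 1"]) auto
  also have "\<dots> = (\<Sum>j\<in>{l<..Suc p}. if j < Suc p then x j else 0)"
    by (rule sum.mono_neutral_cong_left) auto
  finally show ?thesis by (auto simp: sum_above_def simplical_face_def intro!: sum.cong)
qed

text \<open>The cyclic permutation that relates the simplices on opposite sides of the cube.\<close>

definition rotation :: "nat \<Rightarrow> nat \<Rightarrow> nat"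
  where "rotation n l = (if l = 0 then n - 1 else if l < n then l - 1 else l)"

lemma rotation_Suc_Suc: "rotation (Suc (Suc p)) = Transposition.transpose (Suc p) p \<circ> rotation (Suc p)"
  by (auto simp: rotation_def fun_eq_iff Transposition.transpose_def)

lemma rotation_permutes: "rotation (Suc p) permutes {..<Suc p}"
proof (induction p)
  case 0
  have "rotation (Suc 0) = id" by (auto simp: rotation_def)
  then show ?case using permutes_id by metis
next
  case (Suc p)
  show ?case unfolding rotation_Suc_Suc
    by (intro permutes_compose[OF permutes_subset[OF Suc]] permutes_swap_id) auto
qed

lemma sign_rotation: "sign (rotation (Suc p)) = (-1) ^ p"
proof (induction p)
  case 0
  have "rotation (Suc 0) = id" by (auto simp: rotation_def)
  then show ?case by simp
next
  case (Suc p)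
  have "permutation (rotation (Suc p))" using rotation_permutes permutation_permutes by blast
  then show ?case unfolding rotation_Suc_Suc
    by (subst sign_compose) (simp_all add: permutation_swap_id sign_swap_id Suc)
qed

text \<open>Over face \<open>k + 1\<close> the coordinates raised in steps \<open>k\<close> and \<open>k + 1\<close> are equal.\<close>

lemma torus_simplex_inner_face:
  assumes "k < n"
  shows "singular_face (Suc n) (Suc k) (torus_simplex c (Suc n) (Transposition.transpose k (Suc k) \<circ> \<rho>)) =
    singular_face (Suc n) (Suc k) (torus_simplex c (Suc n) \<rho>)"
proof -
  have "sum_above (Suc n) (Transposition.transpose k (Suc k) l) (simplical_face (Suc k) x) = sum_above (Suc n) l (simplical_face (Suc k) x)" for l x
    using sum_above_face_inner[of k "Suc n" x] assms by (auto simp: Transposition.transpose_def)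
  then show ?thesis by (intro ext) (auto simp: singular_face_def torus_simplex_def)
qed

text \<open>Over face 0 the coordinate raised first is constantly 1, over the last face the one raised last is
constantly 0. On the circle both are the base point.\<close>

lemma torus_simplex_outer_face:
  assumes \<rho>: "\<rho> permutes {..<Suc n}"
  shows "singular_face (Suc n) (Suc n) (torus_simplex c (Suc n) (rotation (Suc n) \<circ> \<rho>)) =
    singular_face (Suc n) 0 (torus_simplex c (Suc n) \<rho>)"
proof -
  have "cis (2 * pi * sum_above (Suc n) (rotation (Suc n) l) (simplical_face (Suc n) x)) =
     cis (2 * pi * sum_above (Suc n) l (simplical_face 0 x))" if "l < Suc n" "x \<in> standard_simplex n" for l x
  proof (cases l)
    case 0
    have "{n<..Suc n} = {Suc n}" by auto
    then have "sum_above (Suc n) n (simplical_face (Suc n) x) = 0" by (simp add: sum_above_def simplical_face_def)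
    moreover have "sum_above (Suc n) 0 (simplical_face 0 x) = (\<Sum>j\<le>n. x j)"
      unfolding sum_above_def simplical_face_def
      by (rule sum.reindex_bij_witness[of _ Suc "\<lambda>j. j - 1"]) auto
    ultimately show ?thesis using that by (simp add: 0 rotation_def standard_simplex_def)
  next
    case (Suc m)
    then show ?thesis using sum_above_face_0[of n m x] that by (simp add: rotation_def)
  qed
  moreover have "\<rho> i < Suc n" if "i < Suc n" for i using permutes_in_image[OF \<rho>, of i] that by simp
  ultimately show ?thesis
    using simplical_face_in_standard_simplex[of "Suc n"]
    by (intro ext) (auto simp: singular_face_def torus_simplex_def)
qed

text \<open>The inner faces cancel in pairs, under a transposition. The first and last faces cancel under the rotation,
whose sign \<open>(-1) ^ p\<close> is opposite to the sign \<open>(-1) ^ Suc p\<close> of the last face.\<close>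

lemma torus_cycle:
  fixes \<Psi> :: "configuration cochain"
  shows "(\<Sum>\<rho> | \<rho> permutes {..<Suc p}. sign \<rho> *
     (\<Sum>k\<le>Suc p. (-1) ^ k * \<Psi> (singular_face (Suc p) k (torus_simplex c (Suc p) \<rho>)))) = 0"
proof -
  let ?P = "{\<rho>. \<rho> permutes {..<Suc p}}"
  define F where "F k \<rho> = \<Psi> (singular_face (Suc p) k (torus_simplex c (Suc p) \<rho>))" for k \<rho>
  have reindex: "(\<Sum>\<rho>\<in>?P. sign \<rho> * F k \<rho>) = sign q * (\<Sum>\<rho>\<in>?P. sign \<rho> * F k (q \<circ> \<rho>))"
    if q: "q permutes {..<Suc p}" for q k
  proof -
    have "(\<Sum>\<rho>\<in>?P. sign \<rho> * F k \<rho>) = (\<Sum>\<rho>\<in>?P. sign (q \<circ> \<rho>) * F k (q \<circ> \<rho>))"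
      by (rule setum_permutations_compose_left[OF q])
    also have "\<dots> = (\<Sum>\<rho>\<in>?P. sign q * (sign \<rho> * F k (q \<circ> \<rho>)))"
    proof (rule sum.cong[OF refl])
      fix \<rho> assume "\<rho> \<in> ?P"
      then have "permutation \<rho>" "permutation q" using q permutation_permutes by blast+
      then show "sign (q \<circ> \<rho>) * F k (q \<circ> \<rho>) = sign q * (sign \<rho> * F k (q \<circ> \<rho>))"
        by (simp only: sign_compose mult.assoc)
    qed
    finally show ?thesis by (simp add: sum_distrib_left)
  qed
  have inner: "(\<Sum>\<rho>\<in>?P. sign \<rho> * F k \<rho>) = 0" if k: "0 < k" "k < Suc p" for k
  proof -
    obtain l where l: "k = Suc l" "l < p" using k by (cases k) auto
    have q: "Transposition.transpose l (Suc l) permutes {..<Suc p}" using l by (intro permutes_swap_id) auto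
    have "(\<Sum>\<rho>\<in>?P. sign \<rho> * F k (Transposition.transpose l (Suc l) \<circ> \<rho>)) = (\<Sum>\<rho>\<in>?P. sign \<rho> * F k \<rho>)"
      using torus_simplex_inner_face[OF l(2)] by (intro sum.cong) (auto simp: F_def l)
    then show ?thesis using reindex[OF q, of k] by (simp add: sign_swap_id)
  qed
  have outer: "(\<Sum>\<rho>\<in>?P. sign \<rho> * F (Suc p) \<rho>) = (-1) ^ p * (\<Sum>\<rho>\<in>?P. sign \<rho> * F 0 \<rho>)"
  proof -
    have "(\<Sum>\<rho>\<in>?P. sign \<rho> * F (Suc p) (rotation (Suc p) \<circ> \<rho>)) = (\<Sum>\<rho>\<in>?P. sign \<rho> * F 0 \<rho>)"
      using torus_simplex_outer_face by (intro sum.cong) (auto simp: F_def)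
    then show ?thesis using reindex[OF rotation_permutes, of "Suc p"] by (simp add: sign_rotation)
  qed
  have "(\<Sum>\<rho>\<in>?P. sign \<rho> * (\<Sum>k\<le>Suc p. (-1) ^ k * F k \<rho>)) = (\<Sum>k\<le>Suc p. (-1) ^ k * (\<Sum>\<rho>\<in>?P. sign \<rho> * F k \<rho>))"
    unfolding sum_distrib_left by (subst sum.swap) (simp only: mult.left_commute)
  also have "\<dots> = (\<Sum>k\<in>{0, Suc p}. (-1) ^ k * (\<Sum>\<rho>\<in>?P. sign \<rho> * F k \<rho>))"
    by (rule sum.mono_neutral_right) (auto simp: inner)
  also have "\<dots> = 0" by (simp add: outer flip: power_add mult.assoc)
  finally show ?thesis by (simp only: F_def)
qed

section \<open>Nonvanishing for short segments\<close>

lemma continuous_map_sum_above: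
  "continuous_map (subtopology (powertop_real UNIV) S) euclideanreal (sum_above n l)"
  unfolding sum_above_def[abs_def]
  by (intro continuous_map_sum continuous_map_simplex_coordinate) auto

lemma torus_simplex_in_Seg:
  assumes mem: "\<And>u. (\<And>i. i < n \<Longrightarrow> norm (u i) = 1) \<Longrightarrow> u \<in> extensional {..<n} \<Longrightarrow> (c, u) \<in> topspace (Seg_length n r)"
  shows "singular_simplex n (Seg_length n r) (torus_simplex c n \<rho>)"
proof -
  let ?S = "simplex_space n"
  let ?u = "\<lambda>x. \<lambda>i\<in>{..<n}. cis (2 * pi * sum_above n (\<rho> i) x)"
  have pt: "(c, ?u x) \<in> topspace (Seg_length n r)" for x by (rule mem) auto
  have cc: "continuous_map ?S circle (\<lambda>x. cis (2 * pi * sum_above n (\<rho> i) x))" for i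
  proof -
    have "continuous_map ?S euclideanreal (\<lambda>x. 2 * pi * sum_above n (\<rho> i) x)"
      by (intro continuous_map_real_mult continuous_map_sum_above) auto
    from continuous_map_compose[OF this continuous_map_cis] show ?thesis by (simp add: o_def)
  qed
  have "c \<in> topspace (Conf_disk n)"
    using pt[of "\<lambda>_. 0"] by (auto simp: Seg_length_def Seg_def)
  then have "continuous_map ?S (Conf_disk n) (\<lambda>x. c)" by simp
  moreover have "continuous_map ?S (torus n) ?u"
    unfolding torus_def using cc by (auto simp: continuous_map_componentwise)
  ultimately have "continuous_map ?S (Seg n) (\<lambda>x. (c, ?u x))"
    unfolding Seg_def by (rule continuous_map_pairedI)
  then have "continuous_map ?S (Seg_length n r) (\<lambda>x. (c, ?u x))"
    using pt unfolding Seg_length_def by (auto simp: continuous_map_in_subtopology)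
  then show ?thesis by (auto simp: singular_simplex_def torus_simplex_def)
qed

text \<open>Along its \<open>i\<close>th edge a simplex of the cycle raises only the coordinate \<open>j\<close> with \<open>\<rho> j = i\<close>.\<close>

lemma angle_of_edge:
  assumes "i < n"
  shows "simplex_map 1 (\<lambda>x. snd x i) (back_face i 1 (torus_simplex c n \<rho>)) =
    (if \<rho> i = i then standard_loop else (\<lambda>x\<in>standard_simplex 1. 1))"
proof
  fix x
  show "simplex_map 1 (\<lambda>x. snd x i) (back_face i 1 (torus_simplex c n \<rho>)) x =
    (if \<rho> i = i then standard_loop else (\<lambda>x\<in>standard_simplex 1. 1)) x"
  proof (cases "x \<in> standard_simplex 1")
    case True
    define y where "y = (\<lambda>j. if j < i then 0 else x (j - i))"
    have y: "y \<in> standard_simplex n"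
      using shift_standard_simplex[OF True, of i] standard_simplex_mono[of "i + 1" n] assms
      unfolding y_def by auto
    have x: "x 0 + x 1 = 1" "\<And>j. j > 1 \<Longrightarrow> x j = 0" using True by (auto simp: standard_simplex_def)
    have ts: "sum_above n l y = (\<Sum>j\<in>{l<..n} \<inter> {i, Suc i}. y j)" for l
    proof -
      have "y j = 0" if "j \<noteq> i" "j \<noteq> Suc i" for j
      proof (cases "j < i")
        case False
        then have "j - i > 1" using that by linarith
        then show ?thesis using False x(2) by (simp add: y_def)
      qed (simp add: y_def)
      then show ?thesis unfolding sum_above_def by (intro sum.mono_neutral_right) auto
    qed
    have yi: "y i = x 0" "y (Suc i) = x 1" by (auto simp: y_def)
    have "sum_above n l y = (if l < i then 1 else if l = i then x 1 else 0)" for l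
    proof -
      consider "l < i" | "l = i" | "l > i" by linarith
      then show ?thesis
      proof cases
        case 1
        then have "{l<..n} \<inter> {i, Suc i} = {i, Suc i}" using assms by auto
        then show ?thesis using 1 x yi by (simp add: ts)
      next
        case 2
        then have "{l<..n} \<inter> {i, Suc i} = {Suc i}" using assms by auto
        then show ?thesis using 2 yi by (simp add: ts)
      next
        case 3
        then have "{l<..n} \<inter> {i, Suc i} = {}" by auto
        then show ?thesis using 3 by (simp add: ts)
      qed
    qed
    then show ?thesis using True y assms
      by (simp add: simplex_map_def back_face_def torus_simplex_def standard_loop_def flip: y_def)
  qed (simp add: simplex_map_def standard_loop_def)
qed

text \<open>The value on the fundamental cycle is the \<open>n\<close>th power of the value of \<open>\<phi>\<close> on the loop: only the identity
permutation raises coordinate \<open>i\<close> along edge \<open>i\<close> for every \<open>i\<close>.\<close>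

lemma angle_product_nonzero:
  assumes \<phi>: "\<phi> \<in> singular_cocycle_set 1 circle" and loop: "\<phi> standard_loop \<noteq> 0"
    and mem: "\<And>u. (\<And>i. i < Suc p \<Longrightarrow> norm (u i) = 1) \<Longrightarrow> u \<in> extensional {..<Suc p} \<Longrightarrow>
       (c, u) \<in> topspace (Seg_length (Suc p) r)"
  shows "angle_product \<phi> (Suc p) r \<notin> singular_coboundary_set (Suc p) (Seg_length (Suc p) r)"
proof
  let ?n = "Suc p" and ?P = "{\<rho>. \<rho> permutes {..<Suc p}}"
  let ?X = "Seg_length ?n r"
  assume "angle_product \<phi> ?n r \<in> singular_coboundary_set ?n ?X"
  then obtain \<Psi> where \<Psi>: "angle_product \<phi> ?n r = cochain_coboundary p ?X \<Psi>"
    by (auto simp: singular_coboundary_set_def)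
  have simp: "singular_simplex ?n ?X (torus_simplex c ?n \<rho>)" for \<rho>
    by (rule torus_simplex_in_Seg[OF mem])
  have "(\<Sum>\<rho>\<in>?P. sign \<rho> * angle_product \<phi> ?n r (torus_simplex c ?n \<rho>)) = 0"
    using torus_cycle[of \<Psi> p c] simp
    by (simp add: \<Psi> cochain_coboundary_def del: sum.atMost_Suc)
  moreover have "angle_product \<phi> ?n r (torus_simplex c ?n \<rho>) = (if \<rho> = id then \<phi> standard_loop ^ ?n else 0)"
    if \<rho>: "\<rho> \<in> ?P" for \<rho>
  proof -
    have c1: "\<phi> (\<lambda>x\<in>standard_simplex 1. 1) = 0"
      by (rule cocycle_1_constant[OF \<phi>]) (simp add: circle_def)
    have edge: "singular_simplex 1 ?X (back_face i 1 (torus_simplex c ?n \<rho>))" if "i < ?n" for i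
      using simp that by (rule edge_simplex)
    have "angle_product \<phi> ?n r (torus_simplex c ?n \<rho>) =
        (\<Prod>i<?n. cochain_map 1 ?X (\<lambda>x. snd x i) \<phi> (back_face i 1 (torus_simplex c ?n \<rho>)))"
      using simp by (simp only: angle_product_def edge_product_def restrict_apply mem_Collect_eq if_True)
    also have "\<dots> = (\<Prod>i<?n. if \<rho> i = i then \<phi> standard_loop else 0)"
    proof (rule prod.cong[OF refl])
      fix i assume "i \<in> {..<?n}"
      then have i: "i < ?n" by simp
      show "cochain_map 1 ?X (\<lambda>x. snd x i) \<phi> (back_face i 1 (torus_simplex c ?n \<rho>)) =
         (if \<rho> i = i then \<phi> standard_loop else 0)"
        using edge[OF i] angle_of_edge[OF i, of c \<rho>] c1 unfolding cochain_map_def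
        by (simp only: restrict_apply mem_Collect_eq if_True split: if_split) blast
    qed
    also have "\<dots> = (if \<rho> = id then \<phi> standard_loop ^ ?n else 0)"
    proof (cases "\<rho> = id")
      case False
      then obtain i where "\<rho> i \<noteq> i" by (auto simp: fun_eq_iff)
      moreover have "i < ?n" using \<rho> \<open>\<rho> i \<noteq> i\<close> permutes_not_in[of \<rho> "{..<?n}" i] by auto
      ultimately have "(\<Prod>i<?n. if \<rho> i = i then \<phi> standard_loop else 0) = 0"
        by (intro prod_zero) auto
      then show ?thesis using False by simp
    qed simp
    finally show ?thesis .
  qed
  then have "(\<Sum>\<rho>\<in>?P. sign \<rho> * angle_product \<phi> ?n r (torus_simplex c ?n \<rho>)) =
      (\<Sum>\<rho>\<in>?P. if \<rho> = id then \<phi> standard_loop ^ ?n else 0)"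
    by (intro sum.cong) auto
  moreover have "\<dots> = \<phi> standard_loop ^ ?n"
    using permutes_id[of "{..<?n}"] finite_permutations[of "{..<?n}"] by simp
  ultimately show False using loop by simp
qed

lemma fixed_centers:
  assumes "n > 0" "\<And>i. i < n \<Longrightarrow> norm (u i) = 1" "u \<in> extensional {..<n}"
  shows "((\<lambda>i\<in>{..<n}. of_real (real i / (2 * real n))), u) \<in> topspace (Seg_length n (1 / (4 * real n)))"
proof -
  let ?c = "\<lambda>i. of_real (real i / (2 * real n)) :: complex" and ?r = "1 / (4 * real n)"
  have near: "norm (z - ?c i) \<le> ?r / 2" if "z \<in> segment ?r (?c i) (u i)" "i < n" for z i
  proof -
    have "segment ?r (?c i) (u i) \<subseteq> cball (?c i) (?r / 2)"
      unfolding segment_def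
      using assms(1) assms(2)[OF that(2)] by (intro closed_segment_subset convex_cball) (auto simp: dist_norm)
    then have "z \<in> cball (?c i) (?r / 2)" using that(1) by blast
    then show ?thesis by (simp add: dist_norm norm_minus_commute)
  qed
  have nc: "norm (?c i) \<le> 1/2" if "i < n" for i
    using that by (simp add: norm_divide field_simps)
  have disk: "segment ?r (?c i) (u i) \<subseteq> cball 0 1" if "i < n" for i
  proof
    fix z assume "z \<in> segment ?r (?c i) (u i)"
    then have "norm z \<le> norm (?c i) + norm (z - ?c i)" "norm (z - ?c i) \<le> ?r / 2"
      using near[OF _ that] norm_triangle_sub by auto
    moreover have "?r / 2 \<le> 1 / 2" using assms(1) by (simp add: field_simps)
    ultimately show "z \<in> cball 0 1" using nc[OF that] by simp
  qed
  have disj: "segment ?r (?c i) (u i) \<inter> segment ?r (?c j) (u j) = {}" if "i < n" "j < n" "i \<noteq> j" for i j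
  proof (rule ccontr)
    assume "\<not> ?thesis"
    then obtain z where "z \<in> segment ?r (?c i) (u i)" "z \<in> segment ?r (?c j) (u j)" by blast
    then have "norm (?c i - ?c j) \<le> ?r"
      using near[of z i] near[of z j] that norm_triangle_ineq4[of "z - ?c j" "z - ?c i"] by simp
    moreover have "norm (?c i - ?c j) \<ge> 1 / (2 * real n)"
    proof -
      have "?c i - ?c j = of_real ((real i - real j) / (2 * real n))" by (simp add: diff_divide_distrib)
      then have "norm (?c i - ?c j) = \<bar>real i - real j\<bar> / (2 * real n)"
        by (simp only: norm_of_real abs_divide)
      moreover have "\<bar>real i - real j\<bar> \<ge> 1" using that(3) by linarith
      ultimately show ?thesis using assms(1) by (simp add: divide_right_mono)
    qed
    ultimately show False using assms(1) by (simp add: field_simps)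
  qed
  have nc1: "norm (?c i) \<le> 1" if "i < n" for i using nc[OF that] by linarith
  have "inj_on ?c {..<n}" using assms(1) by (auto simp: inj_on_def)
  then show ?thesis
    unfolding topspace_Seg_length
    using assms disk disj nc1 by (auto simp: disjoint_family_on_def inj_on_def)
qed

section \<open>The limit of the critical lengths\<close>

theorem theorem12:
  fixes d\<theta> :: "complex cochain set"
  assumes "d\<theta> \<in> carrier (cohomology_group 1 circle)"
    and "subgroup_generated (cohomology_group 1 circle) {d\<theta>} = cohomology_group 1 circle"
  shows "\<exists>L. r_crit d\<theta> \<longlonglongrightarrow> L \<and> L < 1"
proof -
  obtain \<phi> where \<phi>: "\<phi> \<in> singular_cocycle_set 1 circle" and d\<theta>: "d\<theta> = cohomology_class 1 circle \<phi>"
    using cohomology_group_elem[OF assms(1)] by blast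
  have loop: "\<phi> standard_loop \<noteq> 0"
    by (rule generator_loop_nonzero[OF \<phi>]) (use assms(2) d\<theta> in simp)
  define S where "S n = {r. 0 < r \<and> angle_product \<phi> n r \<notin> singular_coboundary_set n (Seg_length n r)}" for n
  have crit: "r_crit d\<theta> n = Sup (S n)" for n
    unfolding r_crit_def S_def d\<theta> restricted_Seg_class_trivial_iff[OF \<phi>] ..
  have decr: "S (Suc n) \<subseteq> S n" for n
    using angle_product_Suc_coboundary[OF \<phi>] by (auto simp: S_def)
  have pos: "\<exists>r\<in>S (Suc n). 0 < r" for n
  proof
    show "1 / (4 * real (Suc n)) \<in> S (Suc n)"
      unfolding S_def using angle_product_nonzero[OF \<phi> loop fixed_centers[of "Suc n"]] by simp
  qed simp
  obtain N where N: "\<And>r. r \<ge> 1 - 1/10^6 \<Longrightarrow>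
      angle_product \<phi> N r \<in> singular_coboundary_set N (Seg_length N r)"
    using angle_product_vanishes \<phi> by metis
  let ?R = "1 - 1/10^6 :: real"
  have "antimono S" using decr by (simp add: antimono_iff_le_Suc)
  then have bound: "r \<le> ?R" if "r \<in> S n" "N \<le> n" for r n
  proof -
    have "r \<in> S N" using \<open>antimono S\<close> that by (auto dest: antimonoD)
    then show ?thesis using N[of r] by (fastforce simp: S_def)
  qed
  \<comment> \<open>Only from \<open>N\<close> on are the sets \<open>S n\<close> known to be bounded.\<close>
  define f where "f k = r_crit d\<theta> (Suc (N + k))" for k
  have bdd: "bdd_above (S (Suc (N + k)))" for k using bound by (intro bdd_aboveI[of _ ?R]) auto
  have f_ge: "0 \<le> f k" for k
  proof -
    obtain r where "r \<in> S (Suc (N + k))" "0 < r" using pos by blast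
    then have "r \<le> f k" unfolding f_def crit by (intro cSup_upper bdd)
    then show ?thesis using \<open>0 < r\<close> by simp
  qed
  have f_le: "f k \<le> ?R" for k
    unfolding f_def crit using pos[of "N + k"] bound by (intro cSup_least) auto
  have "decseq f"
    unfolding decseq_Suc_iff f_def crit
  proof
    fix k
    show "Sup (S (Suc (N + Suc k))) \<le> Sup (S (Suc (N + k)))"
      using pos[of "N + Suc k"] bdd[of k] decr[of "Suc (N + k)"]
      by (intro cSup_subset_mono) auto
  qed
  then obtain L where L: "f \<longlonglongrightarrow> L" using decseq_convergent[of f 0] f_ge by blast
  have "(\<lambda>k. r_crit d\<theta> (k + Suc N)) \<longlonglongrightarrow> L"
    using L by (simp add: f_def[abs_def] add.commute)
  then have "r_crit d\<theta> \<longlonglongrightarrow> L" by (rule LIMSEQ_offset)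
  moreover have "L \<le> ?R" using L f_le by (intro LIMSEQ_le_const2[OF L]) auto
  then have "L < 1" by simp
  ultimately show ?thesis by blast
qed

end
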